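(* Let $R$ be a Noetherian ring of Krull dimension one with a unique minimal prime ideal $\mathfrak p$, suppose that $D=R/\mathfrak p$ is a principal ideal domain, and assume that $\operatorname{Min} R\subsetneq\operatorname{Ass} R$. Then the following are equivalent: (a) $R$ is iso-Artinian; (b) $\operatorname{length}_R(\mathfrak p)<\infty$; (c) $\operatorname{rank}_D(\mathfrak p/\mathfrak p^2)=0$. Equivalently, $R$ is not iso-Artinian if and only if $\operatorname{rank}_D(\mathfrak p/\mathfrak p^2)>0$.
   Context: All rings are commutative with identity and all modules are unital. A commutative ring $R$ is called iso-Artinian if for every descending chain of ideals $I_1\supseteq I_2\supseteq I_3\supseteq\cdots$ of $R$ there exists $n_0$ such that $I_n\cong I_{n_0}$ as $R$-modules for every $n\ge n_0$. $\operatorname{Min} R$ is the set of minimal prime ideals of $R$ and $\operatorname{Ass} R$ is the set of associated primes of $R$ as an $R$-module. For a module $M$ over an integral domain $D$ with fraction field $K$, $\operatorname{rank}_D M=\dim_K(M\otimes_D K)$. *)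

theory Defs
  imports
    "HOL-Algebra.Ring_Divisibility"
    "HOL-Algebra.Ideal_Product"
    "HOL-Algebra.Free_Abelian_Groups"
    "HOL-Library.Extended_Nat"
    "Jordan_Normal_Form.Missing_VectorSpace"
begin

section \<open>Primes of a commutative ring\<close>

definition min_primes :: "('a, 'b) ring_scheme \<Rightarrow> 'a set set"
  where "min_primes R =
    {p. primeideal p R \<and> (\<forall>q. primeideal q R \<and> q \<subseteq> p \<longrightarrow> q = p)}"

definition annihilator_of :: "('a, 'b) ring_scheme \<Rightarrow> ('a, 'm, 'd) module_scheme \<Rightarrow> 'm \<Rightarrow> 'a set"
  where "annihilator_of R M x = {a \<in> carrier R. a \<odot>\<^bsub>M\<^esub> x = \<zero>\<^bsub>M\<^esub>}"

definition ass_primes :: "('a, 'b) ring_scheme \<Rightarrow> ('a, 'm, 'd) module_scheme \<Rightarrow> 'a set set"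
  where "ass_primes R M = {p. primeideal p R \<and> (\<exists>x \<in> carrier M. p = annihilator_of R M x)}"

text \<open>A chain of \<open>n + 1\<close> primes has length \<open>n\<close>. As the supremum is taken in \<^typ>\<open>enat\<close>,
  the zero ring gets dimension \<open>0\<close>.\<close>
definition krull_dim :: "('a, 'b) ring_scheme \<Rightarrow> enat"
  where "krull_dim R =
    Sup {enat n | n. \<exists>P. (\<forall>i\<le>n. primeideal (P i) R) \<and> (\<forall>i<n. P i \<subset> P (Suc i))}"


section \<open>Modules\<close>

text \<open>The record type of modules extends that of rings; for a module that is not an algebra the
  fields \<^const>\<open>monoid.mult\<close> and \<^const>\<open>monoid.one\<close> carry no meaning.\<close>

definition ideal_module :: "('a, 'b) ring_scheme \<Rightarrow> 'a set \<Rightarrow> ('a, 'a) module"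
  where "ideal_module R I =
    \<lparr>carrier = I,
     monoid.mult = monoid.mult R, monoid.one = \<one>\<^bsub>R\<^esub>,
     ring.zero = \<zero>\<^bsub>R\<^esub>, ring.add = ring.add R,
     module.smult = monoid.mult R\<rparr>"

definition module_isomorphic ::
  "('a, 'b) ring_scheme \<Rightarrow> ('a, 'm, 'd) module_scheme \<Rightarrow> ('a, 'n, 'e) module_scheme \<Rightarrow> bool"
  where "module_isomorphic R M N \<longleftrightarrow>
    (\<exists>f \<in> module_hom R M N. bij_betw f (carrier M) (carrier N))"

text \<open>The length of a module, as the supremum of the lengths of its chains of submodules.\<close>
definition module_length :: "('a, 'b) ring_scheme \<Rightarrow> ('a, 'm, 'd) module_scheme \<Rightarrow> enat"
  where "module_length R M =
    Sup {enat n | n. \<exists>N. (\<forall>i\<le>n. Module.submodule (N i) R M) \<and> (\<forall>i<n. N i \<subset> N (Suc i))}"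

definition iso_artinian :: "('a, 'b) ring_scheme \<Rightarrow> bool"
  where "iso_artinian R \<longleftrightarrow>
    (\<forall>I :: nat \<Rightarrow> 'a set. (\<forall>n. ideal (I n) R) \<and> (\<forall>n. I (Suc n) \<subseteq> I n) \<longrightarrow>
      (\<exists>n0. \<forall>n\<ge>n0. module_isomorphic R (ideal_module R (I n)) (ideal_module R (I n0))))"

text \<open>The \<open>R/p\<close>-module \<open>p/p\<^sup>2\<close>: on cosets, \<open>(p + a) \<cdot> (p\<^sup>2 + x) = p\<^sup>2 + ax\<close>.\<close>
definition conormal_module :: "('a, 'b) ring_scheme \<Rightarrow> 'a set \<Rightarrow> ('a set, 'a set) module"
  where "conormal_module R p =
    \<lparr>carrier = (\<lambda>x. (p \<cdot>\<^bsub>R\<^esub> p) +>\<^bsub>R\<^esub> x) ` p,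
     monoid.mult = undefined, monoid.one = undefined,
     ring.zero = p \<cdot>\<^bsub>R\<^esub> p, ring.add = set_add R,
     module.smult = (\<lambda>A X. \<Union>a\<in>A. \<Union>x\<in>X. (p \<cdot>\<^bsub>R\<^esub> p) +>\<^bsub>R\<^esub> (a \<otimes>\<^bsub>R\<^esub> x))\<rparr>"


section \<open>The fraction field of a domain\<close>

definition frac_rel :: "('a, 'b) ring_scheme \<Rightarrow> (('a \<times> 'a) \<times> ('a \<times> 'a)) set"
  where "frac_rel D =
    {((a, b), (c, d)). a \<in> carrier D \<and> b \<in> carrier D - {\<zero>\<^bsub>D\<^esub>} \<and>
       c \<in> carrier D \<and> d \<in> carrier D - {\<zero>\<^bsub>D\<^esub>} \<and> a \<otimes>\<^bsub>D\<^esub> d = c \<otimes>\<^bsub>D\<^esub> b}"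

definition fraction :: "('a, 'b) ring_scheme \<Rightarrow> 'a \<Rightarrow> 'a \<Rightarrow> ('a \<times> 'a) set"
  where "fraction D a b = frac_rel D `` {(a, b)}"

text \<open>The fraction field, together with its structure of a \<open>D\<close>-algebra.\<close>
definition frac_field :: "('a, 'b) ring_scheme \<Rightarrow> ('a, ('a \<times> 'a) set) module"
  where "frac_field D =
    \<lparr>carrier = (carrier D \<times> (carrier D - {\<zero>\<^bsub>D\<^esub>})) // frac_rel D,
     monoid.mult = (\<lambda>X Y. \<Union>(a, b)\<in>X. \<Union>(c, d)\<in>Y. fraction D (a \<otimes>\<^bsub>D\<^esub> c) (b \<otimes>\<^bsub>D\<^esub> d)),
     monoid.one = fraction D \<one>\<^bsub>D\<^esub> \<one>\<^bsub>D\<^esub>,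
     ring.zero = fraction D \<zero>\<^bsub>D\<^esub> \<one>\<^bsub>D\<^esub>,
     ring.add = (\<lambda>X Y. \<Union>(a, b)\<in>X. \<Union>(c, d)\<in>Y.
              fraction D (a \<otimes>\<^bsub>D\<^esub> d \<oplus>\<^bsub>D\<^esub> c \<otimes>\<^bsub>D\<^esub> b) (b \<otimes>\<^bsub>D\<^esub> d)),
     module.smult = (\<lambda>r X. \<Union>(a, b)\<in>X. fraction D (r \<otimes>\<^bsub>D\<^esub> a) b)\<rparr>"


section \<open>Extension of scalars\<close>

text \<open>\<open>M \<otimes>\<^sub>D N\<close> is the quotient of the free abelian group on \<open>M \<times> N\<close> by the bilinearity
  relations below; the formal generator at \<open>(x, y)\<close> is \<^term>\<open>frag_of (x, y)\<close>.\<close>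
definition tensor_relations ::
  "('a, 'b) ring_scheme \<Rightarrow> ('a, 'm, 'd) module_scheme \<Rightarrow> ('a, 'n, 'e) module_scheme
    \<Rightarrow> ('m \<times> 'n \<Rightarrow>\<^sub>0 int) set"
  where "tensor_relations D M N =
    {frag_of (x \<oplus>\<^bsub>M\<^esub> x', y) - frag_of (x, y) - frag_of (x', y) | x x' y.
       x \<in> carrier M \<and> x' \<in> carrier M \<and> y \<in> carrier N}
  \<union> {frag_of (x, y \<oplus>\<^bsub>N\<^esub> y') - frag_of (x, y) - frag_of (x, y') | x y y'.
       x \<in> carrier M \<and> y \<in> carrier N \<and> y' \<in> carrier N}
  \<union> {frag_of (r \<odot>\<^bsub>M\<^esub> x, y) - frag_of (x, r \<odot>\<^bsub>N\<^esub> y) | r x y.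
       r \<in> carrier D \<and> x \<in> carrier M \<and> y \<in> carrier N}"

definition tensor_kernel ::
  "('a, 'b) ring_scheme \<Rightarrow> ('a, 'm, 'd) module_scheme \<Rightarrow> ('a, 'n, 'e) module_scheme
    \<Rightarrow> ('m \<times> 'n \<Rightarrow>\<^sub>0 int) set"
  where "tensor_kernel D M N =
    generate (free_Abelian_group (carrier M \<times> carrier N)) (tensor_relations D M N)"

definition tensor_group ::
  "('a, 'b) ring_scheme \<Rightarrow> ('a, 'm, 'd) module_scheme \<Rightarrow> ('a, 'n, 'e) module_scheme
    \<Rightarrow> ('m \<times> 'n \<Rightarrow>\<^sub>0 int) set monoid"
  where "tensor_group D M N =
    free_Abelian_group (carrier M \<times> carrier N) Mod tensor_kernel D M N"

text \<open>For a \<open>D\<close>-algebra \<open>K\<close>, the group \<open>M \<otimes>\<^sub>D K\<close> as a \<open>K\<close>-module: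
  \<open>k \<cdot> (x \<otimes> y) = x \<otimes> ky\<close>, extended additively.\<close>
definition base_change ::
  "('a, 'b) ring_scheme \<Rightarrow> ('a, 'm, 'd) module_scheme \<Rightarrow> ('a, 'k, 'e) module_scheme
    \<Rightarrow> ('k, ('m \<times> 'k \<Rightarrow>\<^sub>0 int) set) module"
  where "base_change D M K =
    \<lparr>carrier = carrier (tensor_group D M K),
     monoid.mult = undefined, monoid.one = undefined,
     ring.zero = \<one>\<^bsub>tensor_group D M K\<^esub>,
     ring.add = monoid.mult (tensor_group D M K),
     module.smult = (\<lambda>k C. \<Union>c\<in>C. tensor_kernel D M K
        #>\<^bsub>free_Abelian_group (carrier M \<times> carrier K)\<^esub>
          frag_extend (\<lambda>(x, y). frag_of (x, k \<otimes>\<^bsub>K\<^esub> y)) c)\<rparr>"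

text \<open>\<^const>\<open>vectorspace.dim\<close> is a natural number and is meaningful only in finite dimension.\<close>
definition vs_dim :: "('k, 'b) ring_scheme \<Rightarrow> ('k, 'v, 'd) module_scheme \<Rightarrow> enat"
  where "vs_dim K V =
    (if vectorspace.fin_dim K V then enat (vectorspace.dim K V) else \<infinity>)"

definition module_rank :: "('a, 'b) ring_scheme \<Rightarrow> ('a, 'm, 'd) module_scheme \<Rightarrow> enat"
  where "module_rank D M = vs_dim (frac_field D) (base_change D M (frac_field D))"

end

theory Submission
  imports Defs
begin

text \<open>Write \<open>D = R/p\<close>. In a ring of dimension one whose only minimal prime is \<open>p\<close>, every prime contains
  \<open>p\<close>, and a prime other than \<open>p\<close> is maximal because \<open>D\<close> is a principal ideal domain. The theorem
  compares all its conditions with one elementary statement: some \<open>s \<notin> p\<close> annihilates \<open>p\<close>.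

  \<^item> Rank. As \<open>p\<close> is finitely generated, \<open>p/p\<^sup>2\<close> has rank \<open>0\<close> iff it is torsion, that is, iff
    \<open>s p \<subseteq> p\<^sup>2\<close> for some \<open>s \<notin> p\<close> (\<open>module_rank_zero_iff\<close>). If it is torsion, then every
    \<open>x \<otimes> k = s x \<otimes> k/s\<close> vanishes. If it is not, then a submodule that is maximal among those that
    contain no multiple \<open>s x\<^sub>0\<close>, \<open>s \<notin> p\<close>, of a fixed non-torsion element \<open>x\<^sub>0\<close> gives a quotient of rank
    one, hence a linear map to the field of fractions that does not kill \<open>x\<^sub>0\<close>. Nakayama's lemma
    turns \<open>s p \<subseteq> p\<^sup>2\<close> into \<open>t p = 0\<close> with \<open>t \<notin> p\<close> (\<open>annihilated_if_torsion_conormal\<close>).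

  \<^item> Length. If \<open>s p = 0\<close>, then every associated prime of a nonzero quotient of \<open>p\<close> contains \<open>s\<close> and so
    is maximal; hence \<open>p\<close> is built from finitely many simple modules. Conversely, if \<open>p\<close> has finite
    length, then the chain \<open>d\<^sup>n p\<close> stabilises for a nonunit \<open>d\<close> of \<open>D\<close>, and Nakayama's lemma applies.

  \<^item> From iso-Artinian to torsion. For a nonzero nonunit \<open>d\<close> of \<open>D\<close> take the chain
    \<open>I\<^sub>n = p + d\<^sup>n R\<close>. A homomorphism \<open>I\<^sub>m \<rightarrow> I\<^sub>n\<close> maps \<open>p\<close> into \<open>p\<close>, so that a surjective one
    for \<open>m = n + 1\<close> gives \<open>d\<^sup>n p \<subseteq> p\<^sup>2 + d\<^sup>m p\<close>, and Nakayama's lemma modulo \<open>p\<^sup>2\<close> applies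
    (\<open>torsion_conormal_if_iso_artinian\<close>).

  \<^item> From finite length to iso-Artinian. In a descending chain \<open>I\<^sub>n\<close> the intersections
    \<open>J = I\<^sub>n \<inter> p\<close> become constant, and \<open>I\<^sub>n = J + R x\<^sub>n\<close> because \<open>D\<close> is a principal ideal domain.
    The isomorphism type of \<open>J + R x\<close> depends only on \<open>J\<close> and the multiplication \<open>p \<rightarrow> J\<close> by \<open>x\<close>,
    hence only on \<open>x\<close> modulo the annihilator of \<open>p\<close>. That annihilator has an Artinian residue ring,
    so that the \<open>x\<^sub>n\<close> finally agree there modulo \<open>J\<close> up to a unit factor
    (\<open>unit_lift_mod_ann\<close>), and a unit factor does not change the isomorphism type
    (\<open>module_isomorphic_transfer\<close>).\<close>

section \<open>Ideals of a commutative ring\<close>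

context cring
begin

lemma ideal_add_mem: "\<lbrakk>ideal I R; x \<in> I; y \<in> I\<rbrakk> \<Longrightarrow> x \<oplus> y \<in> I"
  by (simp add: additive_subgroup.a_closed ideal_def)

lemma ideal_neg_mem: "\<lbrakk>ideal I R; x \<in> I\<rbrakk> \<Longrightarrow> \<ominus> x \<in> I"
  by (simp add: additive_subgroup.a_inv_closed ideal_def)

lemma ideal_diff_mem: "\<lbrakk>ideal I R; x \<in> I; y \<in> I\<rbrakk> \<Longrightarrow> x \<ominus> y \<in> I"
  by (simp add: a_minus_def ideal_add_mem ideal_neg_mem)

lemma minus_add_cancel: "\<lbrakk>x \<in> carrier R; y \<in> carrier R\<rbrakk> \<Longrightarrow> (x \<ominus> y) \<oplus> y = x"
  by (simp add: a_minus_def a_assoc l_neg)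

lemma ideal_zero_mem: "ideal I R \<Longrightarrow> \<zero> \<in> I"
  by (simp add: additive_subgroup.zero_closed ideal_def)

lemma ideal_subset_carrier: "ideal I R \<Longrightarrow> I \<subseteq> carrier R"
  by (simp add: additive_subgroup.a_subset ideal_def)

lemma ideal_mult_mem: "\<lbrakk>ideal I R; r \<in> carrier R; x \<in> I\<rbrakk> \<Longrightarrow> r \<otimes> x \<in> I"
  by (rule ideal.I_l_closed)

lemma ideal_mult_mem_right: "\<lbrakk>ideal I R; r \<in> carrier R; x \<in> I\<rbrakk> \<Longrightarrow> x \<otimes> r \<in> I"
  by (rule ideal.I_r_closed)

lemma cring_idealI:
  assumes "I \<subseteq> carrier R" "\<zero> \<in> I"
    and "\<And>x y. \<lbrakk>x \<in> I; y \<in> I\<rbrakk> \<Longrightarrow> x \<oplus> y \<in> I"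
    and "\<And>r x. \<lbrakk>r \<in> carrier R; x \<in> I\<rbrakk> \<Longrightarrow> r \<otimes> x \<in> I"
  shows "ideal I R"
proof (rule idealI)
  show "ring R" by (rule ring_axioms)
  show "subgroup I (add_monoid R)"
  proof (rule add.subgroupI)
    fix a assume a: "a \<in> I"
    have "\<ominus> \<one> \<otimes> a \<in> I" using assms(4) a by simp
    moreover have "\<ominus> \<one> \<otimes> a = \<ominus> a" using assms(1) a by (simp add: l_minus subset_iff)
    ultimately show "\<ominus> a \<in> I" by simp
  qed (use assms in auto)
  fix a x assume ax: "a \<in> I" "x \<in> carrier R"
  then show "x \<otimes> a \<in> I" by (simp add: assms(4))
  then show "a \<otimes> x \<in> I" using ax assms(1) m_comm by (metis subsetD)
qed

lemma ideal_colon: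
  assumes "ideal L R" "s \<in> carrier R"
  shows "ideal {x \<in> carrier R. s \<otimes> x \<in> L} R"
proof (rule cring_idealI)
  fix r x assume rx: "r \<in> carrier R" "x \<in> {x \<in> carrier R. s \<otimes> x \<in> L}"
  then have "s \<otimes> (r \<otimes> x) = r \<otimes> (s \<otimes> x)" using assms(2) by (simp add: m_lcomm)
  then show "r \<otimes> x \<in> {x \<in> carrier R. s \<otimes> x \<in> L}"
    using rx assms by (simp add: ideal_mult_mem)
qed (use assms in \<open>auto simp: r_distr ideal_zero_mem intro: ideal_add_mem\<close>)

lemma ideal_scale:
  assumes I: "ideal I R" and r: "r \<in> carrier R"
  shows "ideal ((\<otimes>) r ` I) R"
proof (rule cring_idealI)
  note IC = subsetD[OF ideal_subset_carrier[OF I]]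
  show "(\<otimes>) r ` I \<subseteq> carrier R" using r IC by auto
  show "\<zero> \<in> (\<otimes>) r ` I" using r ideal_zero_mem[OF I] by (metis imageI r_null)
  show "x \<oplus> y \<in> (\<otimes>) r ` I" if "x \<in> (\<otimes>) r ` I" "y \<in> (\<otimes>) r ` I" for x y
  proof -
    obtain a b where ab: "a \<in> I" "b \<in> I" "x = r \<otimes> a" "y = r \<otimes> b" using \<open>x \<in> _\<close> \<open>y \<in> _\<close> by blast
    then have "x \<oplus> y = r \<otimes> (a \<oplus> b)" using r IC by (simp add: r_distr)
    then show ?thesis using ab ideal_add_mem[OF I] by blast
  qed
  show "t \<otimes> x \<in> (\<otimes>) r ` I" if t: "t \<in> carrier R" and "x \<in> (\<otimes>) r ` I" for t x
  proof -
    obtain a where a: "a \<in> I" "x = r \<otimes> a" using \<open>x \<in> _\<close> by blast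
    then have "t \<otimes> x = r \<otimes> (t \<otimes> a)" using r t IC by (simp add: m_lcomm)
    then show ?thesis using a t ideal_mult_mem[OF I] by blast
  qed
qed

definition adjoin :: "'a set \<Rightarrow> 'a \<Rightarrow> 'a set"
  where "adjoin L y = {l \<oplus> r \<otimes> y | l r. l \<in> L \<and> r \<in> carrier R}"

lemma adjoin_ideal:
  assumes "ideal L R" "y \<in> carrier R"
  shows "ideal (adjoin L y) R"
proof -
  have sub: "\<And>l. l \<in> L \<Longrightarrow> l \<in> carrier R"
    using assms(1) ideal_subset_carrier by auto
  show ?thesis
  proof (rule cring_idealI)
    show "adjoin L y \<subseteq> carrier R" using assms(2) sub by (auto simp: adjoin_def)
    have "\<zero> = \<zero> \<oplus> \<zero> \<otimes> y" using assms(2) by simp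
    then show "\<zero> \<in> adjoin L y" using ideal_zero_mem[OF assms(1)] unfolding adjoin_def by blast
  next
    fix u v assume "u \<in> adjoin L y" "v \<in> adjoin L y"
    then obtain l r l' r' where *: "u = l \<oplus> r \<otimes> y" "v = l' \<oplus> r' \<otimes> y" "l \<in> L" "l' \<in> L"
      "r \<in> carrier R" "r' \<in> carrier R" unfolding adjoin_def by blast
    moreover have "l \<in> carrier R" "l' \<in> carrier R" using * sub by auto
    ultimately have "u \<oplus> v = (l \<oplus> l') \<oplus> (r \<oplus> r') \<otimes> y"
      using assms(2) by algebra
    then show "u \<oplus> v \<in> adjoin L y"
      using * ideal_add_mem[OF assms(1)] unfolding adjoin_def by blast
  next
    fix t u assume t: "t \<in> carrier R" and "u \<in> adjoin L y"
    then obtain l r where *: "u = l \<oplus> r \<otimes> y" "l \<in> L" "r \<in> carrier R" unfolding adjoin_def by blast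
    moreover have "l \<in> carrier R" using * sub by auto
    ultimately have "t \<otimes> u = t \<otimes> l \<oplus> (t \<otimes> r) \<otimes> y" using assms(2) t by algebra
    then show "t \<otimes> u \<in> adjoin L y"
      using * t ideal_mult_mem[OF assms(1)] unfolding adjoin_def by blast
  qed
qed

lemma adjoin_upper:
  assumes "ideal L R" "y \<in> carrier R"
  shows "L \<subseteq> adjoin L y" "y \<in> adjoin L y"
proof
  fix l assume l: "l \<in> L"
  then have "l = l \<oplus> \<zero> \<otimes> y" using assms ideal_subset_carrier[OF assms(1)] by auto
  with l show "l \<in> adjoin L y" unfolding adjoin_def by blast
next
  have "y = \<zero> \<oplus> \<one> \<otimes> y" using assms by simp
  then show "y \<in> adjoin L y" using ideal_zero_mem[OF assms(1)] unfolding adjoin_def by blast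
qed

lemma adjoin_subset:
  assumes "ideal K R" "L \<subseteq> K" "y \<in> K"
  shows "adjoin L y \<subseteq> K"
  using assms unfolding adjoin_def by (auto intro: ideal_add_mem ideal_mult_mem)

lemma ideal_plus_memE:
  assumes "x \<in> I <+>\<^bsub>R\<^esub> J"
  obtains i j where "i \<in> I" "j \<in> J" "x = i \<oplus> j"
  using assms by (auto simp: set_add_def')

lemma ideal_plus_memI: "\<lbrakk>i \<in> I; j \<in> J\<rbrakk> \<Longrightarrow> i \<oplus> j \<in> I <+>\<^bsub>R\<^esub> J"
  by (auto simp: set_add_def')

end

section \<open>Nakayama's lemma over a Noetherian ring\<close>

context cring
begin

text \<open>A multiplicatively closed set. For \<open>s = 1\<close> it is the set \<open>1 - A\<close> of the usual lemma of Nakayama;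
  a general \<open>s\<close> allows a hypothesis \<open>s N \<subseteq> A N + L\<close>, which is Nakayama's lemma after \<open>s\<close> has been
  inverted.\<close>
definition power_minus :: "'a \<Rightarrow> 'a set \<Rightarrow> 'a set"
  where "power_minus s A = {s [^] k \<ominus> c | (k::nat) c. c \<in> A}"

lemma power_minus_carrier:
  assumes "ideal A R" "s \<in> carrier R"
  shows "power_minus s A \<subseteq> carrier R"
  using assms ideal_subset_carrier[of A] by (auto simp: power_minus_def)

lemma power_minus_one:
  assumes "ideal A R" "s \<in> carrier R"
  shows "\<one> \<in> power_minus s A"
proof -
  have "\<one> = s [^] (0::nat) \<ominus> \<zero>" using assms by (simp add: a_minus_def)
  then show ?thesis using ideal_zero_mem[OF assms(1)] unfolding power_minus_def by blast
qed

lemma power_minus_mult: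
  assumes A: "ideal A R" and s: "s \<in> carrier R" and "u \<in> power_minus s A" "v \<in> power_minus s A"
  shows "u \<otimes> v \<in> power_minus s A"
proof -
  obtain k c l d where *: "u = s [^] (k::nat) \<ominus> c" "c \<in> A" "v = s [^] (l::nat) \<ominus> d" "d \<in> A"
    using assms unfolding power_minus_def by blast
  have cd: "c \<in> carrier R" "d \<in> carrier R" using * ideal_subset_carrier[OF A] by auto
  define S T where "S = s [^] k" and "T = s [^] l"
  have ST: "S \<in> carrier R" "T \<in> carrier R" using s by (simp_all add: S_def T_def)
  have "u \<otimes> v = S \<otimes> T \<ominus> (S \<otimes> d \<oplus> T \<otimes> c \<ominus> d \<otimes> c)"
    unfolding *(1,3) S_def[symmetric] T_def[symmetric] using cd ST by algebra
  also have "S \<otimes> T = s [^] (k + l)" using s by (simp add: S_def T_def nat_pow_mult)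
  finally have "u \<otimes> v = s [^] (k + l) \<ominus> (S \<otimes> d \<oplus> T \<otimes> c \<ominus> d \<otimes> c)" .
  moreover have "S \<otimes> d \<oplus> T \<otimes> c \<ominus> d \<otimes> c \<in> A"
    using A * cd ST by (intro ideal_diff_mem ideal_add_mem ideal_mult_mem)
  ultimately show ?thesis unfolding power_minus_def by blast
qed

lemma power_minus_step:
  assumes A: "ideal A R" and s: "s \<in> carrier R" and "u \<in> power_minus s A" "a \<in> A"
  shows "u \<otimes> s \<ominus> a \<in> power_minus s A"
proof -
  obtain k c where *: "u = s [^] (k::nat) \<ominus> c" "c \<in> A" using assms unfolding power_minus_def by blast
  have ca: "c \<in> carrier R" "a \<in> carrier R" using * assms ideal_subset_carrier[OF A] by auto
  have "u \<otimes> s \<ominus> a = s [^] Suc k \<ominus> (s \<otimes> c \<oplus> a)"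
    unfolding *(1) nat_pow_Suc using nat_pow_closed[OF s, of k] s ca by algebra
  moreover have "s \<otimes> c \<oplus> a \<in> A" using A * s assms by (intro ideal_add_mem ideal_mult_mem)
  ultimately show ?thesis unfolding power_minus_def by blast
qed

text \<open>Instead of a determinant, the generators are removed one at a time. Modulo the last generator
  \<open>y\<close> the induction hypothesis yields \<open>u\<close> with \<open>u N \<subseteq> L + R y\<close>. Multiplied by \<open>u\<close>, the relation for
  \<open>s y\<close> then only involves \<open>y\<close> itself: \<open>(u s - a) y \<in> L\<close> for some \<open>a \<in> A\<close>, and
  \<open>(u s - a) u\<close> is the required multiplier.\<close>
lemma nakayama_generators:
  assumes A: "ideal A R" and s: "s \<in> carrier R" and N: "ideal N R"
    and "finite Y"
    and "ideal L R" "L \<subseteq> N" "Y \<subseteq> N"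
    and "\<And>K. \<lbrakk>ideal K R; L \<subseteq> K; Y \<subseteq> K\<rbrakk> \<Longrightarrow> N \<subseteq> K"
    and "\<And>x. x \<in> N \<Longrightarrow> s \<otimes> x \<in> (A \<cdot> N) <+>\<^bsub>R\<^esub> L"
  shows "\<exists>u \<in> power_minus s A. \<forall>x\<in>N. u \<otimes> x \<in> L"
  using assms(4-)
proof (induction Y arbitrary: L rule: finite_induct)
  case empty
  then have "N \<subseteq> L" by blast
  then show ?case
    using ideal_subset_carrier[OF N] power_minus_one[OF A s]
    by (intro bexI[of _ \<one>]) (auto simp: subset_iff)
next
  case (insert y Y)
  note NC = subsetD[OF ideal_subset_carrier[OF N]] and AC = subsetD[OF ideal_subset_carrier[OF A]]
    and LC = subsetD[OF ideal_subset_carrier[OF \<open>ideal L R\<close>]]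
    and UC = subsetD[OF power_minus_carrier[OF A s]]
  have y: "y \<in> N" "y \<in> carrier R" using insert NC by auto
  let ?L = "adjoin L y"
  have "\<exists>u \<in> power_minus s A. \<forall>x\<in>N. u \<otimes> x \<in> ?L"
  proof (rule insert.IH)
    show L': "ideal ?L R" using insert y by (simp add: adjoin_ideal)
    show "?L \<subseteq> N" using adjoin_subset[OF N] insert y by simp
    show "Y \<subseteq> N" using insert by simp
    show "N \<subseteq> K" if "ideal K R" "?L \<subseteq> K" "Y \<subseteq> K" for K
      using insert.prems(4)[OF that(1)] that adjoin_upper[OF \<open>ideal L R\<close> y(2)] by auto
    show "s \<otimes> x \<in> (A \<cdot> N) <+>\<^bsub>R\<^esub> ?L" if "x \<in> N" for x
      using insert.prems(5)[OF that] adjoin_upper(1)[OF \<open>ideal L R\<close> y(2)]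
      by (auto simp: set_add_def')
  qed
  then obtain u where u: "u \<in> power_minus s A" and uN: "\<And>x. x \<in> N \<Longrightarrow> u \<otimes> x \<in> ?L" by blast
  have uC: "u \<in> carrier R" using UC u by simp
  have prod: "\<exists>a\<in>A. u \<otimes> z \<ominus> a \<otimes> y \<in> L" if "z \<in> A \<cdot> N" for z
    using that
  proof (induction z rule: ideal_prod.induct)
    case (prod i j)
    obtain l r where lr: "u \<otimes> j = l \<oplus> r \<otimes> y" "l \<in> L" "r \<in> carrier R"
      using uN[OF prod(2)] unfolding adjoin_def by blast
    have c: "i \<in> carrier R" "j \<in> carrier R" "l \<in> carrier R" using prod lr NC AC LC by auto
    have "u \<otimes> (i \<otimes> j) = i \<otimes> (u \<otimes> j)" using c uC by (simp add: m_lcomm)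
    then have "u \<otimes> (i \<otimes> j) \<ominus> (i \<otimes> r) \<otimes> y = i \<otimes> l"
      unfolding lr using c lr(3) y(2) by algebra
    moreover have "i \<otimes> l \<in> L" using \<open>ideal L R\<close> c lr by (simp add: ideal_mult_mem)
    moreover have "i \<otimes> r \<in> A" using A prod lr by (simp add: ideal_mult_mem_right)
    ultimately show ?case by (metis (no_types))
  next
    case (sum z1 z2)
    then obtain a b where ab: "a \<in> A" "u \<otimes> z1 \<ominus> a \<otimes> y \<in> L" "b \<in> A" "u \<otimes> z2 \<ominus> b \<otimes> y \<in> L" by blast
    have c: "a \<in> carrier R" "b \<in> carrier R" "z1 \<in> carrier R" "z2 \<in> carrier R"
      using ab sum AC ideal_prod_in_carrier[OF A N] by auto
    have "u \<otimes> (z1 \<oplus> z2) \<ominus> (a \<oplus> b) \<otimes> y = (u \<otimes> z1 \<ominus> a \<otimes> y) \<oplus> (u \<otimes> z2 \<ominus> b \<otimes> y)"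
      using c uC y(2) by algebra
    then show ?case using ab A \<open>ideal L R\<close> by (metis (no_types) ideal_add_mem)
  qed
  \<comment> \<open>The relation for \<open>s y\<close>, multiplied by \<open>u\<close>, becomes a relation for \<open>y\<close> alone modulo \<open>L\<close>.\<close>
  obtain z l where zl: "z \<in> A \<cdot> N" "l \<in> L" "s \<otimes> y = z \<oplus> l"
    using insert.prems(5)[OF y(1)] by (rule ideal_plus_memE)
  obtain a where a: "a \<in> A" "u \<otimes> z \<ominus> a \<otimes> y \<in> L" using prod[OF zl(1)] by blast
  have c: "a \<in> carrier R" "z \<in> carrier R" "l \<in> carrier R"
    using a zl AC LC ideal_prod_in_carrier[OF A N] by auto
  define v where "v = u \<otimes> s \<ominus> a"
  have v: "v \<in> power_minus s A" unfolding v_def by (rule power_minus_step[OF A s u a(1)])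
  have vC: "v \<in> carrier R" using v UC by simp
  have "v \<otimes> y = u \<otimes> (s \<otimes> y) \<ominus> a \<otimes> y" unfolding v_def using uC s c y(2) by algebra
  also have "\<dots> = (u \<otimes> z \<ominus> a \<otimes> y) \<oplus> u \<otimes> l" unfolding zl using uC c y(2) by algebra
  finally have vy: "v \<otimes> y \<in> L"
    using a uC zl \<open>ideal L R\<close> by (simp add: ideal_add_mem ideal_mult_mem)
  have "(v \<otimes> u) \<otimes> x \<in> L" if "x \<in> N" for x
  proof -
    obtain m r where lr: "u \<otimes> x = m \<oplus> r \<otimes> y" "m \<in> L" "r \<in> carrier R"
      using uN[OF \<open>x \<in> N\<close>] unfolding adjoin_def by blast
    have "(v \<otimes> u) \<otimes> x = v \<otimes> (u \<otimes> x)" using vC uC NC[OF that] by (simp add: m_assoc)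
    also have "\<dots> = v \<otimes> m \<oplus> r \<otimes> (v \<otimes> y)" unfolding lr using vC lr LC y(2) by algebra
    finally show ?thesis
      using \<open>ideal L R\<close> vC lr vy by (simp add: ideal_add_mem ideal_mult_mem)
  qed
  then show ?case using power_minus_mult[OF A s v u] by blast
qed

end

locale noetherian_cring = cring R + noetherian_ring R for R (structure)
begin

lemma maximal_ideal_in:
  assumes "\<And>I. I \<in> S \<Longrightarrow> ideal I R" "S \<noteq> {}"
  obtains M where "M \<in> S" "\<And>I. \<lbrakk>I \<in> S; M \<subseteq> I\<rbrakk> \<Longrightarrow> I = M"
proof -
  have "\<exists>M\<in>S. \<forall>X\<in>S. M \<subseteq> X \<longrightarrow> X = M"
  proof (rule subset_Zorn)
    fix C assume C: "subset.chain S C"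
    show "\<exists>U\<in>S. \<forall>X\<in>C. X \<subseteq> U"
    proof (cases "C = {}")
      case True
      then show ?thesis using assms(2) by auto
    next
      case False
      have "subset.chain {I. ideal I R} C"
        using C assms(1) unfolding pred_on.chain_def by auto
      then have "\<Union>C \<in> C" using ideal_chain_is_trivial False by simp
      moreover have "C \<subseteq> S" using C unfolding pred_on.chain_def by simp
      ultimately show ?thesis by blast
    qed
  qed
  then show thesis using that by blast
qed

lemma finite_generators:
  assumes "ideal N R"
  obtains Y where "finite Y" "Y \<subseteq> N" "\<And>K. \<lbrakk>ideal K R; Y \<subseteq> K\<rbrakk> \<Longrightarrow> N \<subseteq> K"
  using finetely_gen[OF assms] genideal_self genideal_minimal by metis

lemma nakayama:
  assumes A: "ideal A R" and s: "s \<in> carrier R" and N: "ideal N R" and L: "ideal L R" "L \<subseteq> N"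
    and "\<And>x. x \<in> N \<Longrightarrow> s \<otimes> x \<in> (A \<cdot> N) <+>\<^bsub>R\<^esub> L"
  obtains k :: nat and c where "c \<in> A" "\<And>x. x \<in> N \<Longrightarrow> (s [^] k \<ominus> c) \<otimes> x \<in> L"
proof -
  obtain Y where Y: "finite Y" "Y \<subseteq> N" "\<And>K. \<lbrakk>ideal K R; Y \<subseteq> K\<rbrakk> \<Longrightarrow> N \<subseteq> K"
    using finite_generators[OF N] by blast
  have "\<exists>u \<in> power_minus s A. \<forall>x\<in>N. u \<otimes> x \<in> L"
    by (rule nakayama_generators[OF A s N Y(1) L Y(2)]) (use Y(3) assms(6) in auto)
  then show thesis using that unfolding power_minus_def by blast
qed

end

section \<open>Noetherian rings of dimension one over a principal ideal domain\<close>

text \<open>What the argument needs to know about \<open>R\<close> and \<open>p\<close>: \<open>p\<close> is the smallest prime but not the only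
  one, and \<open>R/p\<close> is a principal ideal ring. The last property is expressed by elements of \<open>R\<close>, which
  keeps quotient rings out of the ideal theory.\<close>
locale one_dim_pid = noetherian_cring R + primeideal p R for R (structure) and p +
  assumes prime_contains: "primeideal q R \<Longrightarrow> p \<subseteq> q"
    and not_maximal: "\<exists>q. primeideal q R \<and> p \<subset> q"
    and principal_mod: "\<lbrakk>ideal I R; p \<subseteq> I\<rbrakk> \<Longrightarrow> \<exists>t\<in>I. \<forall>x\<in>I. \<exists>r\<in>carrier R. x \<ominus> r \<otimes> t \<in> p"
begin

lemma p_ideal: "ideal p R"
  by (rule is_ideal)

lemma one_notin: "\<one> \<notin> p"
  using one_imp_carrier I_notcarr by blast

lemma mult_notin: "\<lbrakk>a \<in> carrier R - p; b \<in> carrier R - p\<rbrakk> \<Longrightarrow> a \<otimes> b \<in> carrier R - p"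
  using I_prime by blast

lemma pow_notin: "a \<in> carrier R - p \<Longrightarrow> a [^] (n::nat) \<in> carrier R - p"
  by (induction n) (simp_all add: one_notin mult_notin del: Diff_iff, simp add: one_notin)

text \<open>Any element of a prime above \<open>p\<close> that is not in \<open>p\<close> is a nonzero nonunit of the domain \<open>R/p\<close>.\<close>
lemma nonunit_mod:
  obtains d where "d \<in> carrier R - p" "\<And>c. c \<in> carrier R \<Longrightarrow> \<one> \<ominus> c \<otimes> d \<in> carrier R - p"
proof -
  obtain q where q: "primeideal q R" "p \<subset> q" using not_maximal by blast
  interpret q: primeideal q R by (rule q(1))
  obtain d where d: "d \<in> q" "d \<notin> p" using q by blast
  have dC: "d \<in> carrier R" using d ideal_subset_carrier[OF q.is_ideal] by auto
  have "\<one> \<ominus> c \<otimes> d \<notin> p" if c: "c \<in> carrier R" for c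
  proof
    assume "\<one> \<ominus> c \<otimes> d \<in> p"
    then have "(\<one> \<ominus> c \<otimes> d) \<oplus> c \<otimes> d \<in> q"
      using q d c q.is_ideal by (intro ideal_add_mem ideal_mult_mem) auto
    moreover have "(\<one> \<ominus> c \<otimes> d) \<oplus> c \<otimes> d = \<one>" using c dC by algebra
    ultimately show False using q.one_imp_carrier q.I_notcarr by simp
  qed
  then show thesis using that[of d] d dC by blast
qed

text \<open>The usual proof for a principal ideal domain: modulo \<open>p\<close>, let \<open>t\<close> generate \<open>q\<close> and \<open>t'\<close> generate
  \<open>q + r R\<close>. Then \<open>t = v t'\<close> with \<open>t' \<notin> q\<close>, so \<open>v\<close> lies in \<open>q\<close> and is a multiple \<open>w t\<close> of \<open>t\<close>;
  cancelling \<open>t\<close> in \<open>t = w t t'\<close> makes \<open>t'\<close> a unit.\<close>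
lemma prime_above_maximal:
  assumes q: "primeideal q R" "q \<noteq> p" and r: "r \<in> carrier R - q"
  obtains v where "v \<in> carrier R" "\<one> \<ominus> v \<otimes> r \<in> q"
proof -
  interpret q: primeideal q R by (rule q(1))
  have pq: "p \<subset> q" using prime_contains[OF q(1)] q(2) by blast
  note qC = subsetD[OF ideal_subset_carrier[OF q.is_ideal]]
  obtain t where t: "t \<in> q" "\<And>x. x \<in> q \<Longrightarrow> \<exists>r\<in>carrier R. x \<ominus> r \<otimes> t \<in> p"
    using principal_mod[OF q.is_ideal] pq by blast
  have tC: "t \<in> carrier R" using t qC by simp
  have "t \<notin> p"
  proof
    assume tp: "t \<in> p"
    have "x \<in> p" if x: "x \<in> q" for x
    proof -
      obtain r where r: "r \<in> carrier R" "x \<ominus> r \<otimes> t \<in> p" using t(2)[OF x] by blast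
      have "x = (x \<ominus> r \<otimes> t) \<oplus> r \<otimes> t" using r qC[OF x] tC by algebra
      then show ?thesis using r tp p_ideal by (metis ideal_add_mem ideal_mult_mem)
    qed
    then show False using pq by blast
  qed
  let ?I = "adjoin q r"
  have rC: "r \<in> carrier R" using r by simp
  have I: "ideal ?I R" "q \<subseteq> ?I" "r \<in> ?I"
    using adjoin_ideal[OF q.is_ideal rC] adjoin_upper[OF q.is_ideal rC] by auto
  note IC = subsetD[OF ideal_subset_carrier[OF I(1)]]
  obtain t' where t': "t' \<in> ?I" "\<And>x. x \<in> ?I \<Longrightarrow> \<exists>r\<in>carrier R. x \<ominus> r \<otimes> t' \<in> p"
    using principal_mod[OF I(1)] I(2) pq by blast
  have t'C: "t' \<in> carrier R" using t' IC by simp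
  have "t' \<notin> q"
  proof
    assume tq: "t' \<in> q"
    obtain b where b: "b \<in> carrier R" "r \<ominus> b \<otimes> t' \<in> p" using t'(2)[OF I(3)] by blast
    have "r = (r \<ominus> b \<otimes> t') \<oplus> b \<otimes> t'" using b rC t'C by algebra
    moreover have "\<dots> \<in> q" using b pq tq q.is_ideal by (intro ideal_add_mem ideal_mult_mem) auto
    ultimately show False using r by simp
  qed
  obtain v where v: "v \<in> carrier R" "t \<ominus> v \<otimes> t' \<in> p" using t'(2) I(2) t(1) by blast
  have "v \<otimes> t' = t \<ominus> (t \<ominus> v \<otimes> t')" using v t'C tC by algebra
  also have "\<dots> \<in> q" by (rule ideal_diff_mem[OF q.is_ideal t(1)]) (use v(2) pq in blast)
  finally have "v \<in> q" using q.I_prime[OF v(1) t'C] \<open>t' \<notin> q\<close> by blast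
  then obtain w where w: "w \<in> carrier R" "v \<ominus> w \<otimes> t \<in> p" using t(2) by blast
  have "t \<otimes> (\<one> \<ominus> w \<otimes> t') = (t \<ominus> v \<otimes> t') \<oplus> t' \<otimes> (v \<ominus> w \<otimes> t)"
    using t'C tC w v(1) by algebra
  also have "\<dots> \<in> p" using v w t'C p_ideal by (intro ideal_add_mem ideal_mult_mem)
  finally have "\<one> \<ominus> w \<otimes> t' \<in> p"
    using I_prime[OF tC, of "\<one> \<ominus> w \<otimes> t'"] \<open>t \<notin> p\<close> w t'C by simp
  then have 1: "\<one> \<ominus> w \<otimes> t' \<in> ?I" using I pq by auto
  have "\<one> = (\<one> \<ominus> w \<otimes> t') \<oplus> w \<otimes> t'" using w t'C by algebra
  also have "\<dots> \<in> ?I" using 1 w t' I(1) by (intro ideal_add_mem ideal_mult_mem)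
  finally obtain l a where la: "\<one> = l \<oplus> a \<otimes> r" "l \<in> q" "a \<in> carrier R"
    unfolding adjoin_def by blast
  have "\<one> \<ominus> a \<otimes> r = l" unfolding la(1) using la(2,3) qC[OF la(2)] rC by algebra
  then show thesis using that la by simp
qed

text \<open>A finitely generated torsion module has a nonzero annihilator in the domain: multiply the
  annihilators of the generators.\<close>
lemma common_multiplier:
  assumes N: "ideal N R" and L: "ideal L R"
    and loc: "\<And>x. x \<in> N \<Longrightarrow> \<exists>s\<in>carrier R - p. s \<otimes> x \<in> L"
  shows "\<exists>s\<in>carrier R - p. \<forall>x\<in>N. s \<otimes> x \<in> L"
proof -
  obtain Y where Y: "finite Y" "Y \<subseteq> N" "\<And>K. \<lbrakk>ideal K R; Y \<subseteq> K\<rbrakk> \<Longrightarrow> N \<subseteq> K"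
    using finite_generators[OF N] by blast
  note NC = subsetD[OF ideal_subset_carrier[OF N]]
  have "\<exists>s\<in>carrier R - p. \<forall>x\<in>Y. s \<otimes> x \<in> L"
    using Y(1,2)
  proof (induction Y rule: finite_induct)
    case empty
    then show ?case using one_notin by auto
  next
    case (insert y Y)
    then obtain s where s: "s \<in> carrier R - p" "\<forall>x\<in>Y. s \<otimes> x \<in> L" by blast
    obtain t where t: "t \<in> carrier R - p" "t \<otimes> y \<in> L" using loc insert by blast
    have "(s \<otimes> t) \<otimes> x \<in> L" if "x \<in> insert y Y" for x
    proof -
      have xC: "x \<in> carrier R" using that insert NC by auto
      show ?thesis
      proof (cases "x = y")
        case True
        have "(s \<otimes> t) \<otimes> x = s \<otimes> (t \<otimes> x)" using s t xC by (simp add: m_assoc)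
        then show ?thesis using True t s L by (simp add: ideal_mult_mem)
      next
        case False
        have "(s \<otimes> t) \<otimes> x = t \<otimes> (s \<otimes> x)" using s t xC by (simp add: m_assoc m_lcomm)
        then show ?thesis using False that t s L by (simp add: ideal_mult_mem)
      qed
    qed
    then show ?case using mult_notin[OF s(1) t(1)] by blast
  qed
  then obtain s where s: "s \<in> carrier R - p" "\<forall>x\<in>Y. s \<otimes> x \<in> L" by blast
  have "N \<subseteq> {x \<in> carrier R. s \<otimes> x \<in> L}"
    by (rule Y(3)[OF ideal_colon[OF L]]) (use s Y(2) NC in auto)
  then show ?thesis using s by blast
qed

text \<open>Nakayama's lemma with \<open>N = A = p\<close> and \<open>L = 0\<close>. The multiplier \<open>s\<^sup>k - c\<close> lies outside \<open>p\<close> because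
  \<open>c \<in> p\<close> and \<open>s \<notin> p\<close>.\<close>
lemma annihilated_if_torsion_conormal:
  assumes "s \<in> carrier R - p" "\<And>x. x \<in> p \<Longrightarrow> s \<otimes> x \<in> p \<cdot> p"
  shows "\<exists>s\<in>carrier R - p. \<forall>x\<in>p. s \<otimes> x = \<zero>"
proof -
  have *: "s \<otimes> x \<in> p \<cdot> p <+>\<^bsub>R\<^esub> {\<zero>}" if "x \<in> p" for x
  proof -
    have "s \<otimes> x \<oplus> \<zero> \<in> p \<cdot> p <+>\<^bsub>R\<^esub> {\<zero>}" using assms(2)[OF that] by (intro ideal_plus_memI) auto
    then show ?thesis using assms(1) that Icarr by simp
  qed
  obtain k c where c: "c \<in> p" "\<And>x. x \<in> p \<Longrightarrow> (s [^] (k::nat) \<ominus> c) \<otimes> x \<in> {\<zero>}"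
    by (rule nakayama[OF p_ideal _ p_ideal zeroideal _ *])
      (use assms(1) ideal_zero_mem[OF p_ideal] in auto)
  have sk: "s [^] k \<in> carrier R - p" using pow_notin assms(1) by blast
  have cC: "c \<in> carrier R" using c(1) Icarr by simp
  have "s [^] k \<ominus> c \<notin> p"
  proof
    assume "s [^] k \<ominus> c \<in> p"
    then have "(s [^] k \<ominus> c) \<oplus> c \<in> p" using c p_ideal by (intro ideal_add_mem)
    moreover have "(s [^] k \<ominus> c) \<oplus> c = s [^] k" using sk cC by (simp add: minus_add_cancel)
    ultimately show False using sk by simp
  qed
  then show ?thesis using c sk cC by (intro bexI[of _ "s [^] k \<ominus> c"]) auto
qed

end

section \<open>Length and chains of ideals\<close>

context cring
begin

definition ideal_chain :: "'a set \<Rightarrow> nat \<Rightarrow> (nat \<Rightarrow> 'a set) \<Rightarrow> bool"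
  where "ideal_chain A n N \<longleftrightarrow>
    (\<forall>i\<le>n. ideal (N i) R \<and> N i \<subseteq> A) \<and> (\<forall>i<n. N i \<subset> N (Suc i))"

text \<open>Finite length of the module \<open>A\<close>, see \<open>module_length_finite_iff\<close> below.\<close>
definition bounded_chains :: "'a set \<Rightarrow> bool"
  where "bounded_chains A \<longleftrightarrow> (\<exists>m. \<forall>n N. ideal_chain A n N \<longrightarrow> n \<le> m)"

lemma submodule_ideal_module_iff:
  assumes "ideal A R"
  shows "Module.submodule N R (ideal_module R A) \<longleftrightarrow> ideal N R \<and> N \<subseteq> A"
proof -
  interpret A: ideal A R by (rule assms)
  have m: "\<And>x y. x \<oplus>\<^bsub>ideal_module R A\<^esub> y = x \<oplus> y" "\<And>x y. x \<odot>\<^bsub>ideal_module R A\<^esub> y = x \<otimes> y"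
    "carrier (ideal_module R A) = A" "\<zero>\<^bsub>ideal_module R A\<^esub> = \<zero>"
    by (simp_all add: ideal_module_def)
  have sub: "subgroup A (add_monoid R)" by (rule A.a_subgroup)
  show ?thesis
  proof
    assume "Module.submodule N R (ideal_module R A)"
    then interpret N: Module.submodule N R "ideal_module R A" .
    have NA: "N \<subseteq> A" using N.subset by (simp add: m)
    have "ideal N R"
    proof (rule cring_idealI)
      show "N \<subseteq> carrier R" using NA A.a_subset by blast
      show "\<zero> \<in> N" using N.one_closed by (simp add: m)
      show "x \<oplus> y \<in> N" if "x \<in> N" "y \<in> N" for x y using N.m_closed[OF that] by (simp add: m)
      show "r \<otimes> x \<in> N" if "r \<in> carrier R" "x \<in> N" for r x
        using N.smult_closed[OF that] by (simp add: m)
    qed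
    then show "ideal N R \<and> N \<subseteq> A" using NA by simp
  next
    assume N: "ideal N R \<and> N \<subseteq> A"
    then interpret N: ideal N R by simp
    have "subgroup N ((add_monoid R)\<lparr>carrier := A\<rparr>)"
      by (rule group.subgroup_incl[OF add.is_group N.a_subgroup sub]) (use N in simp)
    then have "subgroup N (add_monoid (ideal_module R A))"
      unfolding subgroup_def m_inv_def by (simp add: ideal_module_def)
    then show "Module.submodule N R (ideal_module R A)"
      by (rule Module.submodule.intro)
        (use N.I_l_closed in \<open>simp add: Module.submodule_axioms_def m\<close>)
  qed
qed

lemma module_length_finite_iff:
  assumes "ideal A R"
  shows "module_length R (ideal_module R A) < \<infinity> \<longleftrightarrow> bounded_chains A"
proof -
  let ?S = "{enat n |n. \<exists>N. ideal_chain A n N}"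
  have len: "module_length R (ideal_module R A) = Sup ?S"
    unfolding module_length_def ideal_chain_def submodule_ideal_module_iff[OF assms] by simp
  show ?thesis
  proof
    assume "module_length R (ideal_module R A) < \<infinity>"
    then obtain m where m: "Sup ?S = enat m" unfolding len by auto
    have "n \<le> m" if "ideal_chain A n N" for n N
    proof -
      have "enat n \<le> Sup ?S" using that by (intro Sup_upper) auto
      then show ?thesis using m by simp
    qed
    then show "bounded_chains A" unfolding bounded_chains_def by blast
  next
    assume "bounded_chains A"
    then obtain m where "\<And>n N. ideal_chain A n N \<Longrightarrow> n \<le> m" unfolding bounded_chains_def by blast
    then have "Sup ?S \<le> enat m" by (intro Sup_least) auto
    then have "Sup ?S < \<infinity>" by (rule order_le_less_trans) simp
    then show "module_length R (ideal_module R A) < \<infinity>" unfolding len .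
  qed
qed

text \<open>A descending sequence that moves infinitely often contains strict chains of every length.\<close>
lemma bounded_chains_dcc:
  assumes "bounded_chains A"
    and J: "\<And>n. ideal (J n) R" "\<And>n. J n \<subseteq> A" "\<And>n. J (Suc n) \<subseteq> J n"
  shows "\<exists>n0. \<forall>n\<ge>n0. J n = J n0"
proof (rule ccontr)
  assume "\<nexists>n0. \<forall>n\<ge>n0. J n = J n0"
  then have "\<forall>n. \<exists>m. m \<ge> n \<and> J m \<noteq> J n" by blast
  then obtain f where f: "\<And>n. f n \<ge> n" "\<And>n. J (f n) \<noteq> J n" by metis
  have dec: "J m \<subseteq> J n" if "n \<le> m" for m n
    using that J(3) lift_Suc_antimono_le by blast
  define g where "g i = (f ^^ i) 0" for i
  have g: "J (g (Suc i)) \<subset> J (g i)" for i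
    using f[of "g i"] dec[of "g i" "f (g i)"] by (auto simp: g_def)
  obtain m where m: "\<And>n N. ideal_chain A n N \<Longrightarrow> n \<le> m"
    using assms(1) unfolding bounded_chains_def by blast
  have "ideal_chain A (Suc m) (\<lambda>i. J (g (Suc m - i)))"
    unfolding ideal_chain_def
  proof (intro conjI allI impI)
    fix i assume "i < Suc m"
    then have "Suc m - i = Suc (Suc m - Suc i)" by simp
    then show "J (g (Suc m - i)) \<subset> J (g (Suc m - Suc i))" using g by metis
  qed (use J in auto)
  then show False using m by fastforce
qed

text \<open>The length grows by at most one if a simple module \<open>A'/A\<close> is put on top of \<open>A\<close>. Intersecting a
  strict chain with \<open>A\<close> loses at most one inclusion, namely at the first member that is not
  contained in \<open>A\<close>: once \<open>B\<close> is not contained in \<open>A\<close>, simplicity gives \<open>A' = A + B\<close>, and by the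
  modular law a bigger ideal must have a bigger intersection with \<open>A\<close>.\<close>
lemma bounded_chains_simple_step:
  assumes A: "ideal A R" "ideal A' R" "A \<subseteq> A'" and b: "bounded_chains A"
    and simple: "\<And>B x. \<lbrakk>ideal B R; B \<subseteq> A'; \<not> B \<subseteq> A; x \<in> A'\<rbrakk> \<Longrightarrow> \<exists>y\<in>B. x \<ominus> y \<in> A"
  shows "bounded_chains A'"
proof -
  obtain m where m: "\<And>n N. ideal_chain A n N \<Longrightarrow> n \<le> m"
    using b unfolding bounded_chains_def by blast
  have grow: "B \<inter> A \<subset> C \<inter> A"
    if B: "ideal B R" "\<not> B \<subseteq> A" and C: "ideal C R" "C \<subseteq> A'" and BC: "B \<subset> C" for B C
  proof -
    have "C \<subseteq> B" if eq: "B \<inter> A = C \<inter> A"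
    proof
      fix x assume x: "x \<in> C"
      obtain y where y: "y \<in> B" "x \<ominus> y \<in> A" using simple[of B x] B C BC x by blast
      have "x \<ominus> y \<in> C" using x y BC C by (intro ideal_diff_mem) auto
      then have "x \<ominus> y \<in> B" using eq y by blast
      then have "(x \<ominus> y) \<oplus> y \<in> B" using y B by (intro ideal_add_mem)
      moreover have "(x \<ominus> y) \<oplus> y = x"
        using x y ideal_subset_carrier[OF B(1)] ideal_subset_carrier[OF C(1)]
        by (simp add: subset_iff minus_add_cancel)
      ultimately show "x \<in> B" by simp
    qed
    then show ?thesis using BC by blast
  qed
  have "n \<le> Suc m" if ch: "ideal_chain A' n N" for n N
  proof (cases "n > 0 \<and> (\<exists>j\<le>n. \<not> N j \<subseteq> A)")
    case False
    then consider "n = 0" | "\<forall>j\<le>n. N j \<subseteq> A" by blast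
    then show ?thesis
    proof cases
      case 2
      then have "ideal_chain A n N" using ch unfolding ideal_chain_def by blast
      then show ?thesis using m by fastforce
    qed simp
  next
    case True
    define j where "j = (LEAST j. \<not> N j \<subseteq> A)"
    obtain j' where j': "j' \<le> n" "\<not> N j' \<subseteq> A" using True by blast
    have j: "\<not> N j \<subseteq> A" unfolding j_def by (rule LeastI[of "\<lambda>j. \<not> N j \<subseteq> A", OF j'(2)])
    have below: "N i \<subseteq> A" if "i < j" for i
      using not_less_Least[of i "\<lambda>j. \<not> N j \<subseteq> A"] that unfolding j_def by simp
    have str: "N i \<subset> N (Suc i)" if "i < n" for i using ch that unfolding ideal_chain_def by blast
    have N: "ideal (N i) R" "N i \<subseteq> A'" if "i \<le> n" for i
      using ch that unfolding ideal_chain_def by auto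
    have mono: "N i \<subseteq> N k" if "i \<le> k" "k \<le> n" for i k
      using that
    proof (induction k rule: dec_induct)
      case (step k)
      then show ?case using str[of k] by auto
    qed simp
    have above: "\<not> N i \<subseteq> A" if "j \<le> i" "i \<le> n" for i
      using mono[OF that] j by blast
    \<comment> \<open>The index \<open>j\<close> is skipped, since \<open>N (j - 1)\<close> and \<open>N j\<close> may have the same intersection with \<open>A\<close>.\<close>
    define M where "M i = N (if i < j then i else Suc i) \<inter> A" for i
    have "ideal_chain A (n - 1) M"
      unfolding ideal_chain_def
    proof (intro conjI allI impI)
      fix i assume i: "i \<le> n - 1"
      show "M i \<subseteq> A" by (simp add: M_def)
      show "ideal (M i) R"
      proof -
        have "0 < n" using True by simp
        then have "(if i < j then i else Suc i) \<le> n" using i \<open>0 < n\<close> by auto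
        then show ?thesis unfolding M_def by (intro i_intersect A(1) N(1))
      qed
    next
      fix i assume i: "i < n - 1"
      show "M i \<subset> M (Suc i)"
      proof (cases "Suc i < j")
        case True
        then have "M i = N i" "M (Suc i) = N (Suc i)"
          using below[of i] below[of "Suc i"] by (simp_all add: M_def Int_absorb2)
        then show ?thesis using str[of i] i by simp
      next
        case False
        have top: "N (Suc i) \<inter> A \<subset> N (Suc (Suc i)) \<inter> A"
        proof (rule grow)
          show "ideal (N (Suc i)) R" "ideal (N (Suc (Suc i))) R" "N (Suc (Suc i)) \<subseteq> A'"
            using i N by auto
          show "\<not> N (Suc i) \<subseteq> A" using above[of "Suc i"] False i by simp
          show "N (Suc i) \<subset> N (Suc (Suc i))" using str[of "Suc i"] i by simp
        qed
        have "N (Suc (Suc i)) \<inter> A = M (Suc i)" using False by (simp add: M_def)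
        moreover have "M i \<subseteq> N (Suc i) \<inter> A"
        proof (cases "i < j")
          case True
          then have "M i = N i \<inter> A" by (simp add: M_def)
          moreover have "N i \<subset> N (Suc i)" using str[of i] i by simp
          ultimately show ?thesis by blast
        qed (simp add: M_def)
        ultimately show ?thesis using top by (metis subset_psubset_trans)
      qed
    qed
    then have "n - 1 \<le> m" by (rule m)
    then show ?thesis by simp
  qed
  then show ?thesis unfolding bounded_chains_def by blast
qed

end

section \<open>Finite length and annihilators of the smallest prime\<close>

context one_dim_pid
begin

lemma p_carrier: "x \<in> p \<Longrightarrow> x \<in> carrier R"
  by (rule Icarr)

text \<open>The hypothesis says that \<open>N = d\<^sup>n p + L\<close> satisfies \<open>N \<subseteq> d N + L\<close>. By Nakayama's lemma
  \<open>1 - c d\<close> maps \<open>N\<close> into \<open>L\<close>, so \<open>(1 - c d) d\<^sup>n\<close> maps \<open>p\<close> into \<open>L\<close>, and this element is not in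
  \<open>p\<close> because \<open>d\<close> is neither zero nor a unit modulo \<open>p\<close>.\<close>
lemma multiplier_if_stable:
  assumes d: "d \<in> carrier R - p" "\<And>c. c \<in> carrier R \<Longrightarrow> \<one> \<ominus> c \<otimes> d \<in> carrier R - p"
    and L: "ideal L R" and st: "\<And>x. x \<in> p \<Longrightarrow> \<exists>y\<in>p. d [^] (n::nat) \<otimes> x \<ominus> d [^] Suc n \<otimes> y \<in> L"
  shows "\<exists>s\<in>carrier R - p. \<forall>x\<in>p. s \<otimes> x \<in> L"
proof -
  have dC: "d \<in> carrier R" "d [^] n \<in> carrier R" using d by auto
  note LC = subsetD[OF ideal_subset_carrier[OF L]]
  define P where "P = (\<otimes>) (d [^] n) ` p"
  have P: "ideal P R" unfolding P_def using p_ideal dC by (intro ideal_scale)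
  note PC = subsetD[OF ideal_subset_carrier[OF P]]
  let ?N = "P <+>\<^bsub>R\<^esub> L"
  have N: "ideal ?N R" using P L by (rule add_ideals)
  note NC = subsetD[OF ideal_subset_carrier[OF N]]
  have PN: "P \<subseteq> ?N"
  proof
    fix z assume z: "z \<in> P"
    have "z \<oplus> \<zero> \<in> ?N" using z ideal_zero_mem[OF L] by (rule ideal_plus_memI)
    then show "z \<in> ?N" using PC[OF z] by simp
  qed
  have LN: "L \<subseteq> ?N"
  proof
    fix z assume z: "z \<in> L"
    have "\<zero> \<oplus> z \<in> ?N" using ideal_zero_mem[OF P] z by (rule ideal_plus_memI)
    then show "z \<in> ?N" using LC[OF z] by simp
  qed
  have A: "ideal (PIdl d) R" using dC by (simp add: cgenideal_ideal)
  have step: "\<one> \<otimes> z \<in> ((PIdl d) \<cdot> ?N) <+>\<^bsub>R\<^esub> L" if z: "z \<in> ?N" for z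
  proof -
    obtain a l where al: "a \<in> P" "l \<in> L" "z = a \<oplus> l" using z by (rule ideal_plus_memE)
    obtain x where x: "x \<in> p" "a = d [^] n \<otimes> x" using al unfolding P_def by blast
    obtain y where y: "y \<in> p" "a \<ominus> d [^] Suc n \<otimes> y \<in> L" using st[OF x(1)] unfolding x(2) by blast
    define b where "b = d [^] n \<otimes> y"
    have b: "b \<in> P" "b \<in> carrier R" unfolding b_def P_def using y(1) dC p_carrier by auto
    have eq: "d [^] Suc n \<otimes> y = d \<otimes> b"
      using dC p_carrier[OF y(1)] unfolding b_def nat_pow_Suc by algebra
    have "z = d \<otimes> b \<oplus> ((a \<ominus> d \<otimes> b) \<oplus> l)"
      unfolding al(3) using PC[OF al(1)] LC[OF al(2)] b(2) dC by algebra
    moreover have "d \<otimes> b \<in> (PIdl d) \<cdot> ?N"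
      using cgenideal_self[OF dC(1)] b(1) PN by (intro ideal_prod.prod) auto
    moreover have "(a \<ominus> d \<otimes> b) \<oplus> l \<in> L"
      using y(2) al(2) unfolding eq by (intro ideal_add_mem[OF L])
    moreover have "\<one> \<otimes> z = z" using NC[OF z] by simp
    ultimately show ?thesis using ideal_plus_memI by metis
  qed
  obtain k c where c: "c \<in> PIdl d" "\<And>x. x \<in> ?N \<Longrightarrow> (\<one> [^] (k::nat) \<ominus> c) \<otimes> x \<in> L"
    using nakayama[OF A one_closed N L LN step] by blast
  obtain r where r: "r \<in> carrier R" "c = r \<otimes> d" using c(1) unfolding cgenideal_def by blast
  have u: "\<one> \<ominus> c \<in> carrier R - p" unfolding r(2) by (rule d(2)[OF r(1)])
  have "((\<one> \<ominus> c) \<otimes> d [^] n) \<otimes> x \<in> L" if x: "x \<in> p" for x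
  proof -
    have "d [^] n \<otimes> x \<in> ?N" using x PN unfolding P_def by blast
    then have "(\<one> \<ominus> c) \<otimes> (d [^] n \<otimes> x) \<in> L" using c(2)[of "d [^] n \<otimes> x"] by simp
    then show ?thesis using u dC p_carrier[OF x] by (simp add: m_assoc)
  qed
  then show ?thesis using mult_notin[OF u pow_notin[OF d(1)]] by blast
qed

lemma bounded_chains_zero: "bounded_chains {\<zero>}"
proof -
  have "n \<le> 0" if "ideal_chain {\<zero>} n N" for n N
  proof (rule ccontr)
    assume "\<not> n \<le> 0"
    then have "N 0 \<subset> N (Suc 0)" "N (Suc 0) \<subseteq> {\<zero>}" "ideal (N 0) R"
      using that unfolding ideal_chain_def by auto
    then show False using ideal_zero_mem[of "N 0"] by blast
  qed
  then show ?thesis unfolding bounded_chains_def by blast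
qed

text \<open>Among the ideals \<open>M \<subseteq> p\<close> of finite length take a maximal one. If it were not \<open>p\<close>, then \<open>p/M\<close>
  would have an associated prime \<open>q\<close>, namely a maximal one among the ideals \<open>(M : x)\<close>. It contains
  \<open>s\<close>, so it is not \<open>p\<close> and hence it is a maximal ideal. Then \<open>(M + R x)/M\<close> is simple, and
  \<open>M + R x\<close> still has finite length.\<close>
lemma bounded_chains_if_annihilated:
  assumes s: "s \<in> carrier R - p" "\<And>x. x \<in> p \<Longrightarrow> s \<otimes> x = \<zero>"
  shows "bounded_chains p"
proof -
  obtain M where M: "ideal M R" "M \<subseteq> p" "bounded_chains M"
    and max: "\<And>I. \<lbrakk>ideal I R; I \<subseteq> p; bounded_chains I; M \<subseteq> I\<rbrakk> \<Longrightarrow> I = M"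
  proof (rule maximal_ideal_in[of "{I. ideal I R \<and> I \<subseteq> p \<and> bounded_chains I}"])
    show "{I. ideal I R \<and> I \<subseteq> p \<and> bounded_chains I} \<noteq> {}"
      using zeroideal bounded_chains_zero ideal_zero_mem[OF p_ideal] by blast
  qed auto
  note MC = subsetD[OF ideal_subset_carrier[OF M(1)]]
  have "M = p"
  proof (rule ccontr)
    assume "M \<noteq> p"
    define Q where "Q x = {a \<in> carrier R. x \<otimes> a \<in> M}" for x
    have Q: "ideal (Q x) R" if "x \<in> p - M" for x
      unfolding Q_def using that M p_carrier by (intro ideal_colon) auto
    obtain q where q: "q \<in> Q ` (p - M)" and qmax: "\<And>I. \<lbrakk>I \<in> Q ` (p - M); q \<subseteq> I\<rbrakk> \<Longrightarrow> I = q"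
      by (rule maximal_ideal_in[of "Q ` (p - M)"]) (use Q M \<open>M \<noteq> p\<close> in auto)
    obtain x where x: "x \<in> p" "x \<notin> M" "q = Q x" using q by blast
    have xC: "x \<in> carrier R" using x p_carrier by simp
    have qI: "ideal q R" using Q x by simp
    have prime: "primeideal q R"
    proof (rule primeidealI[OF qI is_cring])
      have "\<one> \<notin> q" using x xC unfolding Q_def by simp
      then show "carrier R \<noteq> q" by auto
      fix a b assume ab: "a \<in> carrier R" "b \<in> carrier R" "a \<otimes> b \<in> q"
      show "a \<in> q \<or> b \<in> q"
      proof (cases "b \<in> q")
        case False
        have bx: "x \<otimes> b \<in> p - M"
          using False x ab xC p_ideal unfolding Q_def by (simp add: ideal_mult_mem_right)
        have "q \<subseteq> Q (x \<otimes> b)"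
        proof
          fix c assume "c \<in> q"
          then have c: "c \<in> carrier R" "x \<otimes> c \<in> M" unfolding x(3) Q_def by auto
          have "(x \<otimes> b) \<otimes> c = b \<otimes> (x \<otimes> c)" using xC ab c by algebra
          then show "c \<in> Q (x \<otimes> b)" using c ab M unfolding Q_def by (simp add: ideal_mult_mem)
        qed
        then have eq: "Q (x \<otimes> b) = q" using qmax bx by blast
        have "x \<otimes> (a \<otimes> b) \<in> M" using ab(3) unfolding x(3) Q_def by simp
        moreover have "x \<otimes> (a \<otimes> b) = (x \<otimes> b) \<otimes> a" using xC ab by algebra
        ultimately have "a \<in> Q (x \<otimes> b)" using ab unfolding Q_def by simp
        then show ?thesis using eq by simp
      qed simp
    qed
    have "s \<in> q"
      using s x xC ideal_zero_mem[OF M(1)] m_comm[of s x] unfolding x(3) Q_def by simp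
    then have qp: "q \<noteq> p" using s by blast
    let ?A = "adjoin M x"
    have A: "ideal ?A R" "M \<subseteq> ?A" "x \<in> ?A" "?A \<subseteq> p"
      using adjoin_ideal[OF M(1) xC] adjoin_upper[OF M(1) xC] adjoin_subset[OF p_ideal M(2) x(1)]
      by auto
    have "bounded_chains ?A"
    proof (rule bounded_chains_simple_step[OF M(1) A(1,2) M(3)])
      fix B z assume B: "ideal B R" "B \<subseteq> ?A" "\<not> B \<subseteq> M" and z: "z \<in> ?A"
      obtain b where b: "b \<in> B" "b \<notin> M" using B by blast
      obtain m r where mr: "b = m \<oplus> r \<otimes> x" "m \<in> M" "r \<in> carrier R"
        using b B unfolding adjoin_def by blast
      obtain m' r' where mr': "z = m' \<oplus> r' \<otimes> x" "m' \<in> M" "r' \<in> carrier R"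
        using z unfolding adjoin_def by blast
      have c: "m \<in> carrier R" "m' \<in> carrier R" using mr mr' MC by auto
      have "r \<notin> q"
      proof
        assume "r \<in> q"
        then have "r \<otimes> x \<in> M" using mr(3) xC m_comm[of r x] unfolding x(3) Q_def by simp
        then show False using b mr M(1) by (simp add: ideal_add_mem)
      qed
      then obtain v where v: "v \<in> carrier R" "\<one> \<ominus> v \<otimes> r \<in> q"
        using prime_above_maximal[OF prime qp, of r] mr(3) by blast
      have vx: "x \<otimes> (\<one> \<ominus> v \<otimes> r) \<in> M" using v unfolding x(3) Q_def by simp
      have "z \<ominus> (r' \<otimes> v) \<otimes> b = (m' \<ominus> (r' \<otimes> v) \<otimes> m) \<oplus> r' \<otimes> (x \<otimes> (\<one> \<ominus> v \<otimes> r))"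
        unfolding mr mr' using c v(1) mr(3) mr'(3) xC by algebra
      also have "\<dots> \<in> M"
        using mr(2) mr'(2,3) v(1)
        by (intro ideal_add_mem[OF M(1)] ideal_diff_mem[OF M(1)] ideal_mult_mem[OF M(1) _ vx]
            ideal_mult_mem[OF M(1) _ mr(2)]) auto
      finally have "z \<ominus> (r' \<otimes> v) \<otimes> b \<in> M" .
      moreover have "(r' \<otimes> v) \<otimes> b \<in> B" using b v(1) mr'(3) by (intro ideal_mult_mem[OF B(1)]) auto
      ultimately show "\<exists>y\<in>B. z \<ominus> y \<in> M" by blast
    qed
    then show False using max[of ?A] A x(2) by blast
  qed
  then show ?thesis using M by simp
qed

lemma annihilated_if_bounded_chains:
  assumes b: "bounded_chains p"
  shows "\<exists>s\<in>carrier R - p. \<forall>x\<in>p. s \<otimes> x = \<zero>"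
proof -
  obtain d where d: "d \<in> carrier R - p" "\<And>c. c \<in> carrier R \<Longrightarrow> \<one> \<ominus> c \<otimes> d \<in> carrier R - p"
    using nonunit_mod by blast
  have dC: "d \<in> carrier R" using d by simp
  define J where "J n = (\<otimes>) (d [^] (n::nat)) ` p" for n
  have "\<exists>n0. \<forall>n\<ge>n0. J n = J n0"
  proof (rule bounded_chains_dcc[OF b])
    show "ideal (J n) R" for n unfolding J_def using p_ideal dC by (intro ideal_scale) auto
    show "J n \<subseteq> p" for n unfolding J_def using p_ideal dC by (auto intro: ideal_mult_mem)
    show "J (Suc n) \<subseteq> J n" for n
    proof
      fix z assume "z \<in> J (Suc n)"
      then obtain x where x: "x \<in> p" "z = d [^] Suc n \<otimes> x" unfolding J_def by blast
      have "z = d [^] n \<otimes> (d \<otimes> x)" using x dC p_carrier by (simp add: m_assoc)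
      then show "z \<in> J n" unfolding J_def using x dC p_ideal by (auto intro: ideal_mult_mem)
    qed
  qed
  then obtain n where n: "J (Suc n) = J n" using le_SucI by blast
  have st: "\<exists>y\<in>p. d [^] n \<otimes> x \<ominus> d [^] Suc n \<otimes> y \<in> {\<zero>}" if x: "x \<in> p" for x
  proof -
    have "d [^] n \<otimes> x \<in> J (Suc n)" unfolding n using x unfolding J_def by blast
    then obtain y where y: "y \<in> p" "d [^] n \<otimes> x = d [^] Suc n \<otimes> y" unfolding J_def by blast
    have "d [^] Suc n \<otimes> y \<in> carrier R" using y dC p_carrier by auto
    then show ?thesis using y by (intro bexI[of _ y]) (auto simp: a_minus_def r_neg)
  qed
  show ?thesis using multiplier_if_stable[OF d zeroideal st] by auto
qed

end

section \<open>In an iso-Artinian ring the conormal module is torsion\<close>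

context one_dim_pid
begin

text \<open>For \<open>I\<^sub>n = p + d\<^sup>n R\<close> let \<open>f: I\<^sub>m \<rightarrow> I\<^sub>n\<close> be an isomorphism, where \<open>m = n + 1\<close>. It maps \<open>p\<close> into
  \<open>p\<close>, as \<open>d\<^sup>m f(x) = x f(d\<^sup>m) \<in> p\<close> for \<open>x \<in> p\<close>. If \<open>d\<^sup>n = f(z)\<close> with \<open>z = q + a d\<^sup>m\<close>, \<open>q \<in> p\<close>,
  then \<open>d\<^sup>n x = f(x z) = x f(q) + d\<^sup>m f(a x)\<close> lies in \<open>p\<^sup>2 + d\<^sup>m p\<close>.\<close>
lemma torsion_conormal_if_iso_artinian:
  assumes iso: "iso_artinian R"
  shows "\<exists>s\<in>carrier R - p. \<forall>x\<in>p. s \<otimes> x \<in> p \<cdot> p"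
proof -
  obtain d where d: "d \<in> carrier R - p" "\<And>c. c \<in> carrier R \<Longrightarrow> \<one> \<ominus> c \<otimes> d \<in> carrier R - p"
    using nonunit_mod by blast
  have dC: "d \<in> carrier R" "\<And>n. d [^] (n::nat) \<in> carrier R" using d by auto
  define I where "I n = adjoin p (d [^] (n::nat))" for n
  have I: "ideal (I n) R" "p \<subseteq> I n" "d [^] n \<in> I n" for n
    using adjoin_ideal[OF p_ideal dC(2)] adjoin_upper[OF p_ideal dC(2)] by (auto simp: I_def)
  have "I (Suc n) \<subseteq> I n" for n
    unfolding I_def[of "Suc n"]
    by (rule adjoin_subset) (use I[of n] dC in \<open>auto simp: ideal_mult_mem_right\<close>)
  then obtain n0 where n0: "\<And>n. n \<ge> n0 \<Longrightarrow>
      module_isomorphic R (ideal_module R (I n)) (ideal_module R (I n0))"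
    using iso I unfolding iso_artinian_def by blast
  define n m where "n = n0" and "m = Suc n0"
  have "module_isomorphic R (ideal_module R (I m)) (ideal_module R (I n))"
    unfolding n_def m_def by (rule n0) simp
  then obtain f where f: "f \<in> module_hom R (ideal_module R (I m)) (ideal_module R (I n))"
      "bij_betw f (I m) (I n)"
    unfolding module_isomorphic_def by (auto simp: ideal_module_def)
  have fI: "f x \<in> I n" if "x \<in> I m" for x using f(2) that by (auto simp: bij_betw_def)
  have fadd: "f (x \<oplus> y) = f x \<oplus> f y" if "x \<in> I m" "y \<in> I m" for x y
    using module_hom_add[OF f(1)] that by (simp add: ideal_module_def)
  have fsmult: "f (r \<otimes> x) = r \<otimes> f x" if "r \<in> carrier R" "x \<in> I m" for r x
    using module_hom_smult[OF f(1)] that by (simp add: ideal_module_def)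
  note fC = subsetD[OF ideal_subset_carrier[OF I(1)[of n]] fI]
  have fp: "f x \<in> p" if x: "x \<in> p" for x
  proof -
    have xI: "x \<in> I m" using x I(2) by blast
    have "d [^] m \<otimes> f x = f (d [^] m \<otimes> x)" using fsmult dC xI by simp
    also have "\<dots> = f (x \<otimes> d [^] m)" using dC p_carrier[OF x] by (simp add: m_comm)
    also have "\<dots> = x \<otimes> f (d [^] m)" using fsmult I(3) p_carrier[OF x] by simp
    also have "\<dots> \<in> p" using x fC I(3) p_ideal by (intro ideal_mult_mem_right) auto
    finally show ?thesis using I_prime[OF dC(2) fC[OF xI]] pow_notin[OF d(1)] by blast
  qed
  have st: "\<exists>y\<in>p. d [^] n \<otimes> x \<ominus> d [^] Suc n \<otimes> y \<in> p \<cdot> p" if x: "x \<in> p" for x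
  proof -
    obtain z where z: "z \<in> I m" "f z = d [^] n" using f(2) I(3)[of n] unfolding bij_betw_def by (metis imageE)
    obtain q a where qa: "z = q \<oplus> a \<otimes> d [^] m" "q \<in> p" "a \<in> carrier R"
      using z(1) unfolding I_def adjoin_def by blast
    have xC: "x \<in> carrier R" and qC: "q \<in> carrier R" using x qa p_carrier by auto
    have ax: "a \<otimes> x \<in> p" using x qa p_ideal by (simp add: ideal_mult_mem)
    have "d [^] n \<otimes> x = x \<otimes> f z" unfolding z(2) using xC dC by (simp add: m_comm)
    also have "\<dots> = f (x \<otimes> z)" using fsmult[OF xC z(1)] by simp
    also have "x \<otimes> z = x \<otimes> q \<oplus> d [^] m \<otimes> (a \<otimes> x)"
      unfolding qa(1) using xC qC qa(3) dC(2)[of m] by algebra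
    also have "f \<dots> = f (x \<otimes> q) \<oplus> f (d [^] m \<otimes> (a \<otimes> x))"
    proof (rule fadd)
      show "x \<otimes> q \<in> I m" using I(2) qa(2) by (intro ideal_mult_mem[OF I(1) xC]) auto
      show "d [^] m \<otimes> (a \<otimes> x) \<in> I m" using I(2) ax by (intro ideal_mult_mem[OF I(1) dC(2)]) auto
    qed
    also have "\<dots> = x \<otimes> f q \<oplus> d [^] m \<otimes> f (a \<otimes> x)"
      using fsmult[OF xC subsetD[OF I(2) qa(2)]] fsmult[OF dC(2) subsetD[OF I(2) ax]] by simp
    finally have eq: "d [^] n \<otimes> x = x \<otimes> f q \<oplus> d [^] m \<otimes> f (a \<otimes> x)" .
    have c: "f q \<in> carrier R" "f (a \<otimes> x) \<in> carrier R" using fp qa(2) ax p_carrier by auto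
    have "d [^] n \<otimes> x \<ominus> d [^] m \<otimes> f (a \<otimes> x) = x \<otimes> f q"
      unfolding eq using c xC dC(2)[of m] by algebra
    also have "\<dots> \<in> p \<cdot> p" using x fp qa(2) by (intro ideal_prod.prod)
    finally show ?thesis using fp ax unfolding m_def n_def by blast
  qed
  show ?thesis
    using multiplier_if_stable[OF d ideal_prod_is_ideal[OF p_ideal p_ideal] st] .
qed

end

section \<open>Descending chains of ideals over a prime of finite length\<close>

context cring
begin

definition ann :: "'a set \<Rightarrow> 'a set"
  where "ann N = {a \<in> carrier R. \<forall>x\<in>N. a \<otimes> x = \<zero>}"

lemma ann_ideal:
  assumes "N \<subseteq> carrier R"
  shows "ideal (ann N) R"
  unfolding ann_def
  by (rule cring_idealI) (use assms in \<open>auto simp: l_distr m_assoc subset_iff\<close>)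

end

context one_dim_pid
begin

text \<open>This is the descending chain condition for \<open>R/ann Y\<close>, which is a submodule of a finite power of
  \<open>p\<close>. For one more element \<open>y\<close>, split the chain: the images \<open>y I\<^sub>n \<subseteq> p\<close> become constant since \<open>p\<close>
  has finite length, and the induction hypothesis takes care of the kernels \<open>I\<^sub>n \<inter> ann y\<close>.\<close>
lemma dcc_mod_ann_finite:
  assumes b: "bounded_chains p" and "finite Y" "Y \<subseteq> p"
    and "\<And>n. ideal (I n) R" "\<And>n. I (Suc n) \<subseteq> I n"
  shows "\<exists>n0. \<forall>n\<ge>n0. \<forall>a\<in>I n0. \<exists>a'\<in>I n. a \<ominus> a' \<in> ann Y"
  using assms(2-)
proof (induction Y arbitrary: I rule: finite_induct)
  case empty
  have "a \<ominus> \<zero> \<in> ann {}" if "a \<in> I 0" for a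
    using that ideal_subset_carrier[OF empty(2)] by (auto simp: ann_def)
  then show ?case using ideal_zero_mem[OF empty(2)] by blast
next
  case (insert y Y)
  note I = insert.prems(2,3)
  note IC = subsetD[OF ideal_subset_carrier[OF I(1)]]
  have dec: "I m \<subseteq> I n" if "n \<le> m" for m n
    using that I(2) by (rule lift_Suc_antimono_le[rotated])
  have y: "y \<in> p" "y \<in> carrier R" using insert.prems(1) p_carrier by auto
  obtain n0 where n0: "\<And>n. n \<ge> n0 \<Longrightarrow> (\<otimes>) y ` I n = (\<otimes>) y ` I n0"
  proof -
    have "\<exists>n0. \<forall>n\<ge>n0. (\<otimes>) y ` I n = (\<otimes>) y ` I n0"
    proof (rule bounded_chains_dcc[OF b])
      show "ideal ((\<otimes>) y ` I n) R" for n using I(1) y(2) by (rule ideal_scale)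
      show "(\<otimes>) y ` I n \<subseteq> p" for n using y(1) IC p_ideal by (auto intro: ideal_mult_mem_right)
      show "(\<otimes>) y ` I (Suc n) \<subseteq> (\<otimes>) y ` I n" for n using I(2) by (rule image_mono)
    qed
    then show thesis using that by blast
  qed
  define K where "K n = I n \<inter> ann {y}" for n
  have "\<exists>n1. \<forall>n\<ge>n1. \<forall>a\<in>K n1. \<exists>a'\<in>K n. a \<ominus> a' \<in> ann Y"
  proof (rule insert.IH)
    show "Y \<subseteq> p" using insert.prems by simp
    show "ideal (K n) R" for n unfolding K_def using y(2) by (intro i_intersect I(1) ann_ideal) simp
    show "K (Suc n) \<subseteq> K n" for n unfolding K_def using I(2) by blast
  qed
  then obtain n1 where n1: "\<And>n a. \<lbrakk>n \<ge> n1; a \<in> K n1\<rbrakk> \<Longrightarrow> \<exists>a'\<in>K n. a \<ominus> a' \<in> ann Y" by blast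
  define m where "m = max n0 n1"
  have "\<exists>a'\<in>I n. a \<ominus> a' \<in> ann (insert y Y)" if n: "n \<ge> m" and a: "a \<in> I m" for n a
  proof -
    have nm: "n0 \<le> n" "n1 \<le> n" "n0 \<le> m" "n1 \<le> m" using n by (auto simp: m_def)
    have "y \<otimes> a \<in> (\<otimes>) y ` I n" using a n0[OF nm(1)] n0[OF nm(3)] by blast
    then obtain a' where a': "a' \<in> I n" "y \<otimes> a = y \<otimes> a'" by blast
    have c: "a \<in> carrier R" "a' \<in> carrier R" using a a' IC by auto
    have "(a \<ominus> a') \<otimes> y = y \<otimes> a \<ominus> y \<otimes> a'" using c y by algebra
    also have "\<dots> = \<zero>" unfolding a'(2) using c y by algebra
    finally have ay: "(a \<ominus> a') \<otimes> y = \<zero>" .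
    have "a' \<in> I m" using a' dec n by blast
    then have "a \<ominus> a' \<in> I m" using a I(1) by (intro ideal_diff_mem)
    then have "a \<ominus> a' \<in> K n1" using dec[OF nm(4)] ay c y unfolding K_def ann_def by auto
    then obtain a'' where a'': "a'' \<in> K n" "(a \<ominus> a') \<ominus> a'' \<in> ann Y" using n1 nm by blast
    have a''n: "a'' \<in> I n" "a'' \<in> carrier R" "a'' \<otimes> y = \<zero>"
      using a'' unfolding K_def ann_def by auto
    have eq: "a \<ominus> (a' \<oplus> a'') = (a \<ominus> a') \<ominus> a''" using c a''n by algebra
    have "((a \<ominus> a') \<ominus> a'') \<otimes> y = (a \<ominus> a') \<otimes> y \<ominus> a'' \<otimes> y" using c a''n(2) y by algebra
    also have "\<dots> = \<zero>" unfolding ay a''n(3) by algebra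
    finally have "a \<ominus> (a' \<oplus> a'') \<in> ann (insert y Y)" using a''(2) unfolding eq ann_def by auto
    moreover have "a' \<oplus> a'' \<in> I n" using a' a''n I(1) by (intro ideal_add_mem)
    ultimately show ?thesis by blast
  qed
  then show ?case by blast
qed

lemma dcc_mod_ann:
  assumes "bounded_chains p" "\<And>n. ideal (I n) R" "\<And>n. I (Suc n) \<subseteq> I n"
  shows "\<exists>n0. \<forall>n\<ge>n0. \<forall>a\<in>I n0. \<exists>a'\<in>I n. a \<ominus> a' \<in> ann p"
proof -
  obtain Y where Y: "finite Y" "Y \<subseteq> p" "\<And>K. \<lbrakk>ideal K R; Y \<subseteq> K\<rbrakk> \<Longrightarrow> p \<subseteq> K"
    using finite_generators[OF p_ideal] by blast
  have "ann Y \<subseteq> ann p"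
  proof
    fix a assume a: "a \<in> ann Y"
    then have aC: "a \<in> carrier R" by (simp add: ann_def)
    have "p \<subseteq> {x \<in> carrier R. a \<otimes> x \<in> {\<zero>}}"
      by (rule Y(3)[OF ideal_colon[OF zeroideal aC]]) (use a Y(2) p_carrier in \<open>auto simp: ann_def\<close>)
    then show "a \<in> ann p" using aC by (auto simp: ann_def)
  qed
  then show ?thesis using dcc_mod_ann_finite[OF assms(1) Y(1,2), of I, OF assms(2,3)] by blast
qed

text \<open>If \<open>x\<close> and \<open>r x\<close> generate the same ideal of an Artinian ring, so that \<open>x = s r x\<close>, then \<open>r\<close>
  may be replaced by a unit \<open>u\<close> with \<open>u x = r x\<close>. The proof is the Fitting decomposition for
  \<open>w = r s\<close>: the powers of \<open>w\<close> become stationary, which provides an idempotent \<open>e = c w\<^sup>k\<close>. On the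
  image of \<open>e\<close> the element \<open>r\<close> is invertible, on the image of \<open>1 - e\<close> it is replaced by \<open>1\<close>, and
  \<open>x\<close> lies in the former. Here the Artinian ring is \<open>R/ann p\<close>, and \<open>K\<close> plays the role of the zero
  ideal in one of its quotients.\<close>
lemma unit_lift_mod_ann:
  assumes b: "bounded_chains p" and r: "r \<in> carrier R" and s: "s \<in> carrier R"
  obtains u v where "u \<in> carrier R" "v \<in> carrier R" "\<one> \<ominus> u \<otimes> v \<in> ann p"
    "\<forall>K x. ideal K R \<longrightarrow> ann p \<subseteq> K \<longrightarrow> x \<in> carrier R \<longrightarrow>
      (\<one> \<ominus> r \<otimes> s) \<otimes> x \<in> K \<longrightarrow> (u \<ominus> r) \<otimes> x \<in> K"
proof -
  define w where "w = r \<otimes> s"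
  have w: "w \<in> carrier R" "\<And>n. w [^] (n::nat) \<in> carrier R" using r s by (auto simp: w_def)
  have A: "ideal (ann p) R" using p_carrier by (intro ann_ideal) auto
  have "\<exists>n0::nat. \<forall>n\<ge>n0. \<forall>a\<in>PIdl (w [^] n0). \<exists>a'\<in>PIdl (w [^] n). a \<ominus> a' \<in> ann p"
  proof (rule dcc_mod_ann[OF b])
    show "ideal (PIdl (w [^] n)) R" for n :: nat using w by (simp add: cgenideal_ideal)
    show "PIdl (w [^] Suc n) \<subseteq> PIdl (w [^] n)" for n :: nat
    proof (rule cgenideal_minimal)
      have "ideal (PIdl (w [^] n)) R" using w by (simp add: cgenideal_ideal)
      then show "ideal (PIdl (w [^] n)) R" .
      then show "w [^] Suc n \<in> PIdl (w [^] n)"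
        unfolding nat_pow_Suc using w cgenideal_self by (intro ideal_mult_mem_right) auto
    qed
  qed
  then obtain n0 :: nat where n0: "\<And>n a. \<lbrakk>n \<ge> n0; a \<in> PIdl (w [^] n0)\<rbrakk> \<Longrightarrow>
      \<exists>a'\<in>PIdl (w [^] n). a \<ominus> a' \<in> ann p" by blast
  define W where "W = w [^] n0"
  \<comment> \<open>The successor makes \<open>w\<^sup>k\<close> divisible by \<open>r\<close> even if \<open>n0 = 0\<close>.\<close>
  define k where "k = Suc n0"
  have WC: "W \<in> carrier R" using w by (simp add: W_def)
  have Wk: "w [^] k = W \<otimes> (r \<otimes> s)" by (simp add: k_def W_def w_def)
  have "w [^] k \<in> PIdl (w [^] n0)" unfolding Wk W_def
    by (rule ideal_mult_mem_right[OF cgenideal_ideal]) (use w r s cgenideal_self in auto)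
  then obtain a' where a': "a' \<in> PIdl (w [^] (k + k))" "w [^] k \<ominus> a' \<in> ann p"
    using n0[of "k + k"] by (auto simp: k_def)
  then obtain c where c: "c \<in> carrier R" "a' = c \<otimes> (w [^] k \<otimes> w [^] k)"
    unfolding cgenideal_def using w by (auto simp: nat_pow_mult)
  define e where "e = c \<otimes> w [^] k"
  have e: "e \<in> carrier R" using c w by (simp add: e_def)
  \<comment> \<open>So \<open>e\<close> is idempotent modulo \<open>ann p\<close>.\<close>
  have fit: "(\<one> \<ominus> e) \<otimes> w [^] k \<in> ann p"
  proof -
    have "(\<one> \<ominus> e) \<otimes> w [^] k = w [^] k \<ominus> a'" unfolding e_def c(2) using w(2)[of k] c(1) by algebra
    then show ?thesis using a'(2) by simp
  qed
  define f V where "f = \<one> \<ominus> e" and "V = s \<otimes> W \<otimes> c"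
  have fV: "f \<in> carrier R" "V \<in> carrier R" using s e c WC by (auto simp: f_def V_def)
  define u v where "u = r \<otimes> e \<oplus> f" and "v = V \<otimes> e \<oplus> f"
  have uv: "u \<in> carrier R" "v \<in> carrier R" using r e fV by (auto simp: u_def v_def)
  \<comment> \<open>Modulo \<open>ann p\<close>, \<open>V\<close> is the inverse of \<open>r\<close> on the image of \<open>e\<close>.\<close>
  have rV: "r \<otimes> V = e" unfolding V_def e_def Wk using r s c(1) WC by algebra
  have "u \<otimes> v = (r \<otimes> V) \<otimes> (e \<otimes> e) \<oplus> (r \<oplus> V) \<otimes> (e \<otimes> f) \<oplus> f \<otimes> f"
    unfolding u_def v_def using r fV e by algebra
  then have "\<one> \<ominus> u \<otimes> v = \<one> \<ominus> (e \<otimes> (e \<otimes> e) \<oplus> (r \<oplus> V) \<otimes> (e \<otimes> f) \<oplus> f \<otimes> f)"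
    unfolding rV by simp
  also have "\<dots> = (e \<oplus> \<one> \<oplus> \<one> \<ominus> r \<ominus> V) \<otimes> (e \<otimes> f)"
    unfolding f_def using r fV(2) e by algebra
  also have "e \<otimes> f = c \<otimes> ((\<one> \<ominus> e) \<otimes> w [^] k)"
    unfolding f_def e_def using w(2)[of k] c(1) by algebra
  also have "(e \<oplus> \<one> \<oplus> \<one> \<ominus> r \<ominus> V) \<otimes> (c \<otimes> ((\<one> \<ominus> e) \<otimes> w [^] k)) \<in> ann p"
    using r fV e c by (intro ideal_mult_mem[OF A _ ideal_mult_mem[OF A c(1) fit]]) auto
  finally have 1: "\<one> \<ominus> u \<otimes> v \<in> ann p" .
  have 2: "(u \<ominus> r) \<otimes> x \<in> K"
    if K: "ideal K R" "ann p \<subseteq> K" and x: "x \<in> carrier R" "(\<one> \<ominus> r \<otimes> s) \<otimes> x \<in> K" for K x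
  proof -
    have pow: "x \<ominus> w [^] n \<otimes> x \<in> K" for n :: nat
    proof (induction n)
      case 0
      have "x \<ominus> w [^] (0::nat) \<otimes> x = \<zero>" using x by (simp add: a_minus_def r_neg)
      then show ?case using ideal_zero_mem[OF K(1)] by simp
    next
      case (Suc n)
      have "x \<ominus> w [^] Suc n \<otimes> x = (x \<ominus> w [^] n \<otimes> x) \<oplus> w [^] n \<otimes> ((\<one> \<ominus> r \<otimes> s) \<otimes> x)"
        unfolding nat_pow_Suc using w(2)[of n] x(1) r s unfolding w_def by algebra
      then show ?case
        using ideal_add_mem[OF K(1) Suc ideal_mult_mem[OF K(1) w(2) x(2)]] by simp
    qed
    have "(u \<ominus> r) \<otimes> x =
        (\<one> \<ominus> r) \<otimes> (x \<otimes> ((\<one> \<ominus> e) \<otimes> w [^] k) \<oplus> (\<one> \<ominus> e) \<otimes> (x \<ominus> w [^] k \<otimes> x))"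
      unfolding u_def f_def using r e w(2)[of k] x(1) by algebra
    also have "\<dots> \<in> K"
    proof -
      have "(\<one> \<ominus> e) \<otimes> w [^] k \<in> K" using fit K(2) by blast
      then have "x \<otimes> ((\<one> \<ominus> e) \<otimes> w [^] k) \<in> K" by (rule ideal_mult_mem[OF K(1) x(1)])
      moreover have "(\<one> \<ominus> e) \<otimes> (x \<ominus> w [^] k \<otimes> x) \<in> K"
        using e by (intro ideal_mult_mem[OF K(1) _ pow]) simp
      ultimately have "x \<otimes> ((\<one> \<ominus> e) \<otimes> w [^] k) \<oplus> (\<one> \<ominus> e) \<otimes> (x \<ominus> w [^] k \<otimes> x) \<in> K"
        by (rule ideal_add_mem[OF K(1)])
      then show ?thesis using r by (intro ideal_mult_mem[OF K(1)]) simp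
    qed
    finally show ?thesis .
  qed
  show thesis by (rule that[OF uv 1]) (use 2 in blast)
qed

text \<open>The map \<open>J + R x \<rightarrow> J + R y\<close> that sends \<open>j + a x\<close> to \<open>u j + a y\<close>; the choice of \<open>a\<close> does not
  matter in the situation of \<open>transfer_eq\<close>.\<close>
definition transfer :: "'a set \<Rightarrow> 'a \<Rightarrow> 'a \<Rightarrow> 'a \<Rightarrow> 'a \<Rightarrow> 'a"
  where "transfer J u x y z = (let a = SOME a. a \<in> carrier R \<and> z \<ominus> a \<otimes> x \<in> J
    in u \<otimes> (z \<ominus> a \<otimes> x) \<oplus> a \<otimes> y)"

text \<open>Two choices of \<open>a\<close> differ by an element \<open>q\<close> with \<open>q x \<in> J \<subseteq> p\<close>, hence \<open>q \<in> p\<close>, and on \<open>p\<close>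
  multiplication by \<open>y\<close> is multiplication by \<open>u x\<close>.\<close>
lemma transfer_eq:
  assumes J: "ideal J R" "J \<subseteq> p" and u: "u \<in> carrier R"
    and x: "x \<in> carrier R - p" and y: "y \<in> carrier R" and uxy: "\<And>q. q \<in> p \<Longrightarrow> q \<otimes> y = u \<otimes> (q \<otimes> x)"
    and z: "z \<in> carrier R" and a: "a \<in> carrier R" "z \<ominus> a \<otimes> x \<in> J"
  shows "transfer J u x y z = u \<otimes> (z \<ominus> a \<otimes> x) \<oplus> a \<otimes> y"
proof -
  define b where "b = (SOME a. a \<in> carrier R \<and> z \<ominus> a \<otimes> x \<in> J)"
  have b: "b \<in> carrier R" "z \<ominus> b \<otimes> x \<in> J"
    using someI[of "\<lambda>a. a \<in> carrier R \<and> z \<ominus> a \<otimes> x \<in> J" a] a unfolding b_def by auto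
  have xC: "x \<in> carrier R" using x by simp
  have "(b \<ominus> a) \<otimes> x = (z \<ominus> a \<otimes> x) \<ominus> (z \<ominus> b \<otimes> x)" using a(1) b(1) xC z by algebra
  also have "\<dots> \<in> p" using ideal_diff_mem[OF J(1) a(2) b(2)] J(2) by blast
  finally have q: "b \<ominus> a \<in> p" using I_prime[of "b \<ominus> a" x] x a(1) b(1) by auto
  have "u \<otimes> (z \<ominus> b \<otimes> x) \<oplus> b \<otimes> y =
      (u \<otimes> (z \<ominus> a \<otimes> x) \<oplus> a \<otimes> y) \<oplus> ((b \<ominus> a) \<otimes> y \<ominus> u \<otimes> ((b \<ominus> a) \<otimes> x))"
    using a(1) b(1) xC z y u by algebra
  also have "(b \<ominus> a) \<otimes> y \<ominus> u \<otimes> ((b \<ominus> a) \<otimes> x) = \<zero>"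
    unfolding uxy[OF q] using u a(1) b(1) xC by algebra
  also have "(u \<otimes> (z \<ominus> a \<otimes> x) \<oplus> a \<otimes> y) \<oplus> \<zero> = u \<otimes> (z \<ominus> a \<otimes> x) \<oplus> a \<otimes> y"
    using a(1) xC z y u by algebra
  finally show ?thesis unfolding transfer_def Let_def b_def[symmetric] .
qed

text \<open>As \<open>u\<close> and \<open>v\<close> are inverse to each other on \<open>p\<close>, the hypothesis \<open>q y = u q x\<close> is equivalent to
  \<open>q x = v q y\<close>. So there are transfer maps in both directions, and they are inverse to each other.\<close>
lemma module_isomorphic_transfer:
  assumes I: "ideal I R" and I': "ideal I' R" and J: "ideal J R" "J \<subseteq> p" "J \<subseteq> I" "J \<subseteq> I'"
    and u: "u \<in> carrier R" and v: "v \<in> carrier R" and uv: "\<one> \<ominus> u \<otimes> v \<in> ann p"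
    and x: "x \<in> I - p" "\<And>z. z \<in> I \<Longrightarrow> \<exists>a\<in>carrier R. z \<ominus> a \<otimes> x \<in> J"
    and y: "y \<in> I' - p" "\<And>z. z \<in> I' \<Longrightarrow> \<exists>a\<in>carrier R. z \<ominus> a \<otimes> y \<in> J"
    and uxy: "\<And>q. q \<in> p \<Longrightarrow> q \<otimes> y = u \<otimes> (q \<otimes> x)"
  shows "module_isomorphic R (ideal_module R I) (ideal_module R I')"
proof -
  note IC = subsetD[OF ideal_subset_carrier[OF I]] and I'C = subsetD[OF ideal_subset_carrier[OF I']]
  have xC: "x \<in> carrier R" and yC: "y \<in> carrier R" using x y IC I'C by auto
  have uvp: "u \<otimes> (v \<otimes> q) = q" "v \<otimes> (u \<otimes> q) = q" if q: "q \<in> p" for q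
  proof -
    have "q \<ominus> u \<otimes> (v \<otimes> q) = (\<one> \<ominus> u \<otimes> v) \<otimes> q" using p_carrier[OF q] u v by algebra
    also have "\<dots> = \<zero>" using uv q unfolding ann_def by auto
    finally show "u \<otimes> (v \<otimes> q) = q" using p_carrier[OF q] u v by simp
    moreover have "v \<otimes> (u \<otimes> q) = u \<otimes> (v \<otimes> q)" using p_carrier[OF q] u v by algebra
    ultimately show "v \<otimes> (u \<otimes> q) = q" by simp
  qed
  have vyx: "q \<otimes> x = v \<otimes> (q \<otimes> y)" if q: "q \<in> p" for q
    using uxy[OF q] uvp(2)[of "q \<otimes> x"] q xC p_ideal by (simp add: ideal_mult_mem_right)
  let ?f = "transfer J u x y" and ?g = "transfer J v y x"
  have f: "?f z = u \<otimes> (z \<ominus> a \<otimes> x) \<oplus> a \<otimes> y"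
    if "z \<in> I" "a \<in> carrier R" "z \<ominus> a \<otimes> x \<in> J" for z a
    using that x xC yC IC by (intro transfer_eq[OF J(1,2) u _ yC uxy]) auto
  have g: "?g z = v \<otimes> (z \<ominus> a \<otimes> y) \<oplus> a \<otimes> x"
    if "z \<in> I'" "a \<in> carrier R" "z \<ominus> a \<otimes> y \<in> J" for z a
    using that y xC yC I'C by (intro transfer_eq[OF J(1,2) v _ xC vyx]) auto
  have gf: "?f z \<in> I'" "?g (?f z) = z" if z: "z \<in> I" for z
  proof -
    obtain a where a: "a \<in> carrier R" "z \<ominus> a \<otimes> x \<in> J" using x(2)[OF z] by blast
    have j: "z \<ominus> a \<otimes> x \<in> carrier R" using a z IC xC by auto
    have uj: "u \<otimes> (z \<ominus> a \<otimes> x) \<in> J" by (rule ideal_mult_mem[OF J(1) u a(2)])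
    show 1: "?f z \<in> I'"
      unfolding f[OF z a] using uj J(4) y(1) a(1) ideal_add_mem[OF I' _ ideal_mult_mem[OF I']] by blast
    have eq: "?f z \<ominus> a \<otimes> y = u \<otimes> (z \<ominus> a \<otimes> x)" unfolding f[OF z a] using j u a(1) yC by algebra
    have "?g (?f z) = v \<otimes> (u \<otimes> (z \<ominus> a \<otimes> x)) \<oplus> a \<otimes> x"
      using g[OF 1 a(1)] uj unfolding eq by simp
    also have "\<dots> = z" using uvp(2)[of "z \<ominus> a \<otimes> x"] a J(2) xC IC[OF z] by (auto simp: minus_add_cancel)
    finally show "?g (?f z) = z" .
  qed
  have fg: "?g z \<in> I" "?f (?g z) = z" if z: "z \<in> I'" for z
  proof -
    obtain a where a: "a \<in> carrier R" "z \<ominus> a \<otimes> y \<in> J" using y(2)[OF z] by blast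
    have j: "z \<ominus> a \<otimes> y \<in> carrier R" using a z I'C yC by auto
    have uj: "v \<otimes> (z \<ominus> a \<otimes> y) \<in> J" by (rule ideal_mult_mem[OF J(1) v a(2)])
    show 1: "?g z \<in> I"
      unfolding g[OF z a] using uj J(3) x(1) a(1) ideal_add_mem[OF I _ ideal_mult_mem[OF I]] by blast
    have eq: "?g z \<ominus> a \<otimes> x = v \<otimes> (z \<ominus> a \<otimes> y)" unfolding g[OF z a] using j v a(1) xC by algebra
    have "?f (?g z) = u \<otimes> (v \<otimes> (z \<ominus> a \<otimes> y)) \<oplus> a \<otimes> y"
      using f[OF 1 a(1)] uj unfolding eq by simp
    also have "\<dots> = z" using uvp(1)[of "z \<ominus> a \<otimes> y"] a J(2) yC I'C[OF z] by (auto simp: minus_add_cancel)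
    finally show "?f (?g z) = z" .
  qed
  have "bij_betw ?f I I'"
    using gf fg by (intro bij_betw_byWitness[where f' = ?g]) auto
  moreover have "?f (z \<oplus> z') = ?f z \<oplus> ?f z'" if z: "z \<in> I" "z' \<in> I" for z z'
  proof -
    obtain a where a: "a \<in> carrier R" "z \<ominus> a \<otimes> x \<in> J" using x(2)[OF z(1)] by blast
    obtain a' where a': "a' \<in> carrier R" "z' \<ominus> a' \<otimes> x \<in> J" using x(2)[OF z(2)] by blast
    have c: "z \<in> carrier R" "z' \<in> carrier R" using z IC by auto
    have eq: "(z \<oplus> z') \<ominus> (a \<oplus> a') \<otimes> x = (z \<ominus> a \<otimes> x) \<oplus> (z' \<ominus> a' \<otimes> x)"
      using c a(1) a'(1) xC by algebra
    have "?f (z \<oplus> z') = u \<otimes> ((z \<oplus> z') \<ominus> (a \<oplus> a') \<otimes> x) \<oplus> (a \<oplus> a') \<otimes> y"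
      by (rule f) (use z I a a' eq J in \<open>auto intro: ideal_add_mem\<close>)
    also have "\<dots> = ?f z \<oplus> ?f z'"
      unfolding f[OF z(1) a] f[OF z(2) a'] using c a(1) a'(1) xC yC u by algebra
    finally show ?thesis .
  qed
  moreover have "?f (r \<otimes> z) = r \<otimes> ?f z" if r: "r \<in> carrier R" and z: "z \<in> I" for r z
  proof -
    obtain a where a: "a \<in> carrier R" "z \<ominus> a \<otimes> x \<in> J" using x(2)[OF z(1)] by blast
    have c: "z \<in> carrier R" using z IC by auto
    have eq: "r \<otimes> z \<ominus> (r \<otimes> a) \<otimes> x = r \<otimes> (z \<ominus> a \<otimes> x)"
      using c a(1) r xC by algebra
    have "?f (r \<otimes> z) = u \<otimes> (r \<otimes> z \<ominus> (r \<otimes> a) \<otimes> x) \<oplus> (r \<otimes> a) \<otimes> y"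
      by (rule f) (use z I a r eq J in \<open>auto intro: ideal_mult_mem\<close>)
    also have "\<dots> = r \<otimes> ?f z"
      unfolding f[OF z a] using c a(1) r xC yC u by algebra
    finally show ?thesis .
  qed
  ultimately show ?thesis
    unfolding module_isomorphic_def module_hom_def using gf(1)
    by (intro bexI[of _ ?f]) (auto simp: ideal_module_def)
qed

text \<open>A generator of the image of \<open>I\<close> in \<open>R/p\<close>, lifted to \<open>I\<close>.\<close>
lemma generator_mod_p:
  assumes I: "ideal I R" "\<not> I \<subseteq> p"
  obtains x where "x \<in> I - p" "\<And>z. z \<in> I \<Longrightarrow> \<exists>a\<in>carrier R. z \<ominus> a \<otimes> x \<in> p"
proof -
  note IC = subsetD[OF ideal_subset_carrier[OF I(1)]]
  let ?S = "I <+>\<^bsub>R\<^esub> p"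
  have S: "ideal ?S R" using I(1) p_ideal by (rule add_ideals)
  have IS: "z \<in> ?S" if "z \<in> I" for z
    using ideal_plus_memI[OF that ideal_zero_mem[OF p_ideal]] IC[OF that] by simp
  have "p \<subseteq> ?S"
  proof
    fix z assume z: "z \<in> p"
    show "z \<in> ?S" using ideal_plus_memI[OF ideal_zero_mem[OF I(1)] z] p_carrier[OF z] by simp
  qed
  then obtain t where t: "t \<in> ?S" "\<And>z. z \<in> ?S \<Longrightarrow> \<exists>a\<in>carrier R. z \<ominus> a \<otimes> t \<in> p"
    using principal_mod[OF S] by blast
  obtain x q where xq: "x \<in> I" "q \<in> p" "t = x \<oplus> q" using t(1) by (rule ideal_plus_memE)
  have xC: "x \<in> carrier R" and qC: "q \<in> carrier R" using xq IC p_carrier by auto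
  have gen: "\<exists>a\<in>carrier R. z \<ominus> a \<otimes> x \<in> p" if z: "z \<in> I" for z
  proof -
    obtain a where a: "a \<in> carrier R" "z \<ominus> a \<otimes> t \<in> p" using t(2) IS z by blast
    have "z \<ominus> a \<otimes> x = (z \<ominus> a \<otimes> t) \<oplus> a \<otimes> q" unfolding xq(3) using IC[OF z] a(1) xC qC by algebra
    also have "\<dots> \<in> p" using a xq(2) by (intro ideal_add_mem[OF p_ideal] ideal_mult_mem[OF p_ideal])
    finally show ?thesis using a by blast
  qed
  moreover have "x \<notin> p"
  proof
    assume x: "x \<in> p"
    have "z \<in> p" if z: "z \<in> I" for z
    proof -
      obtain a where a: "a \<in> carrier R" "z \<ominus> a \<otimes> x \<in> p" using gen[OF z] by blast
      have "z = (z \<ominus> a \<otimes> x) \<oplus> a \<otimes> x" using IC[OF z] a(1) xC by (simp add: minus_add_cancel)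
      also have "\<dots> \<in> p" using a x by (intro ideal_add_mem[OF p_ideal] ideal_mult_mem[OF p_ideal])
      finally show ?thesis .
    qed
    then show False using I(2) by blast
  qed
  ultimately show thesis using that xq(1) by blast
qed

text \<open>Either some \<open>I\<^sub>n\<close> lies in \<open>p\<close> and the chain becomes constant, or \<open>I\<^sub>n = J + R x\<^sub>n\<close> for large
  \<open>n\<close>. In the second case let \<open>x = x\<^sub>m\<close> and \<open>y = x\<^sub>n\<close> for \<open>n \<ge> m\<close>, \<open>m\<close> large. Then
  \<open>y \<equiv> r x\<close> modulo \<open>J\<close> and \<open>x \<equiv> s y\<close> modulo \<open>J + ann p\<close>, and \<open>unit_lift_mod_ann\<close> makes \<open>r\<close> a unit
  \<open>u\<close>. Changing \<open>y\<close> by an element of \<open>J\<close> gives a generator \<open>y'\<close> with \<open>y' \<equiv> u x\<close> modulo \<open>ann p\<close>.\<close>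
lemma iso_artinian_if_bounded_chains:
  assumes b: "bounded_chains p"
  shows "iso_artinian R"
  unfolding iso_artinian_def
proof (intro allI impI)
  fix I :: "nat \<Rightarrow> 'a set"
  assume chain: "(\<forall>n. ideal (I n) R) \<and> (\<forall>n. I (Suc n) \<subseteq> I n)"
  have I: "\<And>n. ideal (I n) R" "\<And>n. I (Suc n) \<subseteq> I n"
    by (rule chain[THEN conjunct1, rule_format], rule chain[THEN conjunct2, rule_format])
  note IC = subsetD[OF ideal_subset_carrier[OF I(1)]]
  have dec: "I m \<subseteq> I n" if "n \<le> m" for m n
    using that I(2) by (rule lift_Suc_antimono_le[rotated])
  have "\<exists>n1. \<forall>n\<ge>n1. I n \<inter> p = I n1 \<inter> p"
    using I p_ideal by (intro bounded_chains_dcc[OF b] i_intersect) auto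
  then obtain n1 where n1: "\<And>n. n \<ge> n1 \<Longrightarrow> I n \<inter> p = I n1 \<inter> p" by blast
  obtain n2 where n2: "\<And>n a. \<lbrakk>n \<ge> n2; a \<in> I n2\<rbrakk> \<Longrightarrow> \<exists>a'\<in>I n. a \<ominus> a' \<in> ann p"
    using dcc_mod_ann[OF b, of I, OF I] by blast
  show "\<exists>n0. \<forall>n\<ge>n0. module_isomorphic R (ideal_module R (I n)) (ideal_module R (I n0))"
  proof (cases "\<exists>n. I n \<subseteq> p")
    case True
    then obtain n3 where n3: "I n3 \<subseteq> p" by blast
    define m where "m = max n1 n3"
    have "module_isomorphic R (ideal_module R (I n)) (ideal_module R (I m))" if n: "n \<ge> m" for n
    proof -
      have "I n \<subseteq> p" "I m \<subseteq> p" using n3 dec[of n3 n] dec[of n3 m] n by (auto simp: m_def)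
      moreover have "I n \<inter> p = I m \<inter> p" using n1[of n] n1[of m] n by (simp add: m_def)
      ultimately have "I n = I m" by blast
      then show ?thesis unfolding module_isomorphic_def module_hom_def
        by (intro bexI[of _ id]) auto
    qed
    then show ?thesis by blast
  next
    case False
    define m where "m = max n1 n2"
    obtain x where x: "x \<in> I m - p" "\<And>z. z \<in> I m \<Longrightarrow> \<exists>a\<in>carrier R. z \<ominus> a \<otimes> x \<in> p"
      using generator_mod_p[OF I(1)[of m]] False by blast
    have xC: "x \<in> carrier R" using x IC by blast
    define J where "J = I m \<inter> p"
    have J: "ideal J R" "J \<subseteq> p" "J \<subseteq> I m" unfolding J_def using I(1) p_ideal by (auto intro: i_intersect)
    have A: "ideal (ann p) R" using p_carrier by (intro ann_ideal) auto
    have "module_isomorphic R (ideal_module R (I n)) (ideal_module R (I m))" if n: "n \<ge> m" for n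
    proof -
      \<comment> \<open>The isomorphism will be the transfer from \<open>y'\<close> to \<open>x\<close>, where \<open>y'\<close> is a corrected generator of \<open>I n\<close>.\<close>
      have nm: "n \<ge> n1" "n \<ge> n2" "m \<ge> n1" "m \<ge> n2" using n by (auto simp: m_def)
      have Jn: "J = I n \<inter> p" unfolding J_def n1[OF nm(1)] n1[OF nm(3)] ..
      have JIn: "J \<subseteq> I n" unfolding Jn by simp
      have InIm: "I n \<subseteq> I m" using dec[OF n] .
      obtain y where y: "y \<in> I n - p" "\<And>z. z \<in> I n \<Longrightarrow> \<exists>a\<in>carrier R. z \<ominus> a \<otimes> y \<in> p"
        using generator_mod_p[OF I(1)[of n]] False by blast
      have yC: "y \<in> carrier R" using y IC by blast
      obtain r where r: "r \<in> carrier R" "y \<ominus> r \<otimes> x \<in> p" using x(2) y(1) InIm by blast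
      have rJ: "y \<ominus> r \<otimes> x \<in> J" unfolding J_def
        using r x(1) y(1) InIm ideal_diff_mem[OF I(1)[of m], of y "r \<otimes> x"]
          ideal_mult_mem[OF I(1)[of m] r(1), of x] by blast
      have "x \<in> I n2" using x(1) dec[OF nm(4)] by blast
      then obtain x' where x': "x' \<in> I n" "x \<ominus> x' \<in> ann p" using n2[OF nm(2)] by blast
      obtain s where s: "s \<in> carrier R" "x' \<ominus> s \<otimes> y \<in> p" using y(2) x'(1) by blast
      have sJ: "x' \<ominus> s \<otimes> y \<in> J" unfolding Jn
        using s x'(1) y(1) ideal_diff_mem[OF I(1)[of n], of x' "s \<otimes> y"]
          ideal_mult_mem[OF I(1)[of n] s(1), of y] by blast
      have x'C: "x' \<in> carrier R" using x' IC by blast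
      define K where "K = J <+>\<^bsub>R\<^esub> ann p"
      have K: "ideal K R" unfolding K_def using J(1) A by (rule add_ideals)
      have JK: "J \<subseteq> K"
      proof
        fix z assume z: "z \<in> J"
        show "z \<in> K" unfolding K_def
          using ideal_plus_memI[OF z ideal_zero_mem[OF A]] z J(2) p_carrier by auto
      qed
      have AK: "ann p \<subseteq> K"
      proof
        fix z assume z: "z \<in> ann p"
        show "z \<in> K" unfolding K_def
          using ideal_plus_memI[OF ideal_zero_mem[OF J(1)] z] z ideal_subset_carrier[OF A] by auto
      qed
      obtain u v where u: "u \<in> carrier R" and v: "v \<in> carrier R" and uv: "\<one> \<ominus> u \<otimes> v \<in> ann p"
        and lift: "\<forall>K x. ideal K R \<longrightarrow> ann p \<subseteq> K \<longrightarrow> x \<in> carrier R \<longrightarrow>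
          (\<one> \<ominus> r \<otimes> s) \<otimes> x \<in> K \<longrightarrow> (u \<ominus> r) \<otimes> x \<in> K"
        by (rule unit_lift_mod_ann[OF b r(1) s(1)])
      have "(\<one> \<ominus> r \<otimes> s) \<otimes> x = (x \<ominus> x') \<oplus> ((x' \<ominus> s \<otimes> y) \<oplus> s \<otimes> (y \<ominus> r \<otimes> x))"
        using r(1) s(1) xC x'C yC by algebra
      also have "\<dots> \<in> K"
      proof (rule ideal_add_mem[OF K])
        show "x \<ominus> x' \<in> K" using x'(2) AK by blast
        have "s \<otimes> (y \<ominus> r \<otimes> x) \<in> K" using rJ JK by (intro ideal_mult_mem[OF K s(1)]) blast
        then show "(x' \<ominus> s \<otimes> y) \<oplus> s \<otimes> (y \<ominus> r \<otimes> x) \<in> K"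
          using sJ JK by (intro ideal_add_mem[OF K]) blast+
      qed
      finally have ur: "(u \<ominus> r) \<otimes> x \<in> K" by (rule lift[rule_format, OF K AK xC])
      have "y \<ominus> u \<otimes> x = (y \<ominus> r \<otimes> x) \<ominus> (u \<ominus> r) \<otimes> x" using r(1) u xC yC by algebra
      also have "\<dots> \<in> K" by (rule ideal_diff_mem[OF K _ ur]) (use rJ JK in blast)
      finally have "y \<ominus> u \<otimes> x \<in> J <+>\<^bsub>R\<^esub> ann p" unfolding K_def .
      then obtain j c where jc: "j \<in> J" "c \<in> ann p" "y \<ominus> u \<otimes> x = j \<oplus> c"
        by (rule ideal_plus_memE)
      have jC: "j \<in> carrier R" and cC: "c \<in> carrier R" using jc J(2) p_carrier ideal_subset_carrier[OF A] by auto
      define y' where "y' = y \<ominus> j"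
      have y'C: "y' \<in> carrier R" using yC jC by (simp add: y'_def)
      have "y' = (y \<ominus> u \<otimes> x) \<ominus> j \<oplus> u \<otimes> x" unfolding y'_def using yC jC u xC by algebra
      also have "\<dots> = u \<otimes> x \<oplus> c" unfolding jc(3) using cC jC u xC by algebra
      finally have y'_eq: "y' = u \<otimes> x \<oplus> c" .
      have uxy: "q \<otimes> y' = u \<otimes> (q \<otimes> x)" if q: "q \<in> p" for q
      proof -
        have "q \<otimes> y' = u \<otimes> (q \<otimes> x) \<oplus> c \<otimes> q" unfolding y'_eq using u xC cC p_carrier[OF q] by algebra
        also have "c \<otimes> q = \<zero>" using jc(2) q unfolding ann_def by blast
        finally show ?thesis using u xC p_carrier[OF q] by simp
      qed
      have vyx: "q \<otimes> x = v \<otimes> (q \<otimes> y')" if q: "q \<in> p" for q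
      proof -
        have qx: "q \<otimes> x \<in> p" using q xC by (intro ideal_mult_mem_right[OF p_ideal])
        have "v \<otimes> (u \<otimes> (q \<otimes> x)) = q \<otimes> x \<ominus> (\<one> \<ominus> u \<otimes> v) \<otimes> (q \<otimes> x)"
          using u v p_carrier[OF q] xC by algebra
        also have "(\<one> \<ominus> u \<otimes> v) \<otimes> (q \<otimes> x) = \<zero>" using uv qx unfolding ann_def by blast
        finally show ?thesis unfolding uxy[OF q] using p_carrier[OF qx] by (simp add: a_minus_def)
      qed
      have y': "y' \<in> I n - p"
      proof -
        have "y' \<in> I n" unfolding y'_def using y(1) jc(1) Jn by (intro ideal_diff_mem[OF I(1)]) auto
        moreover have "y' \<notin> p"
        proof
          assume "y' \<in> p"
          then have "y' \<oplus> j \<in> p" using jc(1) J(2) by (intro ideal_add_mem[OF p_ideal]) auto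
          then show False using y(1) yC jC by (simp add: y'_def minus_add_cancel)
        qed
        ultimately show ?thesis by simp
      qed
      have geny': "\<exists>a\<in>carrier R. z \<ominus> a \<otimes> y' \<in> J" if z: "z \<in> I n" for z
      proof -
        obtain a where a: "a \<in> carrier R" "z \<ominus> a \<otimes> y \<in> p" using y(2) z by blast
        have "z \<ominus> a \<otimes> y' = (z \<ominus> a \<otimes> y) \<oplus> a \<otimes> j"
          unfolding y'_def using IC[OF z] a(1) yC jC by algebra
        also have "\<dots> \<in> p"
          by (rule ideal_add_mem[OF p_ideal a(2) ideal_mult_mem[OF p_ideal a(1)]]) (use jc(1) J(2) in blast)
        finally have "z \<ominus> a \<otimes> y' \<in> p" .
        moreover have "z \<ominus> a \<otimes> y' \<in> I n"
          by (rule ideal_diff_mem[OF I(1) z ideal_mult_mem[OF I(1) a(1)]]) (use y' in simp)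
        ultimately show ?thesis unfolding Jn using a(1) by blast
      qed
      have genx: "\<exists>a\<in>carrier R. z \<ominus> a \<otimes> x \<in> J" if z: "z \<in> I m" for z
      proof -
        obtain a where a: "a \<in> carrier R" "z \<ominus> a \<otimes> x \<in> p" using x(2) z by blast
        moreover have "z \<ominus> a \<otimes> x \<in> I m"
          by (rule ideal_diff_mem[OF I(1) z ideal_mult_mem[OF I(1) a(1)]]) (use x(1) in simp)
        ultimately show ?thesis unfolding J_def by blast
      qed
      have vu: "\<one> \<ominus> v \<otimes> u \<in> ann p" using uv u v by (simp add: m_comm)
      show ?thesis
        by (rule module_isomorphic_transfer[OF I(1) I(1) J(1,2) JIn J(3) v u vu y' geny' x(1) genx vyx])
    qed
    then show ?thesis by blast
  qed
qed

end

section \<open>The field of fractions\<close>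

context "domain"
begin

lemma equiv_frac_rel: "equiv (carrier R \<times> (carrier R - {\<zero>})) (frac_rel R)"
proof (rule equivI)
  show "frac_rel R \<subseteq> (carrier R \<times> (carrier R - {\<zero>})) \<times> (carrier R \<times> (carrier R - {\<zero>}))"
    by (auto simp: frac_rel_def)
  show "refl_on (carrier R \<times> (carrier R - {\<zero>})) (frac_rel R)"
    by (auto simp: refl_on_def frac_rel_def)
  show "sym (frac_rel R)" by (auto simp: sym_def frac_rel_def)
  have tr: "a \<otimes> f = e \<otimes> b"
    if c: "a \<in> carrier R" "b \<in> carrier R" "c \<in> carrier R" "d \<in> carrier R" "d \<noteq> \<zero>"
      "e \<in> carrier R" "f \<in> carrier R" and eq: "a \<otimes> d = c \<otimes> b" "c \<otimes> f = e \<otimes> d" for a b c d e f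
  proof -
    have "d \<otimes> (a \<otimes> f) = (a \<otimes> d) \<otimes> f" using c by algebra
    also have "\<dots> = (c \<otimes> f) \<otimes> b" unfolding eq(1) using c by algebra
    also have "\<dots> = d \<otimes> (e \<otimes> b)" unfolding eq(2) using c by algebra
    finally show ?thesis using c m_lcancel by simp
  qed
  show "trans (frac_rel R)"
  proof (rule transI)
    fix x y z assume "(x, y) \<in> frac_rel R" "(y, z) \<in> frac_rel R"
    then show "(x, z) \<in> frac_rel R"
      using tr[of "fst x" "snd x" "fst y" "snd y" "fst z" "snd z"]
      by (cases x; cases y; cases z) (simp add: frac_rel_def)
  qed
qed

lemma fraction_eq_iff:
  assumes "a \<in> carrier R" "b \<in> carrier R - {\<zero>}" "c \<in> carrier R" "d \<in> carrier R - {\<zero>}"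
  shows "fraction R a b = fraction R c d \<longleftrightarrow> a \<otimes> d = c \<otimes> b"
  unfolding fraction_def
  using eq_equiv_class_iff[OF equiv_frac_rel, of "(a, b)" "(c, d)"] assms
  by (auto simp: frac_rel_def)

lemma mem_fraction_iff:
  assumes "a \<in> carrier R" "b \<in> carrier R - {\<zero>}"
  shows "(c, d) \<in> fraction R a b \<longleftrightarrow> c \<in> carrier R \<and> d \<in> carrier R - {\<zero>} \<and> a \<otimes> d = c \<otimes> b"
  using assms by (auto simp: fraction_def frac_rel_def)

lemma fraction_in_frac_field:
  "\<lbrakk>a \<in> carrier R; b \<in> carrier R - {\<zero>}\<rbrakk> \<Longrightarrow> fraction R a b \<in> carrier (frac_field R)"
  unfolding frac_field_def fraction_def by (auto intro!: quotientI)

lemma frac_field_cases: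
  assumes "X \<in> carrier (frac_field R)"
  obtains a b where "a \<in> carrier R" "b \<in> carrier R - {\<zero>}" "X = fraction R a b"
  using assms unfolding frac_field_def fraction_def by (auto elim!: quotientE)

lemma nonzero_mult: "\<lbrakk>b \<in> carrier R - {\<zero>}; d \<in> carrier R - {\<zero>}\<rbrakk> \<Longrightarrow> b \<otimes> d \<in> carrier R - {\<zero>}"
  using integral by auto

text \<open>The operations of the field of fractions are unions over representatives. They are well defined
  if all representatives contribute the same set.\<close>
lemma UN_fraction_const:
  assumes ab: "a \<in> carrier R" "b \<in> carrier R - {\<zero>}"
    and "\<And>a' b'. \<lbrakk>a' \<in> carrier R; b' \<in> carrier R - {\<zero>}; a \<otimes> b' = a' \<otimes> b\<rbrakk> \<Longrightarrow> f a' b' = C"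
  shows "(\<Union>(a', b')\<in>fraction R a b. f a' b') = C"
proof -
  have "(a, b) \<in> fraction R a b" using ab by (simp add: mem_fraction_iff)
  moreover have "(\<lambda>(a', b'). f a' b') z = C" if "z \<in> fraction R a b" for z
    using that assms(3) mem_fraction_iff[OF ab] by (cases z) auto
  ultimately show ?thesis by blast
qed

lemma frac_mult:
  assumes ab: "a \<in> carrier R" "b \<in> carrier R - {\<zero>}" and cd: "c \<in> carrier R" "d \<in> carrier R - {\<zero>}"
  shows "fraction R a b \<otimes>\<^bsub>frac_field R\<^esub> fraction R c d = fraction R (a \<otimes> c) (b \<otimes> d)"
proof -
  have "(\<Union>(a', b')\<in>fraction R a b. \<Union>(c', d')\<in>fraction R c d. fraction R (a' \<otimes> c') (b' \<otimes> d'))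
      = fraction R (a \<otimes> c) (b \<otimes> d)"
  proof (intro UN_fraction_const ab cd)
    fix a' b' c' d' assume *: "a' \<in> carrier R" "b' \<in> carrier R - {\<zero>}" "a \<otimes> b' = a' \<otimes> b"
      "c' \<in> carrier R" "d' \<in> carrier R - {\<zero>}" "c \<otimes> d' = c' \<otimes> d"
    have c: "a \<in> carrier R" "b \<in> carrier R" "c \<in> carrier R" "d \<in> carrier R" "b' \<in> carrier R" "d' \<in> carrier R"
      using * ab cd by auto
    have "(a' \<otimes> c') \<otimes> (b \<otimes> d) = (a' \<otimes> b) \<otimes> (c' \<otimes> d)" using c *(1,4) by algebra
    also have "\<dots> = (a \<otimes> c) \<otimes> (b' \<otimes> d')"
      unfolding *(3)[symmetric] *(6)[symmetric] using c by algebra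
    finally have "(a' \<otimes> c') \<otimes> (b \<otimes> d) = (a \<otimes> c) \<otimes> (b' \<otimes> d')" .
    then show "fraction R (a' \<otimes> c') (b' \<otimes> d') = fraction R (a \<otimes> c) (b \<otimes> d)"
      using c *(1,4) nonzero_mult[OF *(2,5)] nonzero_mult[OF ab(2) cd(2)]
      by (subst fraction_eq_iff) (simp_all del: Diff_iff)
  qed
  then show ?thesis by (simp add: frac_field_def)
qed

lemma frac_add:
  assumes ab: "a \<in> carrier R" "b \<in> carrier R - {\<zero>}" and cd: "c \<in> carrier R" "d \<in> carrier R - {\<zero>}"
  shows "fraction R a b \<oplus>\<^bsub>frac_field R\<^esub> fraction R c d = fraction R (a \<otimes> d \<oplus> c \<otimes> b) (b \<otimes> d)"
proof -
  have "(\<Union>(a', b')\<in>fraction R a b. \<Union>(c', d')\<in>fraction R c d.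
      fraction R (a' \<otimes> d' \<oplus> c' \<otimes> b') (b' \<otimes> d')) = fraction R (a \<otimes> d \<oplus> c \<otimes> b) (b \<otimes> d)"
  proof (intro UN_fraction_const ab cd)
    fix a' b' c' d' assume *: "a' \<in> carrier R" "b' \<in> carrier R - {\<zero>}" "a \<otimes> b' = a' \<otimes> b"
      "c' \<in> carrier R" "d' \<in> carrier R - {\<zero>}" "c \<otimes> d' = c' \<otimes> d"
    have c: "a \<in> carrier R" "b \<in> carrier R" "c \<in> carrier R" "d \<in> carrier R" "b' \<in> carrier R" "d' \<in> carrier R"
      using * ab cd by auto
    have "(a' \<otimes> d' \<oplus> c' \<otimes> b') \<otimes> (b \<otimes> d) = (a' \<otimes> b) \<otimes> (d' \<otimes> d) \<oplus> (c' \<otimes> d) \<otimes> (b' \<otimes> b)"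
      using c *(1,4) by algebra
    also have "\<dots> = (a \<otimes> d \<oplus> c \<otimes> b) \<otimes> (b' \<otimes> d')"
      unfolding *(3)[symmetric] *(6)[symmetric] using c by algebra
    finally have eq: "(a' \<otimes> d' \<oplus> c' \<otimes> b') \<otimes> (b \<otimes> d) = (a \<otimes> d \<oplus> c \<otimes> b) \<otimes> (b' \<otimes> d')" .
    show "fraction R (a' \<otimes> d' \<oplus> c' \<otimes> b') (b' \<otimes> d') = fraction R (a \<otimes> d \<oplus> c \<otimes> b) (b \<otimes> d)"
      using eq c *(1,4) nonzero_mult[OF *(2,5)] nonzero_mult[OF ab(2) cd(2)]
      by (subst fraction_eq_iff) (simp_all del: Diff_iff)
  qed
  then show ?thesis by (simp add: frac_field_def)
qed

lemma frac_smult: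
  assumes r: "r \<in> carrier R" and ab: "a \<in> carrier R" "b \<in> carrier R - {\<zero>}"
  shows "r \<odot>\<^bsub>frac_field R\<^esub> fraction R a b = fraction R (r \<otimes> a) b"
proof -
  have "(\<Union>(a', b')\<in>fraction R a b. fraction R (r \<otimes> a') b') = fraction R (r \<otimes> a) b"
  proof (intro UN_fraction_const ab)
    fix a' b' assume *: "a' \<in> carrier R" "b' \<in> carrier R - {\<zero>}" "a \<otimes> b' = a' \<otimes> b"
    have c: "b \<in> carrier R" "b' \<in> carrier R" using ab * by auto
    have "(r \<otimes> a') \<otimes> b = r \<otimes> (a' \<otimes> b)" using c * r by algebra
    also have "\<dots> = (r \<otimes> a) \<otimes> b'" unfolding *(3)[symmetric] using c ab(1) r by algebra
    finally show "fraction R (r \<otimes> a') b' = fraction R (r \<otimes> a) b"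
      using * ab r by (subst fraction_eq_iff) auto
  qed
  then show ?thesis by (simp add: frac_field_def)
qed

lemma frac_one: "\<one>\<^bsub>frac_field R\<^esub> = fraction R \<one> \<one>"
  and frac_zero: "\<zero>\<^bsub>frac_field R\<^esub> = fraction R \<zero> \<one>"
  by (simp_all add: frac_field_def)

lemma one_nonzero: "\<one> \<in> carrier R - {\<zero>}"
  by simp

lemma fraction_eqI:
  "\<lbrakk>a \<in> carrier R; b \<in> carrier R - {\<zero>}; c \<in> carrier R; d \<in> carrier R - {\<zero>}; a \<otimes> d = c \<otimes> b\<rbrakk>
    \<Longrightarrow> fraction R a b = fraction R c d"
  by (simp only: fraction_eq_iff)

lemma frac_field_cring: "cring (frac_field R)"
proof (rule cringI)
  let ?K = "frac_field R"
  note nz = nonzero_mult and one = one_nonzero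
  show "abelian_group ?K"
  proof (rule abelian_groupI)
    show "\<zero>\<^bsub>?K\<^esub> \<in> carrier ?K" unfolding frac_zero by (rule fraction_in_frac_field) auto
  next
    fix X Y assume XYZ: "X \<in> carrier ?K" "Y \<in> carrier ?K"
    obtain a b where x: "a \<in> carrier R" "b \<in> carrier R - {\<zero>}" "X = fraction R a b"
      using XYZ(1) by (rule frac_field_cases)
    obtain c d where y: "c \<in> carrier R" "d \<in> carrier R - {\<zero>}" "Y = fraction R c d"
      using XYZ(2) by (rule frac_field_cases)
    note * = x y
    have c: "b \<in> carrier R" "d \<in> carrier R" using * by auto
    show "X \<oplus>\<^bsub>?K\<^esub> Y \<in> carrier ?K"
      unfolding *(3,6) frac_add[OF *(1,2,4,5)] using * c
      by (intro fraction_in_frac_field nz) auto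
    show "X \<oplus>\<^bsub>?K\<^esub> Y = Y \<oplus>\<^bsub>?K\<^esub> X"
      unfolding *(3,6) frac_add[OF *(1,2,4,5)] frac_add[OF *(4,5,1,2)]
      using *(1,4) c by (simp add: m_comm a_comm)
  next
    fix X Y Z assume XYZ: "X \<in> carrier ?K" "Y \<in> carrier ?K" "Z \<in> carrier ?K"
    obtain a b where x: "a \<in> carrier R" "b \<in> carrier R - {\<zero>}" "X = fraction R a b"
      using XYZ(1) by (rule frac_field_cases)
    obtain c d where y: "c \<in> carrier R" "d \<in> carrier R - {\<zero>}" "Y = fraction R c d"
      using XYZ(2) by (rule frac_field_cases)
    obtain e f where z: "e \<in> carrier R" "f \<in> carrier R - {\<zero>}" "Z = fraction R e f"
      using XYZ(3) by (rule frac_field_cases)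
    note * = x y z
    have c: "b \<in> carrier R" "d \<in> carrier R" "f \<in> carrier R" using * by auto
    have l: "(X \<oplus>\<^bsub>?K\<^esub> Y) \<oplus>\<^bsub>?K\<^esub> Z =
        fraction R ((a \<otimes> d \<oplus> c \<otimes> b) \<otimes> f \<oplus> e \<otimes> (b \<otimes> d)) ((b \<otimes> d) \<otimes> f)"
      unfolding *(3,6,9) frac_add[OF *(1,2,4,5)]
      by (rule frac_add) (use * c nz in auto)
    have r: "X \<oplus>\<^bsub>?K\<^esub> (Y \<oplus>\<^bsub>?K\<^esub> Z) =
        fraction R (a \<otimes> (d \<otimes> f) \<oplus> (c \<otimes> f \<oplus> e \<otimes> d) \<otimes> b) (b \<otimes> (d \<otimes> f))"
      unfolding *(3,6,9) frac_add[OF *(4,5,7,8)]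
      by (rule frac_add) (use * c nz in auto)
    have "(a \<otimes> d \<oplus> c \<otimes> b) \<otimes> f \<oplus> e \<otimes> (b \<otimes> d) = a \<otimes> (d \<otimes> f) \<oplus> (c \<otimes> f \<oplus> e \<otimes> d) \<otimes> b"
      using *(1,4,7) c by algebra
    then show "X \<oplus>\<^bsub>?K\<^esub> Y \<oplus>\<^bsub>?K\<^esub> Z = X \<oplus>\<^bsub>?K\<^esub> (Y \<oplus>\<^bsub>?K\<^esub> Z)"
      unfolding l r using c by (simp add: m_assoc)
  next
    fix X assume "X \<in> carrier ?K"
    then obtain a b where *: "a \<in> carrier R" "b \<in> carrier R - {\<zero>}" "X = fraction R a b"
      by (rule frac_field_cases)
    have c: "b \<in> carrier R" using * by auto
    show "\<zero>\<^bsub>?K\<^esub> \<oplus>\<^bsub>?K\<^esub> X = X"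
      unfolding *(3) frac_zero frac_add[OF zero_closed one *(1,2)] using *(1) c by simp
    have "fraction R (\<ominus> a) b \<oplus>\<^bsub>?K\<^esub> X = \<zero>\<^bsub>?K\<^esub>"
      unfolding *(3) frac_zero frac_add[OF a_inv_closed[OF *(1)] *(2,1,2)]
      using *(1,2) c nz[OF *(2,2)] by (intro fraction_eqI) (auto simp: l_minus l_neg)
    then show "\<exists>Y\<in>carrier ?K. Y \<oplus>\<^bsub>?K\<^esub> X = \<zero>\<^bsub>?K\<^esub>"
      using fraction_in_frac_field[OF a_inv_closed[OF *(1)] *(2)] by blast
  qed
  show "comm_monoid ?K"
  proof (rule comm_monoidI)
    show "\<one>\<^bsub>?K\<^esub> \<in> carrier ?K" unfolding frac_one by (rule fraction_in_frac_field) auto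
  next
    fix X Y assume XYZ: "X \<in> carrier ?K" "Y \<in> carrier ?K"
    obtain a b where x: "a \<in> carrier R" "b \<in> carrier R - {\<zero>}" "X = fraction R a b"
      using XYZ(1) by (rule frac_field_cases)
    obtain c d where y: "c \<in> carrier R" "d \<in> carrier R - {\<zero>}" "Y = fraction R c d"
      using XYZ(2) by (rule frac_field_cases)
    note * = x y
    have c: "b \<in> carrier R" "d \<in> carrier R" using * by auto
    show "X \<otimes>\<^bsub>?K\<^esub> Y \<in> carrier ?K"
      unfolding *(3,6) frac_mult[OF *(1,2,4,5)] using * c
      by (intro fraction_in_frac_field nz) auto
    show "X \<otimes>\<^bsub>?K\<^esub> Y = Y \<otimes>\<^bsub>?K\<^esub> X"
      unfolding *(3,6) frac_mult[OF *(1,2,4,5)] frac_mult[OF *(4,5,1,2)]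
      using *(1,4) c by (simp add: m_comm)
  next
    fix X Y Z assume XYZ: "X \<in> carrier ?K" "Y \<in> carrier ?K" "Z \<in> carrier ?K"
    obtain a b where x: "a \<in> carrier R" "b \<in> carrier R - {\<zero>}" "X = fraction R a b"
      using XYZ(1) by (rule frac_field_cases)
    obtain c d where y: "c \<in> carrier R" "d \<in> carrier R - {\<zero>}" "Y = fraction R c d"
      using XYZ(2) by (rule frac_field_cases)
    obtain e f where z: "e \<in> carrier R" "f \<in> carrier R - {\<zero>}" "Z = fraction R e f"
      using XYZ(3) by (rule frac_field_cases)
    note * = x y z
    have c: "b \<in> carrier R" "d \<in> carrier R" "f \<in> carrier R" using * by auto
    have l: "(X \<otimes>\<^bsub>?K\<^esub> Y) \<otimes>\<^bsub>?K\<^esub> Z = fraction R ((a \<otimes> c) \<otimes> e) ((b \<otimes> d) \<otimes> f)"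
      unfolding *(3,6,9) frac_mult[OF *(1,2,4,5)]
      by (rule frac_mult) (use * c nz in auto)
    have r: "X \<otimes>\<^bsub>?K\<^esub> (Y \<otimes>\<^bsub>?K\<^esub> Z) = fraction R (a \<otimes> (c \<otimes> e)) (b \<otimes> (d \<otimes> f))"
      unfolding *(3,6,9) frac_mult[OF *(4,5,7,8)]
      by (rule frac_mult) (use * c nz in auto)
    show "X \<otimes>\<^bsub>?K\<^esub> Y \<otimes>\<^bsub>?K\<^esub> Z = X \<otimes>\<^bsub>?K\<^esub> (Y \<otimes>\<^bsub>?K\<^esub> Z)"
      unfolding l r using c *(1,4,7) by (simp add: m_assoc)
  next
    fix X assume "X \<in> carrier ?K"
    then obtain a b where *: "a \<in> carrier R" "b \<in> carrier R - {\<zero>}" "X = fraction R a b"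
      by (rule frac_field_cases)
    show "\<one>\<^bsub>?K\<^esub> \<otimes>\<^bsub>?K\<^esub> X = X"
      unfolding *(3) frac_one frac_mult[OF one_closed one *(1,2)] using *(1,2) by simp
  qed
  fix X Y Z assume XYZ: "X \<in> carrier ?K" "Y \<in> carrier ?K" "Z \<in> carrier ?K"
  obtain a b where x: "a \<in> carrier R" "b \<in> carrier R - {\<zero>}" "X = fraction R a b"
    using XYZ(1) by (rule frac_field_cases)
  obtain c d where y: "c \<in> carrier R" "d \<in> carrier R - {\<zero>}" "Y = fraction R c d"
    using XYZ(2) by (rule frac_field_cases)
  obtain e f where z: "e \<in> carrier R" "f \<in> carrier R - {\<zero>}" "Z = fraction R e f"
    using XYZ(3) by (rule frac_field_cases)
  note * = x y z
  have c: "b \<in> carrier R" "d \<in> carrier R" "f \<in> carrier R" using * by auto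
  have l: "(X \<oplus>\<^bsub>?K\<^esub> Y) \<otimes>\<^bsub>?K\<^esub> Z = fraction R ((a \<otimes> d \<oplus> c \<otimes> b) \<otimes> e) ((b \<otimes> d) \<otimes> f)"
    unfolding *(3,6,9) frac_add[OF *(1,2,4,5)]
    by (rule frac_mult) (use * c nz in auto)
  have r: "X \<otimes>\<^bsub>?K\<^esub> Z \<oplus>\<^bsub>?K\<^esub> Y \<otimes>\<^bsub>?K\<^esub> Z =
      fraction R ((a \<otimes> e) \<otimes> (d \<otimes> f) \<oplus> (c \<otimes> e) \<otimes> (b \<otimes> f)) ((b \<otimes> f) \<otimes> (d \<otimes> f))"
    unfolding *(3,6,9) frac_mult[OF *(1,2,7,8)] frac_mult[OF *(4,5,7,8)]
    by (rule frac_add) (use * c nz in auto)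
  have eq: "(a \<otimes> d \<oplus> c \<otimes> b) \<otimes> e \<otimes> ((b \<otimes> f) \<otimes> (d \<otimes> f)) =
      ((a \<otimes> e) \<otimes> (d \<otimes> f) \<oplus> (c \<otimes> e) \<otimes> (b \<otimes> f)) \<otimes> ((b \<otimes> d) \<otimes> f)"
    using *(1,4,7) c by algebra
  show "(X \<oplus>\<^bsub>?K\<^esub> Y) \<otimes>\<^bsub>?K\<^esub> Z = X \<otimes>\<^bsub>?K\<^esub> Z \<oplus>\<^bsub>?K\<^esub> Y \<otimes>\<^bsub>?K\<^esub> Z"
    unfolding l r by (rule fraction_eqI[OF _ _ _ _ eq]) (use * c nz in auto)
qed

lemma frac_field_field: "field (frac_field R)"
proof (rule cring.cring_fieldI2[OF frac_field_cring])
  show "\<zero>\<^bsub>frac_field R\<^esub> \<noteq> \<one>\<^bsub>frac_field R\<^esub>"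
    unfolding frac_zero frac_one using fraction_eq_iff[OF zero_closed one_nonzero one_closed one_nonzero] by simp
  fix X assume X: "X \<in> carrier (frac_field R)" "X \<noteq> \<zero>\<^bsub>frac_field R\<^esub>"
  obtain a b where *: "a \<in> carrier R" "b \<in> carrier R - {\<zero>}" "X = fraction R a b"
    using X(1) by (rule frac_field_cases)
  have "a \<noteq> \<zero>"
  proof
    assume "a = \<zero>"
    then have "X = \<zero>\<^bsub>frac_field R\<^esub>"
      unfolding *(3) frac_zero using * by (intro fraction_eqI) auto
    then show False using X by simp
  qed
  then have a: "a \<in> carrier R - {\<zero>}" using * by simp
  have b: "b \<in> carrier R" using * by simp
  have "X \<otimes>\<^bsub>frac_field R\<^esub> fraction R b a = \<one>\<^bsub>frac_field R\<^esub>"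
    unfolding *(3) frac_one frac_mult[OF *(1,2) b a]
    using * a b nonzero_mult[OF *(2) a] by (intro fraction_eqI) (auto simp: m_comm)
  then show "\<exists>Y\<in>carrier (frac_field R). X \<otimes>\<^bsub>frac_field R\<^esub> Y = \<one>\<^bsub>frac_field R\<^esub>"
    using fraction_in_frac_field[OF b a] by blast
qed

lemma frac_smult_closed:
  assumes "r \<in> carrier R" "X \<in> carrier (frac_field R)"
  shows "r \<odot>\<^bsub>frac_field R\<^esub> X \<in> carrier (frac_field R)"
proof -
  obtain a b where *: "a \<in> carrier R" "b \<in> carrier R - {\<zero>}" "X = fraction R a b"
    using assms(2) by (rule frac_field_cases)
  then show ?thesis using assms(1) by (simp only: frac_smult) (simp add: fraction_in_frac_field)
qed

lemma frac_smult_mult: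
  assumes "r \<in> carrier R" "X \<in> carrier (frac_field R)" "Y \<in> carrier (frac_field R)"
  shows "(r \<odot>\<^bsub>frac_field R\<^esub> X) \<otimes>\<^bsub>frac_field R\<^esub> Y = X \<otimes>\<^bsub>frac_field R\<^esub> (r \<odot>\<^bsub>frac_field R\<^esub> Y)"
    and "r \<odot>\<^bsub>frac_field R\<^esub> (X \<otimes>\<^bsub>frac_field R\<^esub> Y) = X \<otimes>\<^bsub>frac_field R\<^esub> (r \<odot>\<^bsub>frac_field R\<^esub> Y)"
proof -
  obtain a b where *: "a \<in> carrier R" "b \<in> carrier R - {\<zero>}" "X = fraction R a b"
    using assms(2) by (rule frac_field_cases)
  obtain c d where **: "c \<in> carrier R" "d \<in> carrier R - {\<zero>}" "Y = fraction R c d"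
    using assms(3) by (rule frac_field_cases)
  have 1: "(r \<odot>\<^bsub>frac_field R\<^esub> X) \<otimes>\<^bsub>frac_field R\<^esub> Y = fraction R ((r \<otimes> a) \<otimes> c) (b \<otimes> d)"
    unfolding *(3) **(3) frac_smult[OF assms(1) *(1,2)] by (rule frac_mult) (use * ** assms in auto)
  have 2: "X \<otimes>\<^bsub>frac_field R\<^esub> (r \<odot>\<^bsub>frac_field R\<^esub> Y) = fraction R (a \<otimes> (r \<otimes> c)) (b \<otimes> d)"
    unfolding *(3) **(3) frac_smult[OF assms(1) **(1,2)] by (rule frac_mult) (use * ** assms in auto)
  have 3: "r \<odot>\<^bsub>frac_field R\<^esub> (X \<otimes>\<^bsub>frac_field R\<^esub> Y) = fraction R (r \<otimes> (a \<otimes> c)) (b \<otimes> d)"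
    unfolding *(3) **(3) frac_mult[OF *(1,2) **(1,2)]
    by (rule frac_smult[OF assms(1) _ nonzero_mult[OF *(2) **(2)]]) (use * ** in auto)
  show "(r \<odot>\<^bsub>frac_field R\<^esub> X) \<otimes>\<^bsub>frac_field R\<^esub> Y = X \<otimes>\<^bsub>frac_field R\<^esub> (r \<odot>\<^bsub>frac_field R\<^esub> Y)"
    unfolding 1 2 using assms(1) *(1) **(1) by (simp add: m_ac)
  show "r \<odot>\<^bsub>frac_field R\<^esub> (X \<otimes>\<^bsub>frac_field R\<^esub> Y) = X \<otimes>\<^bsub>frac_field R\<^esub> (r \<odot>\<^bsub>frac_field R\<^esub> Y)"
    unfolding 2 3 using assms(1) *(1) **(1) by (simp add: m_ac)
qed

lemma frac_divisible:
  assumes "r \<in> carrier R - {\<zero>}" "X \<in> carrier (frac_field R)"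
  shows "\<exists>Y\<in>carrier (frac_field R). X = r \<odot>\<^bsub>frac_field R\<^esub> Y"
proof -
  obtain a b where *: "a \<in> carrier R" "b \<in> carrier R - {\<zero>}" "X = fraction R a b"
    using assms(2) by (rule frac_field_cases)
  have c: "b \<in> carrier R" "r \<in> carrier R" using * assms by auto
  have nz: "b \<otimes> r \<in> carrier R - {\<zero>}" using * assms by (intro nonzero_mult)
  have "X = fraction R (r \<otimes> a) (b \<otimes> r)"
    unfolding *(3) by (rule fraction_eqI) (use * c nz in \<open>auto simp: m_ac\<close>)
  also have "\<dots> = r \<odot>\<^bsub>frac_field R\<^esub> fraction R a (b \<otimes> r)" using frac_smult[OF c(2) *(1) nz] by simp
  finally show ?thesis using fraction_in_frac_field[OF *(1) nz] by blast
qed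

end

section \<open>Extension of scalars\<close>

text \<open>The structure from which \<open>M \<otimes>\<^sub>D K\<close> becomes a \<open>K\<close>-module. The tensor product sees \<open>M\<close> through
  the relations that are divided out, and the assumptions ensure that these relations are formal
  sums over \<open>M \<times> K\<close> and are preserved by the multiplications with elements of \<open>K\<close>.\<close>
locale scalar_extension = K: cring K
  for D :: "('a, 'b) ring_scheme" and M :: "('a, 'm, 'd) module_scheme"
    and K :: "('a, 'k, 'e) module_scheme" +
  assumes M_add_closed: "\<lbrakk>x \<in> carrier M; x' \<in> carrier M\<rbrakk> \<Longrightarrow> x \<oplus>\<^bsub>M\<^esub> x' \<in> carrier M"
    and M_smult_closed: "\<lbrakk>r \<in> carrier D; x \<in> carrier M\<rbrakk> \<Longrightarrow> r \<odot>\<^bsub>M\<^esub> x \<in> carrier M"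
    and K_smult_closed: "\<lbrakk>r \<in> carrier D; y \<in> carrier K\<rbrakk> \<Longrightarrow> r \<odot>\<^bsub>K\<^esub> y \<in> carrier K"
    and K_smult_mult: "\<lbrakk>r \<in> carrier D; k \<in> carrier K; y \<in> carrier K\<rbrakk>
      \<Longrightarrow> r \<odot>\<^bsub>K\<^esub> (k \<otimes>\<^bsub>K\<^esub> y) = k \<otimes>\<^bsub>K\<^esub> (r \<odot>\<^bsub>K\<^esub> y)"
begin

abbreviation G where "G \<equiv> free_Abelian_group (carrier M \<times> carrier K)"
abbreviation N where "N \<equiv> tensor_kernel D M K"
abbreviation cls where "cls c \<equiv> N #>\<^bsub>G\<^esub> c"

sublocale G: comm_group G
  by (rule abelian_free_Abelian_group)

lemma gen_in_G: "\<lbrakk>x \<in> carrier M; y \<in> carrier K\<rbrakk> \<Longrightarrow> frag_of (x, y) \<in> carrier G"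
  by simp

lemma G_diff: "\<lbrakk>c \<in> carrier G; c' \<in> carrier G\<rbrakk> \<Longrightarrow> c - c' \<in> carrier G"
  using keys_diff by fastforce

lemma G_add: "\<lbrakk>c \<in> carrier G; c' \<in> carrier G\<rbrakk> \<Longrightarrow> c + c' \<in> carrier G"
  using G.m_closed by simp

lemma tensor_relations_in_G: "tensor_relations D M K \<subseteq> carrier G"
  unfolding tensor_relations_def
  by (auto simp del: carrier_free_Abelian_group_iff
      intro!: G_diff gen_in_G M_add_closed M_smult_closed K_smult_closed K.a_closed)

lemma subgroup_N: "subgroup N G"
  unfolding tensor_kernel_def by (rule G.generate_is_subgroup[OF tensor_relations_in_G])

lemma normal_N: "N \<lhd> G"
  using subgroup_N by (rule G.subgroup_imp_normal)

lemma relation_in_N: "c \<in> tensor_relations D M K \<Longrightarrow> c \<in> N"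
  unfolding tensor_kernel_def by (rule generate.incl)

lemma N_subset: "N \<subseteq> carrier G"
  by (rule subgroup.subset[OF subgroup_N])

lemma N_add: "\<lbrakk>c \<in> N; c' \<in> N\<rbrakk> \<Longrightarrow> c + c' \<in> N"
  using subgroup.m_closed[OF subgroup_N] by simp

lemma N_uminus: "c \<in> N \<Longrightarrow> - c \<in> N"
  using subgroup.m_inv_closed[OF subgroup_N] subsetD[OF N_subset] by simp

lemma N_diff: "\<lbrakk>c \<in> N; c' \<in> N\<rbrakk> \<Longrightarrow> c - c' \<in> N"
  using N_add[OF _ N_uminus] by simp

lemma N_zero: "0 \<in> N"
  using subgroup.one_closed[OF subgroup_N] by simp

lemma cls_eq_iff:
  assumes "c \<in> carrier G" "c' \<in> carrier G"
  shows "cls c = cls c' \<longleftrightarrow> c - c' \<in> N"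
proof
  assume "cls c = cls c'"
  then have "c \<in> cls c'" using G.rcos_self[OF assms(1) subgroup_N] by simp
  then show "c - c' \<in> N" by (auto simp: r_coset_def)
next
  assume d: "c - c' \<in> N"
  have "c = (c - c') \<otimes>\<^bsub>G\<^esub> c'" by simp
  then have "c \<in> cls c'" unfolding r_coset_def using d by blast
  then show "cls c = cls c'" using G.repr_independence[OF _ assms(2) subgroup_N] by simp
qed

text \<open>Multiplication by \<open>k\<close> on formal sums. It maps relations to relations and so induces the scalar
  multiplication of the base change (\<open>V_smult\<close>).\<close>
definition scale :: "'k \<Rightarrow> ('m \<times> 'k \<Rightarrow>\<^sub>0 int) \<Rightarrow> ('m \<times> 'k \<Rightarrow>\<^sub>0 int)"
  where "scale k = frag_extend (\<lambda>(x, y). frag_of (x, k \<otimes>\<^bsub>K\<^esub> y))"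

lemma scale_of [simp]: "scale k (frag_of (x, y)) = frag_of (x, k \<otimes>\<^bsub>K\<^esub> y)"
  by (simp add: scale_def)

lemma scale_diff: "scale k (c - c') = scale k c - scale k c'"
  by (simp add: scale_def frag_extend_diff)

lemma scale_add: "scale k (c + c') = scale k c + scale k c'"
  by (simp add: scale_def frag_extend_add)

lemma scale_zero [simp]: "scale k 0 = 0"
  by (simp add: scale_def)

lemma G_induct [consumes 1, case_names zero diff gen]:
  assumes "c \<in> carrier G" and "P 0"
    and "\<And>c c'. \<lbrakk>c \<in> carrier G; c' \<in> carrier G; P c; P c'\<rbrakk> \<Longrightarrow> P (c - c')"
    and "\<And>x y. \<lbrakk>x \<in> carrier M; y \<in> carrier K\<rbrakk> \<Longrightarrow> P (frag_of (x, y))"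
  shows "P c"
proof (rule free_Abelian_group_induct[of c "carrier M \<times> carrier K"])
  show "Poly_Mapping.keys c \<subseteq> carrier M \<times> carrier K" using assms(1) by simp
qed (use assms(2-) in auto)

lemma scale_closed:
  assumes "k \<in> carrier K" "c \<in> carrier G"
  shows "scale k c \<in> carrier G"
  using assms(2)
proof (induction rule: G_induct)
  case (diff c c')
  then show ?case unfolding scale_diff by (intro G_diff)
qed (use assms(1) in auto)

lemma scale_relation:
  assumes k: "k \<in> carrier K" and c: "c \<in> tensor_relations D M K"
  shows "scale k c \<in> tensor_relations D M K"
proof -
  from c consider
    (left) x x' y where "c = frag_of (x \<oplus>\<^bsub>M\<^esub> x', y) - frag_of (x, y) - frag_of (x', y)"
      "x \<in> carrier M" "x' \<in> carrier M" "y \<in> carrier K"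
    | (right) x y y' where "c = frag_of (x, y \<oplus>\<^bsub>K\<^esub> y') - frag_of (x, y) - frag_of (x, y')"
      "x \<in> carrier M" "y \<in> carrier K" "y' \<in> carrier K"
    | (bal) r x y where "c = frag_of (r \<odot>\<^bsub>M\<^esub> x, y) - frag_of (x, r \<odot>\<^bsub>K\<^esub> y)"
      "r \<in> carrier D" "x \<in> carrier M" "y \<in> carrier K"
    unfolding tensor_relations_def by blast
  then show ?thesis
  proof cases
    case left
    have "k \<otimes>\<^bsub>K\<^esub> y \<in> carrier K" using k left by simp
    then show ?thesis using left unfolding left(1) scale_diff scale_of tensor_relations_def by blast
  next
    case right
    have "k \<otimes>\<^bsub>K\<^esub> (y \<oplus>\<^bsub>K\<^esub> y') = k \<otimes>\<^bsub>K\<^esub> y \<oplus>\<^bsub>K\<^esub> k \<otimes>\<^bsub>K\<^esub> y'" "k \<otimes>\<^bsub>K\<^esub> y \<in> carrier K" "k \<otimes>\<^bsub>K\<^esub> y' \<in> carrier K"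
      using k right by (simp_all add: K.r_distr)
    then show ?thesis using right unfolding right(1) scale_diff scale_of tensor_relations_def by auto
  next
    case bal
    have "k \<otimes>\<^bsub>K\<^esub> (r \<odot>\<^bsub>K\<^esub> y) = r \<odot>\<^bsub>K\<^esub> (k \<otimes>\<^bsub>K\<^esub> y)" "k \<otimes>\<^bsub>K\<^esub> y \<in> carrier K"
      using k bal by (simp_all add: K_smult_mult)
    then show ?thesis using bal unfolding bal(1) scale_diff scale_of tensor_relations_def by auto
  qed
qed

lemma scale_N:
  assumes k: "k \<in> carrier K" and "c \<in> N"
  shows "scale k c \<in> N"
  using assms(2) unfolding tensor_kernel_def
proof (induction rule: generate.induct)
  case one
  then show ?case using N_zero by (simp add: tensor_kernel_def)
next
  case (incl c)
  then show ?case using relation_in_N scale_relation[OF k] by (simp add: tensor_kernel_def)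
next
  case (inv c)
  then have "c \<in> carrier G" using tensor_relations_in_G by blast
  then have "scale k (inv\<^bsub>G\<^esub> c) = 0 - scale k c" using scale_diff[of k 0 c] by simp
  moreover have "scale k c \<in> N" using inv relation_in_N scale_relation[OF k] by simp
  ultimately show ?case using N_diff[OF N_zero] unfolding tensor_kernel_def by metis
next
  case (eng c c')
  then show ?case using N_add unfolding tensor_kernel_def by (simp add: scale_add)
qed

abbreviation V where "V \<equiv> base_change D M K"

lemma V_carrier: "carrier V = cls ` carrier G"
  by (simp add: base_change_def tensor_group_def carrier_FactGroup)

lemma V_cls: "c \<in> carrier G \<Longrightarrow> cls c \<in> carrier V"
  unfolding V_carrier by (rule imageI)

lemma V_cases:
  assumes "C \<in> carrier V"
  obtains c where "c \<in> carrier G" "C = cls c"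
  using assms unfolding V_carrier by blast

lemma V_zero: "\<zero>\<^bsub>V\<^esub> = cls 0"
proof -
  have "cls 0 = N" by (rule G.coset_join2[OF _ subgroup_N N_zero]) simp
  then show ?thesis by (simp add: base_change_def tensor_group_def)
qed

lemma V_add:
  assumes "c \<in> carrier G" "c' \<in> carrier G"
  shows "cls c \<oplus>\<^bsub>V\<^esub> cls c' = cls (c + c')"
  using normal.rcos_sum[OF normal_N assms] by (simp add: base_change_def tensor_group_def)

lemma V_smult:
  assumes k: "k \<in> carrier K" and c: "c \<in> carrier G"
  shows "k \<odot>\<^bsub>V\<^esub> cls c = cls (scale k c)"
proof -
  have "k \<odot>\<^bsub>V\<^esub> cls c = (\<Union>c'\<in>cls c. cls (scale k c'))"
    by (simp add: base_change_def scale_def)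
  also have "\<dots> = (\<Union>c'\<in>cls c. cls (scale k c))"
  proof (rule SUP_cong[OF refl])
    fix c' assume c': "c' \<in> cls c"
    have c'G: "c' \<in> carrier G" using G.r_coset_subset_G[OF N_subset c] c' by blast
    have "c' - c \<in> N" using c' by (auto simp: r_coset_def)
    then have "scale k c' - scale k c \<in> N" using scale_N[OF k] by (metis scale_diff)
    then show "cls (scale k c') = cls (scale k c)"
      using cls_eq_iff scale_closed[OF k] c c'G by simp
  qed
  also have "\<dots> = cls (scale k c)" using G.rcos_self[OF c subgroup_N] by auto
  finally show ?thesis .
qed

lemma scale_scalar_add:
  assumes "a \<in> carrier K" "b \<in> carrier K" "c \<in> carrier G"
  shows "scale (a \<oplus>\<^bsub>K\<^esub> b) c - (scale a c + scale b c) \<in> N"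
  using assms(3)
proof (induction rule: G_induct)
  case zero
  then show ?case by (simp add: N_zero)
next
  case (diff c c')
  have "scale (a \<oplus>\<^bsub>K\<^esub> b) (c - c') - (scale a (c - c') + scale b (c - c')) =
    (scale (a \<oplus>\<^bsub>K\<^esub> b) c - (scale a c + scale b c)) -
    (scale (a \<oplus>\<^bsub>K\<^esub> b) c' - (scale a c' + scale b c'))" by (simp add: scale_diff algebra_simps)
  then show ?case using N_diff[OF diff(3,4)] by metis
next
  case (gen x y)
  have "a \<otimes>\<^bsub>K\<^esub> y \<in> carrier K" "b \<otimes>\<^bsub>K\<^esub> y \<in> carrier K" using assms gen by simp_all
  then have "frag_of (x, a \<otimes>\<^bsub>K\<^esub> y \<oplus>\<^bsub>K\<^esub> b \<otimes>\<^bsub>K\<^esub> y) - frag_of (x, a \<otimes>\<^bsub>K\<^esub> y) - frag_of (x, b \<otimes>\<^bsub>K\<^esub> y)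
      \<in> tensor_relations D M K"
    using gen unfolding tensor_relations_def by blast
  then show ?case using relation_in_N assms gen by (simp add: K.l_distr diff_diff_eq)
qed

lemma scale_scale:
  assumes "a \<in> carrier K" "b \<in> carrier K" "c \<in> carrier G"
  shows "scale (a \<otimes>\<^bsub>K\<^esub> b) c = scale a (scale b c)"
  using assms(3) by (induction rule: G_induct) (use assms in \<open>auto simp: scale_diff K.m_assoc\<close>)

lemma scale_one:
  assumes "c \<in> carrier G"
  shows "scale \<one>\<^bsub>K\<^esub> c = c"
  using assms by (induction rule: G_induct) (auto simp: scale_diff)

lemma V_module: "module K V"
proof (rule moduleI)
  show "cring K" by (rule K.is_cring)
  show "abelian_group V"
  proof (rule abelian_groupI)
    show "\<zero>\<^bsub>V\<^esub> \<in> carrier V" unfolding V_zero by (rule V_cls) simp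
  next
    fix X Y assume XY: "X \<in> carrier V" "Y \<in> carrier V"
    obtain c where c: "c \<in> carrier G" "X = cls c" using XY(1) by (rule V_cases)
    obtain d where d: "d \<in> carrier G" "Y = cls d" using XY(2) by (rule V_cases)
    show "X \<oplus>\<^bsub>V\<^esub> Y \<in> carrier V" unfolding c(2) d(2) V_add[OF c(1) d(1)] by (rule V_cls[OF G_add[OF c(1) d(1)]])
    show "X \<oplus>\<^bsub>V\<^esub> Y = Y \<oplus>\<^bsub>V\<^esub> X" unfolding c(2) d(2) V_add[OF c(1) d(1)] V_add[OF d(1) c(1)]
      by (simp add: add.commute)
  next
    fix X Y Z assume XYZ: "X \<in> carrier V" "Y \<in> carrier V" "Z \<in> carrier V"
    obtain c where c: "c \<in> carrier G" "X = cls c" using XYZ(1) by (rule V_cases)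
    obtain d where d: "d \<in> carrier G" "Y = cls d" using XYZ(2) by (rule V_cases)
    obtain e where e: "e \<in> carrier G" "Z = cls e" using XYZ(3) by (rule V_cases)
    show "(X \<oplus>\<^bsub>V\<^esub> Y) \<oplus>\<^bsub>V\<^esub> Z = X \<oplus>\<^bsub>V\<^esub> (Y \<oplus>\<^bsub>V\<^esub> Z)"
      unfolding c(2) d(2) e(2) V_add[OF c(1) d(1)] V_add[OF d(1) e(1)]
        V_add[OF G_add[OF c(1) d(1)] e(1)] V_add[OF c(1) G_add[OF d(1) e(1)]]
      by (simp add: add.assoc)
  next
    fix X assume X: "X \<in> carrier V"
    obtain c where c: "c \<in> carrier G" "X = cls c" using X by (rule V_cases)
    have 0: "0 \<in> carrier G" by simp
    show "\<zero>\<^bsub>V\<^esub> \<oplus>\<^bsub>V\<^esub> X = X" unfolding c(2) V_zero V_add[OF 0 c(1)] by simp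
    have m: "- c \<in> carrier G" using G_diff[OF 0 c(1)] by simp
    have "cls (- c) \<oplus>\<^bsub>V\<^esub> X = \<zero>\<^bsub>V\<^esub>" unfolding c(2) V_zero V_add[OF m c(1)] by simp
    then show "\<exists>Y\<in>carrier V. Y \<oplus>\<^bsub>V\<^esub> X = \<zero>\<^bsub>V\<^esub>" using V_cls[OF m] by blast
  qed
next
  fix a X assume a: "a \<in> carrier K" and X: "X \<in> carrier V"
  obtain c where c: "c \<in> carrier G" "X = cls c" using X by (rule V_cases)
  show "a \<odot>\<^bsub>V\<^esub> X \<in> carrier V" unfolding c(2) V_smult[OF a c(1)] by (rule V_cls[OF scale_closed[OF a c(1)]])
next
  fix a b X assume a: "a \<in> carrier K" and b: "b \<in> carrier K" and X: "X \<in> carrier V"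
  obtain c where c: "c \<in> carrier G" "X = cls c" using X by (rule V_cases)
  note cl = scale_closed[OF a c(1)] scale_closed[OF b c(1)]
  have ab: "a \<oplus>\<^bsub>K\<^esub> b \<in> carrier K" "a \<otimes>\<^bsub>K\<^esub> b \<in> carrier K" using a b by simp_all
  show "(a \<oplus>\<^bsub>K\<^esub> b) \<odot>\<^bsub>V\<^esub> X = a \<odot>\<^bsub>V\<^esub> X \<oplus>\<^bsub>V\<^esub> b \<odot>\<^bsub>V\<^esub> X"
    unfolding c(2) V_smult[OF a c(1)] V_smult[OF b c(1)] V_smult[OF ab(1) c(1)] V_add[OF cl]
    using cls_eq_iff[OF scale_closed[OF ab(1) c(1)] G_add[OF cl]] scale_scalar_add[OF a b c(1)] by simp
  show "(a \<otimes>\<^bsub>K\<^esub> b) \<odot>\<^bsub>V\<^esub> X = a \<odot>\<^bsub>V\<^esub> (b \<odot>\<^bsub>V\<^esub> X)"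
    unfolding c(2) V_smult[OF b c(1)] V_smult[OF ab(2) c(1)] V_smult[OF a cl(2)] scale_scale[OF a b c(1)] ..
next
  fix a X Y assume a: "a \<in> carrier K" and XY: "X \<in> carrier V" "Y \<in> carrier V"
  obtain c where c: "c \<in> carrier G" "X = cls c" using XY(1) by (rule V_cases)
  obtain d where d: "d \<in> carrier G" "Y = cls d" using XY(2) by (rule V_cases)
  show "a \<odot>\<^bsub>V\<^esub> (X \<oplus>\<^bsub>V\<^esub> Y) = a \<odot>\<^bsub>V\<^esub> X \<oplus>\<^bsub>V\<^esub> a \<odot>\<^bsub>V\<^esub> Y"
    unfolding c(2) d(2) V_add[OF c(1) d(1)] V_smult[OF a c(1)] V_smult[OF a d(1)]
      V_smult[OF a G_add[OF c(1) d(1)]] V_add[OF scale_closed[OF a c(1)] scale_closed[OF a d(1)]] scale_add ..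
next
  fix X assume X: "X \<in> carrier V"
  obtain c where c: "c \<in> carrier G" "X = cls c" using X by (rule V_cases)
  show "\<one>\<^bsub>K\<^esub> \<odot>\<^bsub>V\<^esub> X = X" unfolding c(2) V_smult[OF K.one_closed c(1)] scale_one[OF c(1)] ..
qed

lemma V_trivial_iff:
  "carrier V = {\<zero>\<^bsub>V\<^esub>} \<longleftrightarrow> (\<forall>x\<in>carrier M. \<forall>y\<in>carrier K. frag_of (x, y) \<in> N)"
proof
  assume triv: "carrier V = {\<zero>\<^bsub>V\<^esub>}"
  show "\<forall>x\<in>carrier M. \<forall>y\<in>carrier K. frag_of (x, y) \<in> N"
  proof (intro ballI)
    fix x y assume "x \<in> carrier M" "y \<in> carrier K"
    then have g: "frag_of (x, y) \<in> carrier G" by (rule gen_in_G)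
    have "cls (frag_of (x, y)) = cls 0"
      using V_cls[OF g] unfolding triv V_zero by (rule singletonD)
    then show "frag_of (x, y) \<in> N" using cls_eq_iff[OF g, of 0] by simp
  qed
next
  assume gens: "\<forall>x\<in>carrier M. \<forall>y\<in>carrier K. frag_of (x, y) \<in> N"
  have "c \<in> N" if "c \<in> carrier G" for c
    using that by (induction rule: G_induct) (use gens N_zero N_diff in auto)
  then have "cls c = cls 0" if "c \<in> carrier G" for c
    using cls_eq_iff[OF that, of 0] that by simp
  moreover have "0 \<in> carrier G" by simp
  ultimately show "carrier V = {\<zero>\<^bsub>V\<^esub>}"
    unfolding V_zero V_carrier by blast
qed

text \<open>If \<open>r x = 0\<close> and \<open>y = r y'\<close>, then \<open>x \<otimes> y = r x \<otimes> y' = 0\<close>. The zero element of \<open>M\<close> enters as a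
  solution \<open>z\<close> of \<open>z + z = z\<close>, which already forces \<open>z \<otimes> y' = 0\<close>.\<close>
lemma torsion_trivial:
  assumes z: "z \<in> carrier M" "z \<oplus>\<^bsub>M\<^esub> z = z"
    and tors: "\<And>x. x \<in> carrier M \<Longrightarrow> \<exists>r\<in>carrier D. r \<odot>\<^bsub>M\<^esub> x = z \<and>
      (\<forall>y\<in>carrier K. \<exists>y'\<in>carrier K. y = r \<odot>\<^bsub>K\<^esub> y')"
  shows "carrier V = {\<zero>\<^bsub>V\<^esub>}"
  unfolding V_trivial_iff
proof (intro ballI)
  fix x y assume x: "x \<in> carrier M" and y: "y \<in> carrier K"
  obtain r where r: "r \<in> carrier D" "r \<odot>\<^bsub>M\<^esub> x = z" "\<forall>y\<in>carrier K. \<exists>y'\<in>carrier K. y = r \<odot>\<^bsub>K\<^esub> y'"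
    using tors[OF x] by blast
  obtain y' where y': "y' \<in> carrier K" "y = r \<odot>\<^bsub>K\<^esub> y'" using r(3) y by blast
  have "frag_of (z \<oplus>\<^bsub>M\<^esub> z, y') - frag_of (z, y') - frag_of (z, y') \<in> tensor_relations D M K"
    unfolding tensor_relations_def using z(1) y'(1) by blast
  then have "- frag_of (z, y') \<in> N" using relation_in_N z(2) by simp
  then have zN: "frag_of (z, y') \<in> N" using N_uminus by fastforce
  have "frag_of (r \<odot>\<^bsub>M\<^esub> x, y') - frag_of (x, r \<odot>\<^bsub>K\<^esub> y') \<in> tensor_relations D M K"
    unfolding tensor_relations_def using r(1) x y'(1) by blast
  then have "frag_of (z, y') - frag_of (x, y) \<in> N" using relation_in_N r(2) y'(2) by simp
  from N_diff[OF zN this] show "frag_of (x, y) \<in> N" by simp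
qed

text \<open>The universal property: a balanced biadditive map factors through the tensor product. If it has a
  nonzero value, then the tensor product is nonzero.\<close>
lemma bilinear_nontrivial:
  assumes A: "comm_group A"
    and \<beta>: "\<And>x y. \<lbrakk>x \<in> carrier M; y \<in> carrier K\<rbrakk> \<Longrightarrow> \<beta> x y \<in> carrier A"
    and l: "\<And>x x' y. \<lbrakk>x \<in> carrier M; x' \<in> carrier M; y \<in> carrier K\<rbrakk>
      \<Longrightarrow> \<beta> (x \<oplus>\<^bsub>M\<^esub> x') y = \<beta> x y \<otimes>\<^bsub>A\<^esub> \<beta> x' y"
    and r: "\<And>x y y'. \<lbrakk>x \<in> carrier M; y \<in> carrier K; y' \<in> carrier K\<rbrakk>
      \<Longrightarrow> \<beta> x (y \<oplus>\<^bsub>K\<^esub> y') = \<beta> x y \<otimes>\<^bsub>A\<^esub> \<beta> x y'"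
    and bal: "\<And>d x y. \<lbrakk>d \<in> carrier D; x \<in> carrier M; y \<in> carrier K\<rbrakk>
      \<Longrightarrow> \<beta> (d \<odot>\<^bsub>M\<^esub> x) y = \<beta> x (d \<odot>\<^bsub>K\<^esub> y)"
    and ne: "x0 \<in> carrier M" "y0 \<in> carrier K" "\<beta> x0 y0 \<noteq> \<one>\<^bsub>A\<^esub>"
  shows "carrier V \<noteq> {\<zero>\<^bsub>V\<^esub>}"
proof -
  interpret A: comm_group A by (rule A)
  obtain h where h: "h \<in> hom G A" "\<And>z. z \<in> carrier M \<times> carrier K \<Longrightarrow> h (frag_of z) = (\<lambda>(x, y). \<beta> x y) z"
    by (rule A.free_Abelian_group_universal[of "\<lambda>(x, y). \<beta> x y" "carrier M \<times> carrier K"])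
      (use \<beta> in auto)
  interpret h: group_hom G A h by (unfold_locales) (rule h(1))
  have hof: "h (frag_of (x, y)) = \<beta> x y" if "x \<in> carrier M" "y \<in> carrier K" for x y
    using h(2)[of "(x, y)"] that by simp
  have hdiff: "h (c - c') = h c \<otimes>\<^bsub>A\<^esub> inv\<^bsub>A\<^esub> (h c')" if "c \<in> carrier G" "c' \<in> carrier G" for c c'
  proof -
    have "c - c' = c \<otimes>\<^bsub>G\<^esub> inv\<^bsub>G\<^esub> c'" using that by simp
    then show ?thesis using that h.hom_mult h.hom_inv by (metis G.inv_closed)
  qed
  have "tensor_relations D M K \<subseteq> kernel G A h"
  proof
    fix c assume c: "c \<in> tensor_relations D M K"
    from c consider
      (left) x x' y where "c = frag_of (x \<oplus>\<^bsub>M\<^esub> x', y) - frag_of (x, y) - frag_of (x', y)"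
        "x \<in> carrier M" "x' \<in> carrier M" "y \<in> carrier K"
      | (right) x y y' where "c = frag_of (x, y \<oplus>\<^bsub>K\<^esub> y') - frag_of (x, y) - frag_of (x, y')"
        "x \<in> carrier M" "y \<in> carrier K" "y' \<in> carrier K"
      | (bal) r x y where "c = frag_of (r \<odot>\<^bsub>M\<^esub> x, y) - frag_of (x, r \<odot>\<^bsub>K\<^esub> y)"
        "r \<in> carrier D" "x \<in> carrier M" "y \<in> carrier K"
      unfolding tensor_relations_def by blast
    then have "h c = \<one>\<^bsub>A\<^esub>"
    proof cases
      case left
      note g = gen_in_G[OF M_add_closed[OF left(2,3)] left(4)] gen_in_G[OF left(2,4)] gen_in_G[OF left(3,4)]
      have "h c = \<beta> (x \<oplus>\<^bsub>M\<^esub> x') y \<otimes>\<^bsub>A\<^esub> inv\<^bsub>A\<^esub> \<beta> x y \<otimes>\<^bsub>A\<^esub> inv\<^bsub>A\<^esub> \<beta> x' y"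
        unfolding left(1) hdiff[OF G_diff[OF g(1,2)] g(3)] hdiff[OF g(1,2)]
        using left M_add_closed by (simp add: hof)
      also have "\<dots> = \<one>\<^bsub>A\<^esub>" unfolding l[OF left(2-4)] using \<beta> left
        by (simp add: A.m_assoc A.m_comm[of "\<beta> x y"] A.inv_solve_right)
      finally show ?thesis .
    next
      case right
      note g = gen_in_G[OF right(2) K.a_closed[OF right(3,4)]] gen_in_G[OF right(2,3)] gen_in_G[OF right(2,4)]
      have "h c = \<beta> x (y \<oplus>\<^bsub>K\<^esub> y') \<otimes>\<^bsub>A\<^esub> inv\<^bsub>A\<^esub> \<beta> x y \<otimes>\<^bsub>A\<^esub> inv\<^bsub>A\<^esub> \<beta> x y'"
        unfolding right(1) hdiff[OF G_diff[OF g(1,2)] g(3)] hdiff[OF g(1,2)]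
        using right by (simp add: hof)
      also have "\<dots> = \<one>\<^bsub>A\<^esub>" unfolding r[OF right(2-4)] using \<beta> right
        by (simp add: A.m_assoc A.m_comm[of "\<beta> x y"] A.inv_solve_right)
      finally show ?thesis .
    next
      case bal
      note g = gen_in_G[OF M_smult_closed[OF bal(2,3)] bal(4)] gen_in_G[OF bal(3) K_smult_closed[OF bal(2,4)]]
      show ?thesis unfolding bal(1) hdiff[OF g]
        using bal \<beta> M_smult_closed K_smult_closed assms(5)[OF bal(2-4)] by (simp add: hof)
    qed
    then show "c \<in> kernel G A h" using c tensor_relations_in_G unfolding kernel_def by blast
  qed
  then have "N \<subseteq> kernel G A h"
    unfolding tensor_kernel_def by (rule G.generate_subgroup_incl[OF _ h.subgroup_kernel])
  moreover have "frag_of (x0, y0) \<notin> kernel G A h" using hof[OF ne(1,2)] ne(3) unfolding kernel_def by simp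
  ultimately show ?thesis unfolding V_trivial_iff using ne(1,2) by blast
qed

end

text \<open>A basis with no elements spans the zero space.\<close>
lemma vs_dim_zero_iff:
  assumes "vectorspace K V"
  shows "vs_dim K V = 0 \<longleftrightarrow> carrier V = {\<zero>\<^bsub>V\<^esub>}"
proof -
  interpret V: vectorspace K V by (rule assms)
  have span: "V.module.span {} = {\<zero>\<^bsub>V\<^esub>}" by (rule V.span_empty)
  show ?thesis
  proof
    assume "carrier V = {\<zero>\<^bsub>V\<^esub>}"
    then have gen: "V.gen_set {}" using span by simp
    then have "V.fin_dim" unfolding V.fin_dim_def by (intro exI[of _ "{}"]) simp
    moreover have "V.dim \<le> card ({} :: 'c set)" by (rule V.gen_ge_dim) (use gen in auto)
    ultimately show "vs_dim K V = 0" unfolding vs_dim_def by (simp add: zero_enat_def)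
  next
    assume 0: "vs_dim K V = 0"
    then have fin: "V.fin_dim" and dim: "V.dim = 0"
      unfolding vs_dim_def by (auto simp: zero_enat_def split: if_splits)
    obtain B where "finite B" "V.basis B" using V.finite_basis_exists[OF fin] by blast
    then have "V.dim = card B" by (rule V.dim_basis)
    then have "B = {}" using dim \<open>finite B\<close> by simp
    then show "carrier V = {\<zero>\<^bsub>V\<^esub>}" using \<open>V.basis B\<close> span unfolding V.basis_def by simp
  qed
qed

section \<open>The rank of the conormal module\<close>

context one_dim_pid
begin

abbreviation D where "D \<equiv> R Quot p"
abbreviation p2 where "p2 \<equiv> p \<cdot> p"
abbreviation M where "M \<equiv> conormal_module R p"
abbreviation K where "K \<equiv> frac_field D"

lemma p2_ideal: "ideal p2 R"
  by (rule ideal_prod_is_ideal[OF p_ideal p_ideal])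

lemma p2_subset: "p2 \<subseteq> p"
  using ideal_prod_inter[OF p_ideal p_ideal] by simp

sublocale D: "domain" D
  by (rule quotient_is_domain)

lemma D_carrier: "carrier D = (\<lambda>a. p +> a) ` carrier R"
  by (auto simp: FactRing_def A_RCOSETS_defs a_r_coset_def r_coset_def)

lemma D_zero: "\<zero>\<^bsub>D\<^esub> = p"
  by (simp add: FactRing_def)

lemma D_one: "\<one>\<^bsub>D\<^esub> = p +> \<one>"
  by (simp add: FactRing_def)

lemma D_add: "\<lbrakk>a \<in> carrier R; b \<in> carrier R\<rbrakk> \<Longrightarrow> (p +> a) \<oplus>\<^bsub>D\<^esub> (p +> b) = p +> (a \<oplus> b)"
  by (simp add: FactRing_def ideal.a_rcos_sum[OF p_ideal])

lemma D_mult: "\<lbrakk>a \<in> carrier R; b \<in> carrier R\<rbrakk> \<Longrightarrow> (p +> a) \<otimes>\<^bsub>D\<^esub> (p +> b) = p +> (a \<otimes> b)"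
  by (simp add: FactRing_def rcoset_mult_add)

lemma coset_in_D: "a \<in> carrier R \<Longrightarrow> p +> a \<in> carrier D"
  unfolding D_carrier by (rule imageI)

lemma coset_eq_iff:
  "\<lbrakk>ideal I R; a \<in> carrier R; b \<in> carrier R\<rbrakk> \<Longrightarrow> I +> a = I +> b \<longleftrightarrow> a \<ominus> b \<in> I"
  by (simp add: quotient_eq_iff_same_a_r_cos)

lemma coset_zero_iff:
  assumes I: "ideal I R" and a: "a \<in> carrier R"
  shows "I +> a = I \<longleftrightarrow> a \<in> I"
proof -
  have "I +> \<zero> = I" using a_rcos_zero[OF I ideal_zero_mem[OF I]] .
  moreover have "\<zero> \<in> carrier R" by simp
  moreover have "a \<ominus> \<zero> = a" using a by (simp add: a_minus_def)
  ultimately show ?thesis using coset_eq_iff[OF I a, of \<zero>] by simp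
qed

lemma coset_nonzero: "a \<in> carrier R - p \<Longrightarrow> p +> a \<in> carrier D - {\<zero>\<^bsub>D\<^esub>}"
  unfolding D_zero using coset_in_D coset_zero_iff[OF p_ideal] by auto

lemma M_carrier: "carrier M = (\<lambda>x. p2 +> x) ` p"
  by (simp add: conormal_module_def)

lemma M_cases:
  assumes "X \<in> carrier M"
  obtains x where "x \<in> p" "X = p2 +> x"
  using assms unfolding M_carrier by blast

lemma M_add: "\<lbrakk>x \<in> p; y \<in> p\<rbrakk> \<Longrightarrow> (p2 +> x) \<oplus>\<^bsub>M\<^esub> (p2 +> y) = p2 +> (x \<oplus> y)"
  by (simp add: conormal_module_def ideal.a_rcos_sum[OF p2_ideal] p_carrier)

lemma mem_coset:
  assumes "z \<in> I +> x" "ideal I R" "x \<in> carrier R"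
  shows "z \<in> carrier R" "z \<ominus> x \<in> I"
proof -
  obtain i where i: "i \<in> I" "z = i \<oplus> x" using assms(1) by (auto simp: a_r_coset_def')
  have iC: "i \<in> carrier R" using i ideal_subset_carrier[OF assms(2)] by blast
  show "z \<in> carrier R" using i iC assms(3) by simp
  have "z \<ominus> x = i" unfolding i(2) using iC assms(3) by algebra
  then show "z \<ominus> x \<in> I" using i by simp
qed

text \<open>The union in the definition of the scalar multiplication is over representatives; they all give
  the same coset because \<open>p\<close> times \<open>x\<close> lies in \<open>p\<^sup>2\<close>.\<close>
lemma M_smult:
  assumes a: "a \<in> carrier R" and x: "x \<in> p"
  shows "(p +> a) \<odot>\<^bsub>M\<^esub> (p2 +> x) = p2 +> (a \<otimes> x)"
proof -
  have xC: "x \<in> carrier R" using x p_carrier by simp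
  have "p2 +> (a' \<otimes> x') = p2 +> (a \<otimes> x)" if a': "a' \<in> p +> a" and x': "x' \<in> p2 +> x" for a' x'
  proof -
    note 1 = mem_coset[OF a' p_ideal a] and 2 = mem_coset[OF x' p2_ideal xC]
    have "a' \<otimes> x' \<ominus> a \<otimes> x = a' \<otimes> (x' \<ominus> x) \<oplus> (a' \<ominus> a) \<otimes> x" using 1(1) 2(1) a xC by algebra
    also have "\<dots> \<in> p2"
      by (rule ideal_add_mem[OF p2_ideal ideal_mult_mem[OF p2_ideal 1(1) 2(2)] ideal_prod.prod[OF 1(2) x]])
    finally show ?thesis using coset_eq_iff[OF p2_ideal] 1(1) 2(1) a xC by simp
  qed
  moreover have "a \<in> p +> a" using a_rcos_self[OF a] .
  moreover have "x \<in> p2 +> x"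
    using abelian_subgroup.a_rcos_self[OF _ xC, of p2] p2_ideal
    by (simp add: ideal.axioms abelian_subgroupI3 is_abelian_group)
  ultimately have "(\<Union>a'\<in>p +> a. \<Union>x'\<in>p2 +> x. p2 +> (a' \<otimes> x')) = p2 +> (a \<otimes> x)"
    by blast
  then show ?thesis by (simp add: conormal_module_def)
qed

sublocale conormal: scalar_extension D M K
proof (rule scalar_extension.intro)
  show "cring K" by (rule D.frac_field_cring)
  show "scalar_extension_axioms D M K"
  proof
    fix X Y assume XY: "X \<in> carrier M" "Y \<in> carrier M"
    obtain x where x: "x \<in> p" "X = p2 +> x" using XY(1) by (rule M_cases)
    obtain y where y: "y \<in> p" "Y = p2 +> y" using XY(2) by (rule M_cases)
    show "X \<oplus>\<^bsub>M\<^esub> Y \<in> carrier M"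
      unfolding x(2) y(2) M_add[OF x(1) y(1)] M_carrier using ideal_add_mem[OF p_ideal x(1) y(1)] by (rule imageI)
  next
    fix A X assume A: "A \<in> carrier D" and X: "X \<in> carrier M"
    obtain x where x: "x \<in> p" "X = p2 +> x" using X by (rule M_cases)
    obtain a where a: "a \<in> carrier R" "A = p +> a" using A unfolding D_carrier by blast
    show "A \<odot>\<^bsub>M\<^esub> X \<in> carrier M"
      unfolding x(2) a(2) M_smult[OF a(1) x(1)] M_carrier using ideal_mult_mem[OF p_ideal a(1) x(1)] by (rule imageI)
  qed (simp_all only: D.frac_smult_closed D.frac_smult_mult)
qed

lemma module_rank_zero_iff_trivial:
  "module_rank D M = 0 \<longleftrightarrow> carrier (base_change D M K) = {\<zero>\<^bsub>base_change D M K\<^esub>}"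
  unfolding module_rank_def
  by (rule vs_dim_zero_iff) (simp add: vectorspace_def conormal.V_module D.frac_field_field)

text \<open>All of \<open>p/p\<^sup>2\<close> is killed by \<open>s\<close>, and \<open>s\<close> is invertible in the field of fractions.\<close>
lemma module_rank_zero_if_torsion:
  assumes s: "s \<in> carrier R - p" "\<And>x. x \<in> p \<Longrightarrow> s \<otimes> x \<in> p2"
  shows "module_rank D M = 0"
  unfolding module_rank_zero_iff_trivial
proof (rule conormal.torsion_trivial)
  have 0: "p2 +> \<zero> = p2" using a_rcos_zero[OF p2_ideal ideal_zero_mem[OF p2_ideal]] .
  have z: "\<zero> \<in> p" by (rule ideal_zero_mem[OF p_ideal])
  show "p2 \<in> carrier M" unfolding M_carrier using z 0 by force
  show "p2 \<oplus>\<^bsub>M\<^esub> p2 = p2" using M_add[OF z z] unfolding 0 by (simp add: 0)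
  fix X assume "X \<in> carrier M"
  then obtain x where x: "x \<in> p" "X = p2 +> x" by (rule M_cases)
  have sC: "s \<in> carrier R" using s by simp
  have sx: "s \<otimes> x \<in> carrier R" using sC x p_carrier by simp
  have "(p +> s) \<odot>\<^bsub>M\<^esub> X = p2"
    unfolding x(2) M_smult[OF sC x(1)] coset_zero_iff[OF p2_ideal sx] by (rule s(2)[OF x(1)])
  moreover have "\<forall>y\<in>carrier K. \<exists>y'\<in>carrier K. y = (p +> s) \<odot>\<^bsub>K\<^esub> y'"
    using D.frac_divisible[OF coset_nonzero[OF s(1)]] by blast
  ultimately show "\<exists>r\<in>carrier D. r \<odot>\<^bsub>M\<^esub> X = p2 \<and> (\<forall>y\<in>carrier K. \<exists>y'\<in>carrier K. y = r \<odot>\<^bsub>K\<^esub> y')"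
    using coset_in_D[OF sC] by blast
qed

text \<open>Otherwise some \<open>x\<^sub>0 \<in> p\<close> is not torsion modulo \<open>p\<^sup>2\<close>. Let \<open>L\<close> be maximal among the ideals between
  \<open>p\<^sup>2\<close> and \<open>p\<close> modulo which \<open>x\<^sub>0\<close> is not torsion. By maximality, every \<open>y \<in> p\<close> satisfies a relation
  \<open>r y \<equiv> s x\<^sub>0\<close> modulo \<open>L\<close> with \<open>r \<notin> p\<close>, and \<open>y \<mapsto> s/r\<close> is a well-defined linear map from
  \<open>p/p\<^sup>2\<close> to the field of fractions that maps \<open>x\<^sub>0\<close> to \<open>1\<close>. Hence \<open>x\<^sub>0 \<otimes> 1\<close> is not zero.\<close>
lemma torsion_if_module_rank_zero:
  assumes rank: "module_rank D M = 0"
  shows "\<exists>s\<in>carrier R - p. \<forall>x\<in>p. s \<otimes> x \<in> p2"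
proof (rule ccontr)
  assume "\<not> ?thesis"
  then obtain x0 where x0: "x0 \<in> p" "\<And>s. s \<in> carrier R - p \<Longrightarrow> s \<otimes> x0 \<notin> p2"
    using common_multiplier[OF p_ideal p2_ideal] by blast
  have x0C: "x0 \<in> carrier R" using x0 p_carrier by simp
  let ?S = "{L. ideal L R \<and> p2 \<subseteq> L \<and> L \<subseteq> p \<and> (\<forall>s\<in>carrier R - p. s \<otimes> x0 \<notin> L)}"
  have p2S: "p2 \<in> ?S" using p2_ideal p2_subset x0(2) by blast
  obtain L where L: "L \<in> ?S" and max: "\<And>I. \<lbrakk>I \<in> ?S; L \<subseteq> I\<rbrakk> \<Longrightarrow> I = L"
  proof (rule maximal_ideal_in[of ?S])
    show "ideal I R" if "I \<in> ?S" for I using that by simp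
    show "?S \<noteq> {}" using p2S by blast
  qed blast
  have LI: "ideal L R" and p2L: "p2 \<subseteq> L" and Lp: "L \<subseteq> p"
    and x0L: "\<And>s. s \<in> carrier R - p \<Longrightarrow> s \<otimes> x0 \<notin> L" using L by auto
  note LC = subsetD[OF ideal_subset_carrier[OF LI]]
  define Q where "Q y s r \<longleftrightarrow> s \<in> carrier R \<and> r \<in> carrier R - p \<and> r \<otimes> y \<ominus> s \<otimes> x0 \<in> L" for y s r
  define fr where "fr s r = fraction D (p +> s) (p +> r)" for s r
  have ex: "\<exists>s r. Q y s r" if y: "y \<in> p" for y
  proof (cases "y \<in> L")
    case True
    have "\<one> \<otimes> y \<ominus> \<zero> \<otimes> x0 = y" using p_carrier[OF y] x0C by algebra
    then have "Q y \<zero> \<one>" using True one_notin unfolding Q_def by simp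
    then show ?thesis by blast
  next
    case False
    have yC: "y \<in> carrier R" using y p_carrier by simp
    have "adjoin L y \<notin> ?S" using max[of "adjoin L y"] adjoin_upper[OF LI yC] False by auto
    moreover have "ideal (adjoin L y) R" "p2 \<subseteq> adjoin L y" "adjoin L y \<subseteq> p"
      using adjoin_ideal[OF LI yC] adjoin_upper[OF LI yC] adjoin_subset[OF p_ideal Lp y] p2L by auto
    ultimately obtain s where s: "s \<in> carrier R - p" "s \<otimes> x0 \<in> adjoin L y" by blast
    then obtain l r where lr: "s \<otimes> x0 = l \<oplus> r \<otimes> y" "l \<in> L" "r \<in> carrier R" unfolding adjoin_def by blast
    have "r \<notin> p"
    proof
      assume "r \<in> p"
      then have "r \<otimes> y \<in> L" using ideal_prod.prod[OF _ y] p2L by blast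
      then have "s \<otimes> x0 \<in> L" unfolding lr(1) using lr(2) ideal_add_mem[OF LI] by blast
      then show False using x0L s by blast
    qed
    moreover have "r \<otimes> y \<ominus> s \<otimes> x0 = \<ominus> l" unfolding lr(1) using lr(3) LC[OF lr(2)] yC by algebra
    ultimately have "Q y s r" using s lr ideal_neg_mem[OF LI lr(2)] unfolding Q_def by simp
    then show ?thesis by blast
  qed
  have unique: "fr s r = fr s' r'" if q: "Q y s r" "Q y s' r'" and y: "y \<in> p" for y s r s' r'
  proof -
    have yC: "y \<in> carrier R" using y p_carrier by simp
    have c: "s \<in> carrier R" "r \<in> carrier R - p" "s' \<in> carrier R" "r' \<in> carrier R - p"
      and qL: "r \<otimes> y \<ominus> s \<otimes> x0 \<in> L" "r' \<otimes> y \<ominus> s' \<otimes> x0 \<in> L"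
      using q unfolding Q_def by blast+
    then have c': "r \<in> carrier R" "r' \<in> carrier R" by auto
    have "(s \<otimes> r' \<ominus> s' \<otimes> r) \<otimes> x0 = r \<otimes> (r' \<otimes> y \<ominus> s' \<otimes> x0) \<ominus> r' \<otimes> (r \<otimes> y \<ominus> s \<otimes> x0)"
      using c(1,3) c' yC x0C by algebra
    also have "\<dots> \<in> L"
      by (rule ideal_diff_mem[OF LI ideal_mult_mem[OF LI c'(1) qL(2)] ideal_mult_mem[OF LI c'(2) qL(1)]])
    finally have "s \<otimes> r' \<ominus> s' \<otimes> r \<in> p" using x0L[of "s \<otimes> r' \<ominus> s' \<otimes> r"] c(1,3) c' by auto
    then have "p +> (s \<otimes> r') = p +> (s' \<otimes> r)" using coset_eq_iff[OF p_ideal] c(1,3) c' by simp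
    then show ?thesis
      unfolding fr_def using c(1,3) c'
      by (intro D.fraction_eqI coset_nonzero[OF c(2)] coset_nonzero[OF c(4)] coset_in_D) (simp_all add: D_mult)
  qed
  define val where "val y = (SOME k. \<exists>s r. Q y s r \<and> k = fr s r)" for y
  have val: "val y = fr s r" if q: "Q y s r" and y: "y \<in> p" for y s r
  proof -
    have "\<exists>s r. Q y s r \<and> val y = fr s r"
      unfolding val_def by (rule someI_ex) (use q in blast)
    then show ?thesis using unique[OF _ q y] by auto
  qed
  have frK: "fr s r \<in> carrier K" if "Q y s r" for y s r
    unfolding fr_def using that unfolding Q_def
    by (intro D.fraction_in_frac_field coset_nonzero coset_in_D) auto
  have valK: "val y \<in> carrier K" if "y \<in> p" for y
    using ex[OF that] val[OF _ that] frK by metis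
  have val_add: "val (y \<oplus> z) = val y \<oplus>\<^bsub>K\<^esub> val z" if yz: "y \<in> p" "z \<in> p" for y z
  proof -
    obtain s r where q: "Q y s r" using ex[OF yz(1)] by blast
    obtain s' r' where q': "Q z s' r'" using ex[OF yz(2)] by blast
    have c: "s \<in> carrier R" "r \<in> carrier R - p" "s' \<in> carrier R" "r' \<in> carrier R - p"
      and qL: "r \<otimes> y \<ominus> s \<otimes> x0 \<in> L" "r' \<otimes> z \<ominus> s' \<otimes> x0 \<in> L"
      using q q' unfolding Q_def by blast+
    then have c': "r \<in> carrier R" "r' \<in> carrier R" "y \<in> carrier R" "z \<in> carrier R" using yz p_carrier by auto
    have "(r \<otimes> r') \<otimes> (y \<oplus> z) \<ominus> (s \<otimes> r' \<oplus> s' \<otimes> r) \<otimes> x0 =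
        r' \<otimes> (r \<otimes> y \<ominus> s \<otimes> x0) \<oplus> r \<otimes> (r' \<otimes> z \<ominus> s' \<otimes> x0)"
      using c(1,3) c' x0C by algebra
    also have "\<dots> \<in> L"
      by (rule ideal_add_mem[OF LI ideal_mult_mem[OF LI c'(2) qL(1)] ideal_mult_mem[OF LI c'(1) qL(2)]])
    finally have "Q (y \<oplus> z) (s \<otimes> r' \<oplus> s' \<otimes> r) (r \<otimes> r')"
      using c(1,3) c' mult_notin[OF c(2,4)] unfolding Q_def by simp
    then have "val (y \<oplus> z) = fr (s \<otimes> r' \<oplus> s' \<otimes> r) (r \<otimes> r')"
      by (rule val) (rule ideal_add_mem[OF p_ideal yz])
    also have "\<dots> = fr s r \<oplus>\<^bsub>K\<^esub> fr s' r'"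
      unfolding fr_def
      using D.frac_add[OF coset_in_D[OF c(1)] coset_nonzero[OF c(2)] coset_in_D[OF c(3)] coset_nonzero[OF c(4)]]
        c(1,3) c' by (simp add: D_mult D_add)
    finally show ?thesis using val[OF q yz(1)] val[OF q' yz(2)] by simp
  qed
  have val_smult: "val (a \<otimes> y) = (p +> a) \<odot>\<^bsub>K\<^esub> val y" if a: "a \<in> carrier R" and y: "y \<in> p" for a y
  proof -
    obtain s r where q: "Q y s r" using ex[OF y] by blast
    have c: "s \<in> carrier R" "r \<in> carrier R - p" using q unfolding Q_def by auto
    then have c': "r \<in> carrier R" "y \<in> carrier R" using y p_carrier by auto
    have "r \<otimes> (a \<otimes> y) \<ominus> (a \<otimes> s) \<otimes> x0 = a \<otimes> (r \<otimes> y \<ominus> s \<otimes> x0)"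
      using c(1) c' a x0C by algebra
    also have "\<dots> \<in> L" using q unfolding Q_def by (intro ideal_mult_mem[OF LI a]) blast
    finally have "Q (a \<otimes> y) (a \<otimes> s) r" using c a unfolding Q_def by simp
    then have "val (a \<otimes> y) = fr (a \<otimes> s) r" by (rule val) (rule ideal_mult_mem[OF p_ideal a y])
    also have "\<dots> = (p +> a) \<odot>\<^bsub>K\<^esub> fr s r"
      unfolding fr_def using D.frac_smult[OF coset_in_D[OF a] coset_in_D[OF c(1)] coset_nonzero[OF c(2)]]
        a c(1) by (simp add: D_mult)
    finally show ?thesis using val[OF q y] by simp
  qed
  have val_L: "val l = \<zero>\<^bsub>K\<^esub>" if l: "l \<in> L" for l
  proof -
    have "\<one> \<otimes> l \<ominus> \<zero> \<otimes> x0 = l" using LC[OF l] x0C by algebra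
    then have "Q l \<zero> \<one>" using l one_notin unfolding Q_def by simp
    then have "val l = fr \<zero> \<one>" by (rule val) (use l Lp in blast)
    moreover have "p +> \<zero> = p" using a_rcos_zero[OF p_ideal ideal_zero_mem[OF p_ideal]] .
    ultimately show ?thesis unfolding fr_def D.frac_zero D_zero D_one by simp
  qed
  have val_x0: "val x0 = \<one>\<^bsub>K\<^esub>"
  proof -
    have "\<one> \<otimes> x0 \<ominus> \<one> \<otimes> x0 = \<zero>" using x0C by algebra
    then have "Q x0 \<one> \<one>" using one_notin ideal_zero_mem[OF LI] unfolding Q_def by simp
    then have "val x0 = fr \<one> \<one>" by (rule val) (rule x0(1))
    then show ?thesis unfolding fr_def D.frac_one D_one by simp
  qed
  \<comment> \<open>As \<open>val\<close> vanishes on \<open>L\<close> and hence on \<open>p\<^sup>2\<close>, it is defined on the conormal module.\<close>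
  define \<phi> where "\<phi> X = val (SOME x. x \<in> p \<and> X = p2 +> x)" for X
  have \<phi>: "\<phi> (p2 +> x) = val x" if x: "x \<in> p" for x
  proof -
    define x' where "x' = (SOME x'. x' \<in> p \<and> p2 +> x = p2 +> x')"
    have x': "x' \<in> p" "p2 +> x = p2 +> x'"
      using someI[of "\<lambda>x'. x' \<in> p \<and> p2 +> x = p2 +> x'" x] x unfolding x'_def by auto
    have "x' \<ominus> x \<in> p2" using coset_eq_iff[OF p2_ideal, of x' x] x' x p_carrier by simp
    then have d: "x' \<ominus> x \<in> L" "x' \<ominus> x \<in> p" using p2L p2_subset by auto
    have "val x' = val ((x' \<ominus> x) \<oplus> x)" using x x'(1) p_carrier by (simp add: minus_add_cancel)
    also have "\<dots> = val x" unfolding val_add[OF d(2) x] val_L[OF d(1)] using valK[OF x]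
      by (rule conormal.K.l_zero)
    finally show ?thesis unfolding \<phi>_def x'_def .
  qed
  have "carrier (base_change D M K) \<noteq> {\<zero>\<^bsub>base_change D M K\<^esub>}"
  proof (rule conormal.bilinear_nontrivial[of "add_monoid K" "\<lambda>X k. \<phi> X \<otimes>\<^bsub>K\<^esub> k" "p2 +> x0" "\<one>\<^bsub>K\<^esub>"])
    show "comm_group (add_monoid K)" by (rule conormal.K.a_comm_group)
    have \<phi>K: "\<phi> X \<in> carrier K" if "X \<in> carrier M" for X
      using that \<phi> valK by (auto elim!: M_cases)
    show "\<phi> X \<otimes>\<^bsub>K\<^esub> k \<in> carrier (add_monoid K)" if "X \<in> carrier M" "k \<in> carrier K" for X k
      using \<phi>K[OF that(1)] that(2) by simp
    show "\<phi> (X \<oplus>\<^bsub>M\<^esub> Y) \<otimes>\<^bsub>K\<^esub> k = \<phi> X \<otimes>\<^bsub>K\<^esub> k \<otimes>\<^bsub>add_monoid K\<^esub> (\<phi> Y \<otimes>\<^bsub>K\<^esub> k)"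
      if XY: "X \<in> carrier M" "Y \<in> carrier M" and k: "k \<in> carrier K" for X Y k
    proof -
      obtain x where x: "x \<in> p" "X = p2 +> x" using XY(1) by (rule M_cases)
      obtain y where y: "y \<in> p" "Y = p2 +> y" using XY(2) by (rule M_cases)
      show ?thesis
        unfolding x(2) y(2) M_add[OF x(1) y(1)] \<phi>[OF x(1)] \<phi>[OF y(1)]
          \<phi>[OF ideal_add_mem[OF p_ideal x(1) y(1)]] val_add[OF x(1) y(1)]
        using conormal.K.l_distr[OF valK[OF x(1)] valK[OF y(1)] k] by simp
    qed
    show "\<phi> X \<otimes>\<^bsub>K\<^esub> (k \<oplus>\<^bsub>K\<^esub> k') = \<phi> X \<otimes>\<^bsub>K\<^esub> k \<otimes>\<^bsub>add_monoid K\<^esub> (\<phi> X \<otimes>\<^bsub>K\<^esub> k')"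
      if "X \<in> carrier M" "k \<in> carrier K" "k' \<in> carrier K" for X k k'
      using conormal.K.r_distr[OF that(2,3) \<phi>K[OF that(1)]] by simp
    show "\<phi> (A \<odot>\<^bsub>M\<^esub> X) \<otimes>\<^bsub>K\<^esub> k = \<phi> X \<otimes>\<^bsub>K\<^esub> (A \<odot>\<^bsub>K\<^esub> k)"
      if A: "A \<in> carrier D" and X: "X \<in> carrier M" and k: "k \<in> carrier K" for A X k
    proof -
      obtain x where x: "x \<in> p" "X = p2 +> x" using X by (rule M_cases)
      obtain a where a: "a \<in> carrier R" "A = p +> a" using A unfolding D_carrier by blast
      show ?thesis
        unfolding x(2) a(2) M_smult[OF a(1) x(1)] \<phi>[OF x(1)] \<phi>[OF ideal_mult_mem[OF p_ideal a(1) x(1)]]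
          val_smult[OF a(1) x(1)]
        by (rule D.frac_smult_mult(1)[OF coset_in_D[OF a(1)] valK[OF x(1)] k])
    qed
    show "p2 +> x0 \<in> carrier M" unfolding M_carrier using x0(1) by (rule imageI)
    show "\<one>\<^bsub>K\<^esub> \<in> carrier K" by (rule conormal.K.one_closed)
    have "\<one>\<^bsub>K\<^esub> \<noteq> \<zero>\<^bsub>K\<^esub>"
      using D.frac_field_field by (simp add: field_def domain_def domain_axioms_def)
    then show "\<phi> (p2 +> x0) \<otimes>\<^bsub>K\<^esub> \<one>\<^bsub>K\<^esub> \<noteq> \<one>\<^bsub>add_monoid K\<^esub>"
      unfolding \<phi>[OF x0(1)] val_x0 by simp
  qed
  then show False using rank unfolding module_rank_zero_iff_trivial by simp
qed

lemma module_rank_zero_iff: "module_rank D M = 0 \<longleftrightarrow> (\<exists>s\<in>carrier R - p. \<forall>x\<in>p. s \<otimes> x \<in> p2)"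
  using module_rank_zero_if_torsion torsion_if_module_rank_zero by blast

lemma iso_artinian_length_rank:
  shows "iso_artinian R \<longleftrightarrow> module_length R (ideal_module R p) < \<infinity>"
    and "module_length R (ideal_module R p) < \<infinity> \<longleftrightarrow> module_rank D M = 0"
proof -
  have len_ann: "bounded_chains p \<longleftrightarrow> (\<exists>s\<in>carrier R - p. \<forall>x\<in>p. s \<otimes> x = \<zero>)"
    using annihilated_if_bounded_chains bounded_chains_if_annihilated by blast
  have ann_tors: "(\<exists>s\<in>carrier R - p. \<forall>x\<in>p. s \<otimes> x = \<zero>) \<longleftrightarrow> (\<exists>s\<in>carrier R - p. \<forall>x\<in>p. s \<otimes> x \<in> p2)"
    using annihilated_if_torsion_conormal ideal_zero_mem[OF p2_ideal] by metis
  show "module_length R (ideal_module R p) < \<infinity> \<longleftrightarrow> module_rank D M = 0"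
    unfolding module_length_finite_iff[OF p_ideal] module_rank_zero_iff len_ann ann_tors ..
  show "iso_artinian R \<longleftrightarrow> module_length R (ideal_module R p) < \<infinity>"
    unfolding module_length_finite_iff[OF p_ideal]
    using iso_artinian_if_bounded_chains torsion_conormal_if_iso_artinian len_ann ann_tors by blast
qed

end

section \<open>The equivalence\<close>

text \<open>A prime \<open>q\<close> that is not minimal contains a strictly smaller prime, and this one is minimal, as
  otherwise there would be a chain of three primes. So \<open>p\<close>, the only minimal prime, is contained in
  every prime. A chain of two primes exists as the dimension is not zero; its first member is \<open>p\<close>.\<close>
lemma one_dim_pidI:
  fixes R (structure)
  assumes R: "cring R" "noetherian_ring R"
    and dim: "krull_dim R = 1" and min: "min_primes R = {p}"
    and pid: "principal_domain (R Quot p)"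
  shows "one_dim_pid R p"
proof -
  interpret cring R by (rule R(1))
  interpret p: primeideal p R using min by (auto simp: min_primes_def)
  let ?S = "{enat n | n. \<exists>P. (\<forall>i\<le>n. primeideal (P i) R) \<and> (\<forall>i<n. P i \<subset> P (Suc i))}"
  have Sup: "Sup ?S = 1" using dim by (simp add: krull_dim_def)
  have minimal: "q = p" if "primeideal q R" "\<And>q'. \<lbrakk>primeideal q' R; q' \<subseteq> q\<rbrakk> \<Longrightarrow> q' = q" for q
  proof -
    have "q \<in> min_primes R" using that by (simp add: min_primes_def)
    then show ?thesis using min by simp
  qed
  show ?thesis
  proof (rule one_dim_pid.intro)
    show "noetherian_cring R" using R by (rule noetherian_cring.intro)
    show "primeideal p R" by (rule p.primeideal)
    show "one_dim_pid_axioms R p"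
    proof
      fix q assume q: "primeideal q R"
      show "p \<subseteq> q"
      proof (rule ccontr)
        assume np: "\<not> p \<subseteq> q"
        then obtain q1 where q1: "primeideal q1 R" "q1 \<subset> q" using minimal[OF q] by blast
        have "q1 \<noteq> p" using np q1 by blast
        then obtain q2 where q2: "primeideal q2 R" "q2 \<subset> q1" using minimal[OF q1(1)] by blast
        define P where "P i = (if i = 0 then q2 else if i = 1 then q1 else q)" for i :: nat
        have "(\<forall>i\<le>2. primeideal (P i) R) \<and> (\<forall>i<2. P i \<subset> P (Suc i))"
          using q q1 q2 by (auto simp: P_def less_2_cases_iff)
        then have "enat 2 \<le> Sup ?S" by (intro Sup_upper) blast
        then show False unfolding Sup by (simp add: one_enat_def)
      qed
    next
      show "\<exists>q. primeideal q R \<and> p \<subset> q"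
      proof (rule ccontr)
        assume no: "\<not> ?thesis"
        have "n = 0" if P: "\<forall>i\<le>n. primeideal (P i) R" "\<forall>i<n. P i \<subset> P (Suc i)" for n and P :: "nat \<Rightarrow> 'a set"
        proof (rule ccontr)
          assume "n \<noteq> 0"
          then have P01: "primeideal (P 0) R" "primeideal (P 1) R" "P 0 \<subset> P 1" using P by auto
          have "P 0 = p"
          proof (rule minimal[OF P01(1)])
            fix q' assume q': "primeideal q' R" "q' \<subseteq> P 0"
            show "q' = P 0"
            proof (rule ccontr)
              assume "q' \<noteq> P 0"
              then have "q' \<subset> P 0" using q' by blast
              define P' where "P' i = (if i = 0 then q' else if i = 1 then P 0 else P 1)" for i :: nat
              have "(\<forall>i\<le>2. primeideal (P' i) R) \<and> (\<forall>i<2. P' i \<subset> P' (Suc i))"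
                using q' P01 \<open>q' \<subset> P 0\<close> by (auto simp: P'_def less_2_cases_iff)
              then have "enat 2 \<le> Sup ?S" by (intro Sup_upper) blast
              then show False unfolding Sup by (simp add: one_enat_def)
            qed
          qed
          then show False using no P01 by blast
        qed
        then have "Sup ?S \<le> 0" by (intro Sup_least) (auto simp: zero_enat_def)
        then show False unfolding Sup by simp
      qed
    next
      fix I assume I: "ideal I R" "p \<subseteq> I"
      interpret D: principal_domain "R Quot p" by (rule pid)
      note IC = subsetD[OF ideal_subset_carrier[OF I(1)]]
      have "ideal ((+>) p ` I) (R Quot p)"
        using ring_ideal_imp_quot_ideal[OF p.is_ideal I(1)] .
      then obtain A where A: "A \<in> carrier (R Quot p)" "(+>) p ` I = PIdl\<^bsub>R Quot p\<^esub> A"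
        using D.exists_gen by blast
      have "A \<in> (+>) p ` I" unfolding A(2) by (rule D.cgenideal_self[OF A(1)])
      then obtain t where t: "t \<in> I" "A = p +> t" by blast
      have "\<exists>r\<in>carrier R. x \<ominus> r \<otimes> t \<in> p" if x: "x \<in> I" for x
      proof -
        have "p +> x \<in> PIdl\<^bsub>R Quot p\<^esub> A" unfolding A(2)[symmetric] using x by (rule imageI)
        then obtain B where B: "B \<in> carrier (R Quot p)" "p +> x = B \<otimes>\<^bsub>R Quot p\<^esub> A"
          unfolding cgenideal_def by blast
        obtain r where r: "r \<in> carrier R" "B = p +> r"
          using B(1) by (auto simp: FactRing_def A_RCOSETS_defs a_r_coset_def r_coset_def)
        have "p +> x = p +> (r \<otimes> t)"
          unfolding B(2) r(2) t(2) using r(1) IC[OF t(1)] by (simp add: FactRing_def p.rcoset_mult_add)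
        then have "x \<ominus> r \<otimes> t \<in> p"
          using quotient_eq_iff_same_a_r_cos[OF p.is_ideal IC[OF x], of "r \<otimes> t"] r(1) IC[OF t(1)] by simp
        then show ?thesis using r(1) by blast
      qed
      then show "\<exists>t\<in>I. \<forall>x\<in>I. \<exists>r\<in>carrier R. x \<ominus> r \<otimes> t \<in> p" using t(1) by blast
    qed
  qed
qed

theorem theorem6p1:
  fixes R :: "('a, 'b) ring_scheme" and p :: "'a set"
  assumes "cring R"
    and "noetherian_ring R"
    and "krull_dim R = 1"
    and "min_primes R = {p}"
    and "principal_domain (R Quot p)"
    and "min_primes R \<subset> ass_primes R (ideal_module R (carrier R))"
  shows "(iso_artinian R \<longleftrightarrow> module_length R (ideal_module R p) < \<infinity>)
    \<and> (module_length R (ideal_module R p) < \<infinity>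
        \<longleftrightarrow> module_rank (R Quot p) (conormal_module R p) = 0)
    \<and> (\<not> iso_artinian R \<longleftrightarrow> module_rank (R Quot p) (conormal_module R p) > 0)"
proof -
  interpret one_dim_pid R p by (rule one_dim_pidI[OF assms(1-5)])
  show ?thesis using iso_artinian_length_rank by (simp add: zero_less_iff_neq_zero)
qed

end
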